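(* The ideal $I(P_{ex})$ is invariant under any ring isomorphism: if $K$ is a field, $E$ and $F$ are arbitrary directed graphs and $\varphi:L_K(E)\to L_K(F)$ is a ring isomorphism, then $\varphi(I(P_{ex}^E))=I(P_{ex}^F)$.
   Context: A directed graph $E=(E^0,E^1,s,r)$ consists of arbitrary sets $E^0$ (vertices), $E^1$ (edges) and maps $s,r:E^1\to E^0$ (source, range). A vertex $v$ is a sink if $s^{-1}(v)=\emptyset$, an infinite emitter if $s^{-1}(v)$ is infinite, and regular otherwise. A path is a vertex (length $0$) or a finite sequence of edges $e_1\cdots e_n$ with $r(e_i)=s(e_{i+1})$. Write $u\ge v$ if there is a path from $u$ to $v$, and $T(v)=\{u\in E^0: v\ge u\}$. A set $H\subseteq E^0$ is hereditary if $v\in H$, $v\ge w$ imply $w\in H$. A closed simple path based at $v$ is a path $e_1\cdots e_n$, $n>0$, with $s(e_1)=r(e_n)=v$ and $s(e_i)\neq v$ for $i\ge 2$. A graph satisfies Condition (K) if for each vertex $v$ lying on a closed simple path there are at least two distinct closed simple paths based at $v$. For a hereditary $H\subseteq E^0$ the restriction graph $E_H$ has vertex set $H$, edge set $\{e\in E^1: s(e)\in H\}$, and source and range maps restricted from $E$; $H$ satisfies Condition (K) if $E_H$ does. Set $P_{(K)}=\{v\in E^0: T(v)\text{ satisfies Condition (K)}\}$, a hereditary set. For a hereditary $H\subseteq E^0$, $B_H=\{v\in E^0\setminus H: v\text{ is an infinite emitter and }0<|s^{-1}(v)\cap r^{-1}(E^0\setminus H)|<\infty\}$, and for $v\in B_H$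 put $v^H=v-\sum_{e\in s^{-1}(v)\cap r^{-1}(E^0\setminus H)}ee^*\in L_K(E)$. Define $P_{ex}=P_{ex}^E=P_{(K)}\cup\{v^{H}: v\in B_{H}\}$ with $H=P_{(K)}$. The Leavitt path algebra $L_K(E)$ is the $K$-algebra generated by $\{v: v\in E^0\}\cup\{e,e^*: e\in E^1\}$ subject to: $vw=\delta_{v,w}v$ for $v,w\in E^0$; $s(e)e=e\,r(e)=e$ and $r(e)e^*=e^*s(e)=e^*$ for $e\in E^1$; $e^*e'=\delta_{e,e'}r(e)$ for $e,e'\in E^1$; $v=\sum_{s(e)=v}ee^*$ for every regular vertex $v$. $I(X)$ is the two-sided ideal generated by $X$. *)

theory Defs
  imports
    "Graph_Theory.Digraph"
    "Graph_Theory.Arc_Walk"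
    "HOL-Algebra.QuotRing"
    "HOL-Library.Poly_Mapping"
begin

section \<open>Directed graphs\<close>

text \<open>
  Graphs are those of \<^locale>\<open>wf_digraph\<close>: \<^const>\<open>verts\<close>, \<^const>\<open>arcs\<close> are arbitrary sets
  (possibly infinite, with loops and parallel arcs), \<^const>\<open>tail\<close> is the source map and
  \<^const>\<open>head\<close> the range map.  Paths are the arc walks of \<^const>\<open>pre_digraph.awalk\<close>; the
  path of length 0 at a vertex is the empty arc list.
\<close>

definition path_ge :: "('v,'e) pre_digraph \<Rightarrow> 'v \<Rightarrow> 'v \<Rightarrow> bool" where
  "path_ge E u v \<longleftrightarrow> (\<exists>p. pre_digraph.awalk E u p v)"

definition tree :: "('v,'e) pre_digraph \<Rightarrow> 'v \<Rightarrow> 'v set" where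
  "tree E v = {u \<in> verts E. path_ge E v u}"

definition infinite_emitter :: "('v,'e) pre_digraph \<Rightarrow> 'v \<Rightarrow> bool" where
  "infinite_emitter E v \<longleftrightarrow> v \<in> verts E \<and> infinite (out_arcs E v)"

definition sink :: "('v,'e) pre_digraph \<Rightarrow> 'v \<Rightarrow> bool" where
  "sink E v \<longleftrightarrow> v \<in> verts E \<and> out_arcs E v = {}"

definition regular :: "('v,'e) pre_digraph \<Rightarrow> 'v \<Rightarrow> bool" where
  "regular E v \<longleftrightarrow> v \<in> verts E \<and> \<not> sink E v \<and> \<not> infinite_emitter E v"

definition closed_simple_path :: "('v,'e) pre_digraph \<Rightarrow> 'v \<Rightarrow> 'e list \<Rightarrow> bool" where
  "closed_simple_path E v p \<longleftrightarrow>
     pre_digraph.awalk E v p v \<and> p \<noteq> [] \<and> (\<forall>e \<in> set (tl p). tail E e \<noteq> v)"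

definition condition_K :: "('v,'e) pre_digraph \<Rightarrow> bool" where
  "condition_K E \<longleftrightarrow>
     (\<forall>v \<in> verts E.
        (\<exists>w p. closed_simple_path E w p \<and> v \<in> set (pre_digraph.awalk_verts E w p)) \<longrightarrow>
        (\<exists>p q. p \<noteq> q \<and> closed_simple_path E v p \<and> closed_simple_path E v q))"

text \<open>The restriction graph; well-formed when \<open>H\<close> is hereditary.\<close>

definition restriction :: "('v,'e) pre_digraph \<Rightarrow> 'v set \<Rightarrow> ('v,'e) pre_digraph" where
  "restriction E H = E\<lparr>verts := H, arcs := {e \<in> arcs E. tail E e \<in> H}\<rparr>"

definition P_K :: "('v,'e) pre_digraph \<Rightarrow> 'v set" where
  "P_K E = {v \<in> verts E. condition_K (restriction E (tree E v))}"

definition arcs_leaving_into_compl :: "('v,'e) pre_digraph \<Rightarrow> 'v set \<Rightarrow> 'v \<Rightarrow> 'e set" where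
  "arcs_leaving_into_compl E H v = {e \<in> out_arcs E v. head E e \<in> verts E - H}"

definition breaking_vertices :: "('v,'e) pre_digraph \<Rightarrow> 'v set \<Rightarrow> 'v set" where
  "breaking_vertices E H =
     {v \<in> verts E - H. infinite_emitter E v \<and>
        arcs_leaving_into_compl E H v \<noteq> {} \<and> finite (arcs_leaving_into_compl E H v)}"


section \<open>Rings without unit\<close>

text \<open>
  The library has no carrier-based rings without unit.  The record type \<^typ>\<open>'a ring\<close>
  is used for them nevertheless; its field \<^const>\<open>one\<close> is then irrelevant, and need not lie in the
  carrier.  The notions below do not refer to it.
\<close>

definition rng_ideal :: "'a set \<Rightarrow> ('a,'b) ring_scheme \<Rightarrow> bool" where
  "rng_ideal I R \<longleftrightarrow> additive_subgroup I R \<and>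
     (\<forall>a \<in> I. \<forall>x \<in> carrier R. x \<otimes>\<^bsub>R\<^esub> a \<in> I \<and> a \<otimes>\<^bsub>R\<^esub> x \<in> I)"

definition rng_ideal_gen :: "('a,'b) ring_scheme \<Rightarrow> 'a set \<Rightarrow> 'a set" where
  "rng_ideal_gen R X = \<Inter>{I. rng_ideal I R \<and> X \<subseteq> I}"

definition rng_iso :: "('a,'c) ring_scheme \<Rightarrow> ('b,'d) ring_scheme \<Rightarrow> ('a \<Rightarrow> 'b) set" where
  "rng_iso R S = iso R S \<inter> iso (add_monoid R) (add_monoid S)"


section \<open>Leavitt path algebras\<close>

text \<open>
  With concatenation as addition on words, the convolution product of
  \<^theory>\<open>HOL-Library.Poly_Mapping\<close> makes the finitely supported functions from words over \<open>'g\<close> to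
  \<open>'k\<close> the free unital associative \<open>'k\<close>-algebra over the type \<open>'g\<close>.
\<close>

instantiation list :: (type) monoid_add
begin

definition zero_list :: "'a list" where "zero_list = []"

definition plus_list :: "'a list \<Rightarrow> 'a list \<Rightarrow> 'a list" where "plus_list = (@)"

instance
  by standard (simp_all add: zero_list_def plus_list_def)

end

datatype ('v,'e) lpa_gen = Vert 'v | Edge 'e | Ghost 'e

type_synonym ('k,'v,'e) lpa_word_alg = "('v,'e) lpa_gen list \<Rightarrow>\<^sub>0 'k"

definition lpa_gens :: "('v,'e) pre_digraph \<Rightarrow> ('v,'e) lpa_gen set" where
  "lpa_gens E = Vert ` verts E \<union> Edge ` arcs E \<union> Ghost ` arcs E"

text \<open>
  The free associative algebra without unit on the generators of \<open>E\<close>: its monomials are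
  the nonempty words.
\<close>

definition free_alg :: "('v,'e) pre_digraph \<Rightarrow> ('k::field,'v,'e) lpa_word_alg ring" where
  "free_alg E =
     \<lparr>carrier = {p. \<forall>w \<in> Poly_Mapping.keys p. w \<noteq> [] \<and> set w \<subseteq> lpa_gens E},
      mult = (*), one = 1, zero = 0, add = (+)\<rparr>"

definition gen :: "('v,'e) lpa_gen \<Rightarrow> ('k::field,'v,'e) lpa_word_alg" where
  "gen g = Poly_Mapping.single [g] 1"

definition scale :: "'k \<Rightarrow> ('k::field,'v,'e) lpa_word_alg \<Rightarrow> ('k,'v,'e) lpa_word_alg" where
  "scale c p = Poly_Mapping.map ((*) c) p"

text \<open>Each relation \<open>l = r\<close> is represented by the difference \<open>l - r\<close>.\<close>

inductive_set lpa_relations ::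
  "('v,'e) pre_digraph \<Rightarrow> ('k::field,'v,'e) lpa_word_alg set" for E where
  vert_vert: "\<lbrakk>v \<in> verts E; w \<in> verts E\<rbrakk> \<Longrightarrow>
    gen (Vert v) * gen (Vert w) - (if v = w then gen (Vert v) else 0) \<in> lpa_relations E"
| source_edge: "e \<in> arcs E \<Longrightarrow>
    gen (Vert (tail E e)) * gen (Edge e) - gen (Edge e) \<in> lpa_relations E"
| edge_range: "e \<in> arcs E \<Longrightarrow>
    gen (Edge e) * gen (Vert (head E e)) - gen (Edge e) \<in> lpa_relations E"
| range_ghost: "e \<in> arcs E \<Longrightarrow>
    gen (Vert (head E e)) * gen (Ghost e) - gen (Ghost e) \<in> lpa_relations E"
| ghost_source: "e \<in> arcs E \<Longrightarrow>
    gen (Ghost e) * gen (Vert (tail E e)) - gen (Ghost e) \<in> lpa_relations E"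
| CK1: "\<lbrakk>e \<in> arcs E; f \<in> arcs E\<rbrakk> \<Longrightarrow>
    gen (Ghost e) * gen (Edge f) - (if e = f then gen (Vert (head E e)) else 0) \<in> lpa_relations E"
| CK2: "regular E v \<Longrightarrow>
    gen (Vert v) - (\<Sum>e \<in> out_arcs E v. gen (Edge e) * gen (Ghost e)) \<in> lpa_relations E"

text \<open>
  The \<open>'k\<close>-algebra ideal generated by the relations.  Closure under scalars has to be
  demanded: the free algebra has no unit, so its ring ideals need not be subspaces.
\<close>

definition lpa_kernel :: "('v,'e) pre_digraph \<Rightarrow> ('k::field,'v,'e) lpa_word_alg set" where
  "lpa_kernel E =
     \<Inter>{I. rng_ideal I (free_alg E) \<and> (\<forall>c. \<forall>a \<in> I. scale c a \<in> I) \<and> lpa_relations E \<subseteq> I}"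

type_synonym ('k,'v,'e) lpa_elem = "('k,'v,'e) lpa_word_alg set"

definition lpa :: "('v,'e) pre_digraph \<Rightarrow> ('k::field,'v,'e) lpa_elem ring" where
  "lpa E = free_alg E Quot lpa_kernel E"

definition lpa_class ::
  "('v,'e) pre_digraph \<Rightarrow> ('k::field,'v,'e) lpa_word_alg \<Rightarrow> ('k,'v,'e) lpa_elem" where
  "lpa_class E p = lpa_kernel E +>\<^bsub>free_alg E\<^esub> p"

definition lpa_vert :: "('v,'e) pre_digraph \<Rightarrow> 'v \<Rightarrow> ('k::field,'v,'e) lpa_elem" where
  "lpa_vert E v = lpa_class E (gen (Vert v))"

definition lpa_breaking ::
  "('v,'e) pre_digraph \<Rightarrow> 'v set \<Rightarrow> 'v \<Rightarrow> ('k::field,'v,'e) lpa_elem" where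
  "lpa_breaking E H v = lpa_class E
     (gen (Vert v) - (\<Sum>e \<in> arcs_leaving_into_compl E H v. gen (Edge e) * gen (Ghost e)))"

definition P_ex :: "('v,'e) pre_digraph \<Rightarrow> ('k::field,'v,'e) lpa_elem set" where
  "P_ex E = lpa_vert E ` P_K E \<union> lpa_breaking E (P_K E) ` breaking_vertices E (P_K E)"

end

theory Submission
  imports Defs "HOL-Library.Function_Algebras" "HOL-Library.Sublist"
begin

text \<open>
  The ideal \<open>I(P\<^sub>e\<^sub>x)\<close> consists of the elements \<open>a\<close> such that every \<open>b\<close> in the ideal \<open>(a)\<close> lies in \<open>(b)\<^sup>2\<close>,
  which is a purely ring theoretic description.

  Any nonzero element of a quotient \<open>A\<close> of \<open>L\<^sub>K(E)\<close> can be multiplied on both sides into either a nonzero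
  idempotent \<open>v - \<Sum> t t\<^sup>*\<close>, with \<open>t\<close> in a finite set of incomparable paths from \<open>v\<close>, or a nonzero
  polynomial, with a constant term, in closed paths at a vertex \<open>v\<close> that carries a closed simple path \<open>c\<close>
  with \<open>c c\<^sup>* = v\<close> in \<open>A\<close>.  Take \<open>b \<in> I(P\<^sub>e\<^sub>x)\<close> and \<open>A = L\<^sub>K(E)/(b)\<^sup>2\<close>, and suppose that \<open>b\<close> is nonzero in \<open>A\<close>.
  The ideal of \<open>b\<close> has square zero, so it contains no nonzero idempotent; and \<open>c c\<^sup>* = v\<close> forces all other closed
  simple paths at \<open>v\<close> to vanish, so \<open>v\<close> is not in \<open>P\<^sub>(\<^sub>K\<^sub>)\<close> and the corner of \<open>I(P\<^sub>e\<^sub>x)\<close> at \<open>v\<close> is zero in \<open>A\<close>.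

  Conversely let \<open>c\<close> be the only closed simple path at \<open>v\<close>.  The algebra acts on the functions from the
  infinite paths ending in \<open>c c c \<dots>\<close> to the Laurent polynomials, with edges of degree one, and \<open>v\<close> acts with
  rank one.  If \<open>a\<close> acts nontrivially, its ideal contains an element of the corner at \<open>v\<close> acting as
  \<open>f (1 - x\<^sup>n)\<close> with \<open>f \<noteq> 0\<close>, which does not lie in the square of its own ideal.  Finally, the reduction in
  \<open>A = L\<^sub>K(E)/I(P\<^sub>e\<^sub>x)\<close> shows that \<open>I(P\<^sub>e\<^sub>x)\<close> is the common kernel of these actions.
\<close>

section \<open>Two-sided ideals of a ring type\<close>

text \<open>The ideal \<open>(b)\<^sup>2\<close> need not be graded, so the quotient by it is in
  general not the Leavitt path algebra of a graph, and structure theorems for such algebras do not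
  reach it. The reduction is therefore carried out in an arbitrary homomorphic image, where
  \<open>c c^* = v\<close> can hold although \<open>c\<close> has exits in \<open>E\<close>. This
  equation separates the two outcomes: without it a finite cut at some stage isolates the constant
  term of a polynomial; with it every nonzero path from \<open>v\<close> runs along the cycle.

  The variable \<open>x\<close> counts edges. Without it \<open>c\<close> would act on its own
  infinite path as the identity and \<open>v - c\<close> as zero. With it the value is
  \<open>1 - x\<^sup>n\<close>, which is nonzero but vanishes at \<open>x = 1\<close>, hence is no
  unit; and in a domain a nonzero nonunit \<open>g\<close> is not divisible by
  \<open>g\<^sup>2\<close>.

  Neither the algebra nor its quotients need have a unit, and the quotients vary with
  \<open>b\<close>. Calculations therefore take place in the unital word algebra over the type of
  generators and in rings of additive maps.\<close>

definition two_sided :: "'a::ring set \<Rightarrow> bool" where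
  "two_sided D \<longleftrightarrow> 0 \<in> D \<and> (\<forall>x\<in>D. \<forall>y\<in>D. x + y \<in> D) \<and> (\<forall>x\<in>D. - x \<in> D) \<and>
     (\<forall>x\<in>D. \<forall>r. r * x \<in> D \<and> x * r \<in> D)"

definition ideal_gen :: "'a::ring set \<Rightarrow> 'a set" where
  "ideal_gen X = \<Inter>{D. two_sided D \<and> X \<subseteq> D}"

lemma two_sidedI:
  assumes "0 \<in> D" "\<And>x y. x \<in> D \<Longrightarrow> y \<in> D \<Longrightarrow> x + y \<in> D" "\<And>x. x \<in> D \<Longrightarrow> - x \<in> D"
    "\<And>r x. x \<in> D \<Longrightarrow> r * x \<in> D" "\<And>r x. x \<in> D \<Longrightarrow> x * r \<in> D"
  shows "two_sided D"
  using assms by (auto simp: two_sided_def)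

lemma two_sidedD:
  assumes "two_sided D"
  shows two_sided_0: "0 \<in> D"
    and two_sided_add: "x \<in> D \<Longrightarrow> y \<in> D \<Longrightarrow> x + y \<in> D"
    and two_sided_uminus: "x \<in> D \<Longrightarrow> - x \<in> D"
    and two_sided_diff: "x \<in> D \<Longrightarrow> y \<in> D \<Longrightarrow> x - y \<in> D"
    and two_sided_lmult: "x \<in> D \<Longrightarrow> r * x \<in> D"
    and two_sided_rmult: "x \<in> D \<Longrightarrow> x * r \<in> D"
proof -
  show "x \<in> D \<Longrightarrow> y \<in> D \<Longrightarrow> x - y \<in> D"
    using assms unfolding two_sided_def by (metis add_uminus_conv_diff)
qed (use assms in \<open>auto simp: two_sided_def\<close>)

lemma two_sided_sum:
  assumes "two_sided D" "\<And>i. i \<in> A \<Longrightarrow> f i \<in> D"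
  shows "sum f A \<in> D"
  using assms(2) by (induction A rule: infinite_finite_induct)
    (auto simp: two_sided_0[OF assms(1)] two_sided_add[OF assms(1)])

lemma two_sided_ideal_gen: "two_sided (ideal_gen X)"
  by (rule two_sidedI) (auto simp: ideal_gen_def two_sided_def)

lemma ideal_gen_superset: "X \<subseteq> ideal_gen X"
  by (auto simp: ideal_gen_def)

lemma ideal_gen_incl: "x \<in> X \<Longrightarrow> x \<in> ideal_gen X"
  using ideal_gen_superset by blast

lemma ideal_gen_minimal: "two_sided D \<Longrightarrow> X \<subseteq> D \<Longrightarrow> ideal_gen X \<subseteq> D"
  by (auto simp: ideal_gen_def)

section \<open>Evaluation of elements of the free algebra\<close>

lemma poly_mapping_sum_single:
  "p = (\<Sum>w\<in>Poly_Mapping.keys p. Poly_Mapping.single w (Poly_Mapping.lookup p w))"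
  by (rule poly_mapping_eqI)
    (auto simp: lookup_sum lookup_single when_def sum.delta in_keys_iff)

abbreviation const :: "'k::field \<Rightarrow> ('k,'v,'e) lpa_word_alg" where
  "const c \<equiv> Poly_Mapping.single [] c"

lemma single_list_mult:
  "Poly_Mapping.single (v :: 'g list) (a :: 'k::field) * Poly_Mapping.single w b =
    Poly_Mapping.single (v @ w) (a * b)"
  by (simp add: mult_single plus_list_def)

lemma const_1: "const 1 = 1"
  by (metis single_one zero_list_def)

lemma const_mult_comm: "const c * p = p * const c"
proof -
  have "const c * (\<Sum>w\<in>Poly_Mapping.keys p. Poly_Mapping.single w (Poly_Mapping.lookup p w)) =
    (\<Sum>w\<in>Poly_Mapping.keys p. Poly_Mapping.single w (Poly_Mapping.lookup p w)) * const c"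
    by (simp add: sum_distrib_left sum_distrib_right single_list_mult mult.commute)
  then show ?thesis
    using poly_mapping_sum_single[of p] by simp
qed

lemma scale_eq: "scale c p = const c * p"
  unfolding scale_def by (subst mult_map_scale_conv_mult) (simp add: zero_list_def)

lemma single_Cons: "Poly_Mapping.single (g # w) c = gen g * Poly_Mapping.single w c"
  by (simp add: gen_def single_list_mult)

text \<open>The universal property of the free algebra, used to kill foreign generators, to read off
  constant terms and to build a representation. The class \<open>ring\<close> with
  \<open>monoid_mult\<close> replaces \<open>ring_1\<close>, which demands
  \<open>0 \<noteq> 1\<close> and so excludes the additive maps of a trivial group.\<close>

locale word_eval =
  fixes sc :: "'k::field \<Rightarrow> 'b::{ring,monoid_mult}" and g :: "'g \<Rightarrow> 'b"
  assumes sc_add: "sc (a + b) = sc a + sc b"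
    and sc_mult: "sc (a * b) = sc a * sc b"
    and sc_1: "sc 1 = 1"
    and sc_comm: "sc a * g x = g x * sc a"
begin

lemma sc_0: "sc 0 = 0"
  using sc_add[of 0 0] by simp

lemma sc_prod_list: "sc a * prod_list (map g w) = prod_list (map g w) * sc a"
  by (induction w) (auto simp: sc_comm mult.assoc simp flip: mult.assoc[of "sc a"])

definition ev :: "('g list \<Rightarrow>\<^sub>0 'k) \<Rightarrow> 'b" where
  "ev p = (\<Sum>w\<in>Poly_Mapping.keys p. sc (Poly_Mapping.lookup p w) * prod_list (map g w))"

lemma ev_superset:
  assumes "finite S" "Poly_Mapping.keys p \<subseteq> S"
  shows "ev p = (\<Sum>w\<in>S. sc (Poly_Mapping.lookup p w) * prod_list (map g w))"
  unfolding ev_def using assms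
  by (intro sum.mono_neutral_left) (auto simp: in_keys_iff sc_0)

lemma ev_0: "ev 0 = 0"
  by (simp add: ev_def)

lemma ev_add: "ev (p + q) = ev p + ev q"
proof -
  let ?S = "Poly_Mapping.keys p \<union> Poly_Mapping.keys q"
  have "ev (p + q) = (\<Sum>w\<in>?S. sc (Poly_Mapping.lookup (p + q) w) * prod_list (map g w))"
    by (rule ev_superset) (use keys_add[of p q] in auto)
  also have "\<dots> = ev p + ev q"
    by (simp add: ev_superset[of ?S] lookup_add sc_add distrib_right sum.distrib)
  finally show ?thesis .
qed

lemma ev_uminus: "ev (- p) = - ev p"
  using ev_add[of p "-p"] by (simp add: ev_0 eq_neg_iff_add_eq_0 add.commute)

lemma ev_sum: "ev (sum f A) = (\<Sum>i\<in>A. ev (f i))"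
  by (induction A rule: infinite_finite_induct) (auto simp: ev_0 ev_add)

lemma ev_single: "ev (Poly_Mapping.single w c) = sc c * prod_list (map g w)"
  by (subst ev_superset[of "{w}"]) auto

lemma ev_mult: "ev (p * q) = ev p * ev q"
proof -
  have *: "ev (Poly_Mapping.single v a * Poly_Mapping.single w b) =
      ev (Poly_Mapping.single v a) * ev (Poly_Mapping.single w b)" for v w a b
    by (simp add: mult_single plus_list_def ev_single sc_mult)
      (metis mult.assoc sc_prod_list)
  have "ev ((\<Sum>w\<in>Poly_Mapping.keys p. Poly_Mapping.single w (Poly_Mapping.lookup p w)) *
        (\<Sum>w\<in>Poly_Mapping.keys q. Poly_Mapping.single w (Poly_Mapping.lookup q w))) =
      ev (\<Sum>w\<in>Poly_Mapping.keys p. Poly_Mapping.single w (Poly_Mapping.lookup p w)) *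
        ev (\<Sum>w\<in>Poly_Mapping.keys q. Poly_Mapping.single w (Poly_Mapping.lookup q w))"
    by (simp add: ev_sum sum_product *)
  then show ?thesis
    by (simp flip: poly_mapping_sum_single)
qed

end

section \<open>The defining relations as an ideal of the full word algebra\<close>

text \<open>An ideal of the whole unital word algebra, where the ambient ring is a type. Foreign
  generators are killed too, so the quotient is \<open>L_K(E)\<close> with a unit adjoined.\<close>

definition rel_ideal :: "('v,'e) pre_digraph \<Rightarrow> ('k::field,'v,'e) lpa_word_alg set" where
  "rel_ideal E = ideal_gen (lpa_relations E \<union> gen ` (- lpa_gens E))"

definition kill_foreign :: "('v,'e) pre_digraph \<Rightarrow> ('v,'e) lpa_gen \<Rightarrow> ('k::field,'v,'e) lpa_word_alg" where
  "kill_foreign E g = (if g \<in> lpa_gens E then gen g else 0)"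

text \<open>Killing the foreign generators retracts the word algebra onto the unital subalgebra of \<open>E\<close>.\<close>

global_interpretation retract: word_eval const "kill_foreign E"
  defines retract = "retract.ev"
  by unfold_locales (auto simp: single_add single_list_mult const_1 const_mult_comm)

abbreviation free_carrier :: "('v,'e) pre_digraph \<Rightarrow> ('k::field,'v,'e) lpa_word_alg set" where
  "free_carrier E \<equiv> carrier (free_alg E)"

lemma free_carrier_iff:
  "p \<in> free_carrier E \<longleftrightarrow> (\<forall>w \<in> Poly_Mapping.keys p. w \<noteq> [] \<and> set w \<subseteq> lpa_gens E)"
  by (simp add: free_alg_def)

lemma prod_list_retract:
  "prod_list (map (kill_foreign E) w) =
    (if set w \<subseteq> lpa_gens E then Poly_Mapping.single w 1 else 0)"
  by (induction w) (auto simp: const_1 single_Cons kill_foreign_def)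

lemma retract_gen: "retract E (gen g) = kill_foreign E g"
  by (simp add: gen_def retract.ev_single const_1)

lemma retract_eq:
  "retract E p = (\<Sum>w\<in>Poly_Mapping.keys p.
     if set w \<subseteq> lpa_gens E then Poly_Mapping.single w (Poly_Mapping.lookup p w) else 0)"
  unfolding retract.ev_def prod_list_retract
  by (intro sum.cong) (auto simp: single_list_mult)

lemma lookup_retract:
  "Poly_Mapping.lookup (retract E p) w = (if set w \<subseteq> lpa_gens E then Poly_Mapping.lookup p w else 0)"
proof -
  have "Poly_Mapping.lookup (retract E p) w =
    (\<Sum>w'\<in>Poly_Mapping.keys p. if w' = w then (if set w \<subseteq> lpa_gens E then Poly_Mapping.lookup p w else 0) else 0)"
    unfolding retract_eq lookup_sum
    by (intro sum.cong) (auto simp: lookup_single when_def)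
  also have "\<dots> = (if set w \<subseteq> lpa_gens E then Poly_Mapping.lookup p w else 0)"
    by (auto simp: in_keys_iff)
  finally show ?thesis .
qed

lemma retract_id: "p \<in> free_carrier E \<Longrightarrow> retract E p = p"
  by (rule poly_mapping_eqI) (auto simp: lookup_retract free_carrier_iff in_keys_iff)

lemma retract_in_free: "Poly_Mapping.lookup p [] = 0 \<Longrightarrow> retract E p \<in> free_carrier E"
  by (auto simp: free_carrier_iff in_keys_iff lookup_retract split: if_splits)

lemma free_carrier_no_const: "p \<in> free_carrier E \<Longrightarrow> Poly_Mapping.lookup p [] = 0"
  by (auto simp: free_carrier_iff in_keys_iff)

text \<open>Sending all generators to 0 is a homomorphism and returns the constant term. Hence a
  product with one factor free of constant term has none, which is what
  \<open>retract_in_free\<close> asks for.\<close>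

lemma lookup_Nil_mult:
  "Poly_Mapping.lookup (p * q) [] = Poly_Mapping.lookup p [] * Poly_Mapping.lookup (q :: 'g list \<Rightarrow>\<^sub>0 'k::field) []"
proof -
  interpret i: word_eval "\<lambda>c::'k. c" "\<lambda>g::'g. 0"
    by unfold_locales (auto simp: mult.commute)
  have *: "i.ev p = Poly_Mapping.lookup p []" for p :: "'g list \<Rightarrow>\<^sub>0 'k"
  proof -
    have *: "prod_list (map (\<lambda>g. 0) w) = (if w = [] then 1 else (0::'k))" for w :: "'g list"
      by (cases w) auto
    have "i.ev p = (\<Sum>w\<in>Poly_Mapping.keys p. if w = [] then Poly_Mapping.lookup p [] else 0)"
      unfolding i.ev_def by (rule sum.cong) (simp_all add: *)
    then show ?thesis
      by (auto simp: in_keys_iff)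
  qed
  show ?thesis
    using i.ev_mult[of p q] by (simp add: *)
qed

lemma
  fixes p q :: "('k::field,'v,'e) lpa_word_alg"
  shows free_carrier_0: "(0 :: ('k,'v,'e) lpa_word_alg) \<in> free_carrier E"
  and free_carrier_add: "p \<in> free_carrier E \<Longrightarrow> q \<in> free_carrier E \<Longrightarrow> p + q \<in> free_carrier E"
  and free_carrier_uminus: "p \<in> free_carrier E \<Longrightarrow> - p \<in> free_carrier E"
  and free_carrier_diff: "p \<in> free_carrier E \<Longrightarrow> q \<in> free_carrier E \<Longrightarrow> p - q \<in> free_carrier E"
proof -
  show *: "p \<in> free_carrier E \<Longrightarrow> q \<in> free_carrier E \<Longrightarrow> p + q \<in> free_carrier E" for p q :: "('k,'v,'e) lpa_word_alg"
    using keys_add[of p q] by (fastforce simp: free_carrier_iff)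
  show **: "p \<in> free_carrier E \<Longrightarrow> - p \<in> free_carrier E" for p :: "('k,'v,'e) lpa_word_alg"
    by (simp add: free_carrier_iff in_keys_iff)
  show "p \<in> free_carrier E \<Longrightarrow> q \<in> free_carrier E \<Longrightarrow> p - q \<in> free_carrier E"
    using *[of p "- q"] ** by simp
qed (simp add: free_carrier_iff)

lemma free_carrier_mult:
  assumes "p \<in> free_carrier E" "q \<in> free_carrier E"
  shows "p * q \<in> free_carrier E"
  unfolding free_carrier_iff
proof
  fix w assume "w \<in> Poly_Mapping.keys (p * q)"
  then obtain u v where "w = u @ v" "u \<in> Poly_Mapping.keys p" "v \<in> Poly_Mapping.keys q"
    using keys_mult[of p q] by (auto simp: plus_list_def)
  then show "w \<noteq> [] \<and> set w \<subseteq> lpa_gens E"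
    using assms by (auto simp: free_carrier_iff)
qed

lemma free_carrier_const_mult: "p \<in> free_carrier E \<Longrightarrow> const c * p \<in> free_carrier E"
  by (auto simp: free_carrier_iff in_keys_iff simp flip: scale_eq simp: scale_def map.rep_eq)

lemma free_carrier_sum: "(\<And>i. i \<in> A \<Longrightarrow> f i \<in> free_carrier E) \<Longrightarrow> sum f A \<in> free_carrier E"
  by (induction A rule: infinite_finite_induct) (auto simp: free_carrier_0 free_carrier_add)

lemma gen_in_free: "gen g \<in> free_carrier E \<longleftrightarrow> g \<in> lpa_gens E"
  by (auto simp: gen_def free_carrier_iff)

lemma free_alg_simps [simp]:
  "x \<otimes>\<^bsub>free_alg E\<^esub> y = x * y" "x \<oplus>\<^bsub>free_alg E\<^esub> y = x + y" "\<zero>\<^bsub>free_alg E\<^esub> = 0"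
  by (auto simp: free_alg_def)

lemma lpa_gens_simps [simp]:
  "Vert v \<in> lpa_gens E \<longleftrightarrow> v \<in> verts E"
  "Edge e \<in> lpa_gens E \<longleftrightarrow> e \<in> arcs E"
  "Ghost e \<in> lpa_gens E \<longleftrightarrow> e \<in> arcs E"
  by (auto simp: lpa_gens_def)

lemma relations_in_free:
  fixes E :: "('v,'e) pre_digraph"
  assumes "wf_digraph E"
  shows "(lpa_relations E :: ('k::field,'v,'e) lpa_word_alg set) \<subseteq> free_carrier E"
proof
  interpret wf_digraph E by fact
  fix x :: "('k,'v,'e) lpa_word_alg" assume "x \<in> lpa_relations E"
  then show "x \<in> free_carrier E"
    by cases (auto intro!: free_carrier_diff free_carrier_mult free_carrier_sum
      simp: gen_in_free free_carrier_0 regular_def)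
qed

section \<open>Ideals generated by sets in rings without unit\<close>

text \<open>Just enough structure for generated ideals to exist and for isomorphisms to be
  inverted.\<close>

definition rng :: "('a,'b) ring_scheme \<Rightarrow> bool" where
  "rng R \<longleftrightarrow> group (add_monoid R) \<and> (\<forall>x\<in>carrier R. \<forall>y\<in>carrier R. x \<otimes>\<^bsub>R\<^esub> y \<in> carrier R)"

lemma rng_ideal_carrier: "rng R \<Longrightarrow> rng_ideal (carrier R) R"
  unfolding rng_def rng_ideal_def additive_subgroup_def
  by (auto intro: group.subgroup_self[of "add_monoid R", simplified])

lemma rng_ideal_subset: "rng_ideal I R \<Longrightarrow> I \<subseteq> carrier R"
  unfolding rng_ideal_def by (auto dest: additive_subgroup.a_subset)

lemma rng_ideal_gen_incl: "x \<in> X \<Longrightarrow> x \<in> rng_ideal_gen R X"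
  by (auto simp: rng_ideal_gen_def)

lemma rng_ideal_gen_minimal: "rng_ideal I R \<Longrightarrow> X \<subseteq> I \<Longrightarrow> rng_ideal_gen R X \<subseteq> I"
  by (auto simp: rng_ideal_gen_def)

lemma rng_ideal_gen_subset: "rng R \<Longrightarrow> X \<subseteq> carrier R \<Longrightarrow> rng_ideal_gen R X \<subseteq> carrier R"
  by (rule rng_ideal_gen_minimal) (auto intro: rng_ideal_carrier)

lemma rng_ideal_gen_ideal:
  assumes "rng R" "X \<subseteq> carrier R"
  shows "rng_ideal (rng_ideal_gen R X) R"
proof -
  interpret group "add_monoid R" using assms(1) by (simp add: rng_def)
  let ?S = "{I. rng_ideal I R \<and> X \<subseteq> I}"
  have "?S \<noteq> {}" using rng_ideal_carrier[OF assms(1)] assms(2) by blast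
  then have "subgroup (\<Inter>?S) (add_monoid R)"
    by (intro subgroups_Inter) (auto simp: rng_ideal_def additive_subgroup_def)
  then show ?thesis
    unfolding rng_ideal_def rng_ideal_gen_def additive_subgroup_def by auto
qed

lemma rng_isoD:
  assumes "\<phi> \<in> rng_iso R S"
  shows rng_iso_mult: "x \<in> carrier R \<Longrightarrow> y \<in> carrier R \<Longrightarrow> \<phi> (x \<otimes>\<^bsub>R\<^esub> y) = \<phi> x \<otimes>\<^bsub>S\<^esub> \<phi> y"
    and rng_iso_bij: "bij_betw \<phi> (carrier R) (carrier S)"
  using assms by (auto simp: rng_iso_def iso_def hom_def)

lemma rng_iso_inv:
  assumes "rng R" "\<phi> \<in> rng_iso R S"
  shows "inv_into (carrier R) \<phi> \<in> rng_iso S R"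
proof -
  let ?i = "inv_into (carrier R) \<phi>"
  have bij: "bij_betw \<phi> (carrier R) (carrier S)"
    by (rule rng_iso_bij[OF assms(2)])
  have "?i \<in> iso (add_monoid S) (add_monoid R)"
    using group.iso_set_sym[of "add_monoid R" \<phi> "add_monoid S"] assms
    by (simp add: rng_def rng_iso_def)
  moreover have "?i (x \<otimes>\<^bsub>S\<^esub> y) = ?i x \<otimes>\<^bsub>R\<^esub> ?i y" if "x \<in> carrier S" "y \<in> carrier S" for x y
  proof -
    have i: "?i x \<in> carrier R" "?i y \<in> carrier R"
      using bij that by (metis bij_betw_imp_surj_on inv_into_into)+
    have "\<phi> (?i x \<otimes>\<^bsub>R\<^esub> ?i y) = x \<otimes>\<^bsub>S\<^esub> y"
      using i that bij by (simp add: rng_iso_mult[OF assms(2)] bij_betw_inv_into_right)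
    moreover have "?i x \<otimes>\<^bsub>R\<^esub> ?i y \<in> carrier R"
      using i assms(1) by (simp add: rng_def)
    ultimately show ?thesis
      using bij by (metis bij_betw_inv_into_left)
  qed
  ultimately show ?thesis
    using bij_betw_inv_into[OF bij]
    by (auto simp: rng_iso_def iso_def hom_def bij_betw_def)
qed

lemma rng_ideal_image:
  assumes "rng R" "rng S" "\<phi> \<in> rng_iso R S" "rng_ideal I R"
  shows "rng_ideal (\<phi> ` I) S"
proof -
  have "group_hom (add_monoid R) (add_monoid S) \<phi>"
    using assms by (auto simp: rng_def rng_iso_def iso_def group_hom_def group_hom_axioms_def)
  then have "additive_subgroup (\<phi> ` I) S"
    using assms(4) unfolding rng_ideal_def additive_subgroup_def
    by (intro group_hom.subgroup_img_is_subgroup) auto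
  moreover have "x \<otimes>\<^bsub>S\<^esub> \<phi> a \<in> \<phi> ` I \<and> \<phi> a \<otimes>\<^bsub>S\<^esub> x \<in> \<phi> ` I"
    if ax: "a \<in> I" "x \<in> carrier S" for a x
  proof -
    obtain y where y: "y \<in> carrier R" "x = \<phi> y"
      using rng_iso_bij[OF assms(3)] ax(2) by (auto simp: bij_betw_def)
    have "a \<in> carrier R" using ax(1) assms(4) rng_ideal_subset by blast
    then have "x \<otimes>\<^bsub>S\<^esub> \<phi> a = \<phi> (y \<otimes>\<^bsub>R\<^esub> a)" "\<phi> a \<otimes>\<^bsub>S\<^esub> x = \<phi> (a \<otimes>\<^bsub>R\<^esub> y)"
      using y by (simp_all add: rng_iso_mult[OF assms(3)])
    then show ?thesis
      using ax(1) y(1) assms(4) by (auto simp: rng_ideal_def)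
  qed
  ultimately show ?thesis by (auto simp: rng_ideal_def)
qed

lemma rng_ideal_gen_image:
  assumes "rng R" "rng S" "\<phi> \<in> rng_iso R S" "X \<subseteq> carrier R"
  shows "\<phi> ` rng_ideal_gen R X = rng_ideal_gen S (\<phi> ` X)"
proof
  let ?i = "inv_into (carrier R) \<phi>"
  have bij: "bij_betw \<phi> (carrier R) (carrier S)"
    by (rule rng_iso_bij[OF assms(3)])
  show "rng_ideal_gen S (\<phi> ` X) \<subseteq> \<phi> ` rng_ideal_gen R X"
    using assms by (intro rng_ideal_gen_minimal rng_ideal_image[OF assms(1,2,3)] rng_ideal_gen_ideal)
      (auto intro: rng_ideal_gen_incl)
  have \<phi>X: "\<phi> ` X \<subseteq> carrier S"
    using assms(4) bij by (auto simp: bij_betw_def)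
  have "x \<in> ?i ` rng_ideal_gen S (\<phi> ` X)" if "x \<in> X" for x
  proof -
    have "\<phi> x \<in> rng_ideal_gen S (\<phi> ` X)" using that by (intro rng_ideal_gen_incl) auto
    moreover have "?i (\<phi> x) = x" using that assms(4) bij by (auto intro: bij_betw_inv_into_left)
    ultimately show ?thesis by force
  qed
  then have "rng_ideal_gen R X \<subseteq> ?i ` rng_ideal_gen S (\<phi> ` X)"
    by (intro rng_ideal_gen_minimal rng_ideal_image[OF assms(2,1) rng_iso_inv[OF assms(1,3)]]
      rng_ideal_gen_ideal[OF assms(2) \<phi>X]) auto
  then have "\<phi> ` rng_ideal_gen R X \<subseteq> \<phi> ` ?i ` rng_ideal_gen S (\<phi> ` X)" by blast
  also have "\<dots> = rng_ideal_gen S (\<phi> ` X)"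
  proof -
    have "\<phi> (?i y) = y" if "y \<in> rng_ideal_gen S (\<phi> ` X)" for y
      using rng_ideal_gen_subset[OF assms(2) \<phi>X] that bij by (auto intro: bij_betw_inv_into_right)
    then show ?thesis by (simp add: image_comp)
  qed
  finally show "\<phi> ` rng_ideal_gen R X \<subseteq> rng_ideal_gen S (\<phi> ` X)" .
qed

text \<open>Testing \<open>a\<close> alone would say little: the unit of the Laurent polynomials
  lies in the square of its own ideal, whereas its multiple \<open>1 - x\<close> does not. That the
  set is an ideal only emerges from its identification with \<open>I(P_ex)\<close>.\<close>

definition fully_idempotent_part :: "('a,'b) ring_scheme \<Rightarrow> 'a set" where
  "fully_idempotent_part R = {a \<in> carrier R. \<forall>b \<in> rng_ideal_gen R {a}.
     b \<in> rng_ideal_gen R {x \<otimes>\<^bsub>R\<^esub> y | x y. x \<in> rng_ideal_gen R {b} \<and> y \<in> rng_ideal_gen R {b}}}"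

lemma fully_idempotent_part_image_subset:
  assumes "rng R" "rng S" "\<phi> \<in> rng_iso R S"
  shows "\<phi> ` fully_idempotent_part R \<subseteq> fully_idempotent_part S"
proof
  fix z assume "z \<in> \<phi> ` fully_idempotent_part R"
  then obtain a where a: "a \<in> fully_idempotent_part R" "z = \<phi> a" by blast
  then have aR: "{a} \<subseteq> carrier R" by (simp add: fully_idempotent_part_def)
  have bij: "bij_betw \<phi> (carrier R) (carrier S)"
    by (rule rng_iso_bij[OF assms(3)])
  have "c \<in> rng_ideal_gen S {x \<otimes>\<^bsub>S\<^esub> y | x y. x \<in> rng_ideal_gen S {c} \<and> y \<in> rng_ideal_gen S {c}}"
    if c: "c \<in> rng_ideal_gen S {z}" for c
  proof -
    obtain b where b: "b \<in> rng_ideal_gen R {a}" "c = \<phi> b"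
      using rng_ideal_gen_image[OF assms aR] c a(2) by auto
    let ?B = "rng_ideal_gen R {b}"
    let ?P = "{x \<otimes>\<^bsub>R\<^esub> y | x y. x \<in> ?B \<and> y \<in> ?B}"
    have bR: "{b} \<subseteq> carrier R" using b rng_ideal_gen_subset[OF assms(1) aR] by auto
    note BR = rng_ideal_gen_subset[OF assms(1) bR]
    then have PR: "?P \<subseteq> carrier R" using assms(1) by (auto simp: rng_def)
    have "\<phi> b \<in> \<phi> ` rng_ideal_gen R ?P"
      using a b by (auto simp: fully_idempotent_part_def)
    also have "\<dots> = rng_ideal_gen S (\<phi> ` ?P)"
      by (rule rng_ideal_gen_image[OF assms PR])
    also have "\<phi> ` ?P = {x \<otimes>\<^bsub>S\<^esub> y | x y. x \<in> \<phi> ` ?B \<and> y \<in> \<phi> ` ?B}"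
    proof -
      have "\<phi> (x \<otimes>\<^bsub>R\<^esub> y) = \<phi> x \<otimes>\<^bsub>S\<^esub> \<phi> y" if "x \<in> ?B" "y \<in> ?B" for x y
        using that BR by (intro rng_iso_mult[OF assms(3)]) auto
      then show ?thesis by (auto simp: image_iff) metis+
    qed
    also have "\<phi> ` ?B = rng_ideal_gen S {c}"
      using rng_ideal_gen_image[OF assms bR] b(2) by simp
    finally show ?thesis using b(2) by simp
  qed
  moreover have "z \<in> carrier S" using aR a(2) bij by (auto simp: bij_betw_def)
  ultimately show "z \<in> fully_idempotent_part S" by (auto simp: fully_idempotent_part_def)
qed

lemma fully_idempotent_part_image:
  assumes "rng R" "rng S" "\<phi> \<in> rng_iso R S"
  shows "\<phi> ` fully_idempotent_part R = fully_idempotent_part S"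
proof
  let ?i = "inv_into (carrier R) \<phi>"
  have "\<phi> (?i y) = y" if "y \<in> fully_idempotent_part S" for y
    using rng_iso_bij[OF assms(3)] that
    by (auto simp: fully_idempotent_part_def intro: bij_betw_inv_into_right)
  then show "fully_idempotent_part S \<subseteq> \<phi> ` fully_idempotent_part R"
    using fully_idempotent_part_image_subset[OF assms(2,1) rng_iso_inv[OF assms(1,3)]]
    by (metis image_subset_iff rev_image_eqI subsetI)
qed (rule fully_idempotent_part_image_subset[OF assms])

section \<open>The Leavitt path algebra as a quotient of the word algebra\<close>

lemma abelian_group_free_alg: "abelian_group (free_alg E)"
proof (rule abelian_groupI)
  fix x assume "x \<in> free_carrier E"
  then show "\<exists>y\<in>free_carrier E. y \<oplus>\<^bsub>free_alg E\<^esub> x = \<zero>\<^bsub>free_alg E\<^esub>"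
    by (intro bexI[of _ "- x"]) (auto simp: free_carrier_uminus)
qed (auto simp: free_carrier_0 free_carrier_add ac_simps)

lemma inv_free_alg: "x \<in> free_carrier E \<Longrightarrow> inv\<^bsub>add_monoid (free_alg E)\<^esub> x = - x"
  unfolding a_inv_def[symmetric]
  by (rule abelian_group.minus_equality[OF abelian_group_free_alg])
    (auto simp: free_carrier_uminus)

lemma additive_subgroup_free_alg:
  "additive_subgroup I (free_alg E) \<longleftrightarrow>
    I \<subseteq> free_carrier E \<and> 0 \<in> I \<and> (\<forall>x\<in>I. \<forall>y\<in>I. x + y \<in> I) \<and> (\<forall>x\<in>I. - x \<in> I)"
  (is "?L \<longleftrightarrow> ?R")
proof
  assume ?L
  then have sub: "subgroup I (add_monoid (free_alg E))" by (rule additive_subgroup.a_subgroup)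
  have I: "I \<subseteq> free_carrier E" using subgroup.subset[OF sub] by simp
  moreover have "0 \<in> I" using subgroup.one_closed[OF sub] by simp
  moreover have "x + y \<in> I" if "x \<in> I" "y \<in> I" for x y
    using subgroup.m_closed[OF sub that] by simp
  moreover have "- x \<in> I" if "x \<in> I" for x
  proof -
    have "inv\<^bsub>add_monoid (free_alg E)\<^esub> x = - x"
      using that I by (intro inv_free_alg) auto
    then show ?thesis using subgroup.m_inv_closed[OF sub that] by simp
  qed
  ultimately show ?R by blast
next
  assume ?R
  then show ?L
  proof (intro additive_subgroup.intro subgroup.intro)
    fix x assume "x \<in> I"
    with \<open>?R\<close> show "inv\<^bsub>add_monoid (free_alg E)\<^esub> x \<in> I"
      by (subst inv_free_alg) auto
  qed auto
qed

lemma rng_ideal_free_alg: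
  "rng_ideal I (free_alg E) \<longleftrightarrow>
    I \<subseteq> free_carrier E \<and> 0 \<in> I \<and> (\<forall>x\<in>I. \<forall>y\<in>I. x + y \<in> I) \<and> (\<forall>x\<in>I. - x \<in> I) \<and>
    (\<forall>a\<in>I. \<forall>x\<in>free_carrier E. x * a \<in> I \<and> a * x \<in> I)"
  by (auto simp: rng_ideal_def additive_subgroup_free_alg)

lemma free_split:
  obtains r where "retract E p = const (Poly_Mapping.lookup p []) + r" "r \<in> free_carrier E"
proof
  show "retract E p = const (Poly_Mapping.lookup p []) + retract E (p - const (Poly_Mapping.lookup p []))"
    by (rule poly_mapping_eqI) (auto simp: lookup_retract lookup_add lookup_minus lookup_single when_def)
  show "retract E (p - const (Poly_Mapping.lookup p [])) \<in> free_carrier E"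
    by (rule retract_in_free) (simp add: lookup_minus)
qed

text \<open>After \<open>retract\<close>, any element of the word algebra is a scalar plus an
  element of the algebra without unit (\<open>free_split\<close>). Closure under
  \<open>scale\<close> takes care of the scalar and so passes from ideals of the latter to ideals of
  the former.\<close>

lemma two_sided_retract_vimage:
  assumes "rng_ideal I (free_alg E)" "\<And>c a. a \<in> I \<Longrightarrow> scale c a \<in> I"
  shows "two_sided {p. retract E p \<in> I}"
proof -
  note I = assms(1)[unfolded rng_ideal_free_alg]
  have *: "retract E r * a \<in> I \<and> a * retract E r \<in> I" if "a \<in> I" for r a
  proof -
    obtain s where s: "retract E r = const (Poly_Mapping.lookup r []) + s" "s \<in> free_carrier E"
      by (rule free_split)
    have "retract E r * a = scale (Poly_Mapping.lookup r []) a + s * a"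
      "a * retract E r = scale (Poly_Mapping.lookup r []) a + a * s"
      unfolding s scale_eq by (simp_all add: distrib_left distrib_right const_mult_comm)
    then show ?thesis using s(2) that I assms(2) by auto
  qed
  show ?thesis
    by (rule two_sidedI) (use I * in \<open>auto simp: retract.ev_0 retract.ev_add retract.ev_uminus retract.ev_mult\<close>)
qed

lemma rng_ideal_two_sided_Int:
  assumes "two_sided D"
  shows "rng_ideal (D \<inter> free_carrier E) (free_alg E)"
  using assms
  by (auto simp: rng_ideal_free_alg two_sided_def free_carrier_0 free_carrier_add
      free_carrier_uminus free_carrier_mult)

lemma two_sided_rel_ideal: "two_sided (rel_ideal E)"
  unfolding rel_ideal_def by (rule two_sided_ideal_gen)

section \<open>The ring \<open>lpa E\<close> in terms of representatives\<close>

context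
  fixes E :: "('v,'e) pre_digraph"
  assumes wf: "wf_digraph E"
begin

text \<open>Two least ideals of different rings. A competitor \<open>I\<close> for the left side
  becomes one for \<open>rel_ideal E\<close> when pulled back along \<open>retract\<close>, which
  fixes the free algebra of \<open>E\<close> and kills foreign generators.\<close>

lemma lpa_kernel_eq: "(lpa_kernel E :: ('k::field,'v,'e) lpa_word_alg set) = rel_ideal E \<inter> free_carrier E"
proof
  show "lpa_kernel E \<subseteq> (rel_ideal E \<inter> free_carrier E :: ('k,'v,'e) lpa_word_alg set)"
    unfolding lpa_kernel_def
  proof (intro Inter_lower CollectI conjI allI ballI)
    show "rng_ideal (rel_ideal E \<inter> free_carrier E) (free_alg E :: ('k,'v,'e) lpa_word_alg ring)"
      by (rule rng_ideal_two_sided_Int[OF two_sided_rel_ideal])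
    show "scale c a \<in> rel_ideal E \<inter> free_carrier E" if "a \<in> rel_ideal E \<inter> free_carrier E"
      for c and a :: "('k,'v,'e) lpa_word_alg"
      using that by (auto simp: scale_eq free_carrier_const_mult two_sided_lmult[OF two_sided_rel_ideal])
    show "lpa_relations E \<subseteq> (rel_ideal E \<inter> free_carrier E :: ('k,'v,'e) lpa_word_alg set)"
      using relations_in_free[OF wf] ideal_gen_superset unfolding rel_ideal_def by blast
  qed
  show "rel_ideal E \<inter> free_carrier E \<subseteq> (lpa_kernel E :: ('k,'v,'e) lpa_word_alg set)"
    unfolding lpa_kernel_def
  proof (intro Inter_greatest)
    fix I :: "('k,'v,'e) lpa_word_alg set"
    assume "I \<in> {I. rng_ideal I (free_alg E) \<and> (\<forall>c. \<forall>a\<in>I. scale c a \<in> I) \<and> lpa_relations E \<subseteq> I}"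
    then have I: "rng_ideal I (free_alg E)" "\<And>c a. a \<in> I \<Longrightarrow> scale c a \<in> I" "lpa_relations E \<subseteq> I"
      by auto
    then have I0: "0 \<in> I" "I \<subseteq> free_carrier E" by (auto simp: rng_ideal_free_alg)
    have "rel_ideal E \<subseteq> {p. retract E p \<in> I}"
      unfolding rel_ideal_def
      by (rule ideal_gen_minimal[OF two_sided_retract_vimage[OF I(1,2)]])
        (use I(3) I0 in \<open>auto simp: retract_gen kill_foreign_def retract_id subset_iff\<close>)
    then show "rel_ideal E \<inter> free_carrier E \<subseteq> I"
      by (auto simp: retract_id subset_iff)
  qed
qed

lemma abelian_subgroup_lpa_kernel: "abelian_subgroup (lpa_kernel E) (free_alg E)"
  using rng_ideal_two_sided_Int[OF two_sided_rel_ideal[of E], of E]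
  by (intro abelian_subgroupI3 abelian_group_free_alg) (unfold lpa_kernel_eq rng_ideal_def, rule conjunct1)

lemma lpa_class_conv: "lpa_class E p = {k + p | k. k \<in> lpa_kernel E}"
  by (auto simp: lpa_class_def a_r_coset_def')

lemma lpa_class_eq_iff:
  assumes "p \<in> free_carrier E" "q \<in> free_carrier E"
  shows "lpa_class E p = lpa_class E q \<longleftrightarrow> p - q \<in> rel_ideal E"
proof
  assume "lpa_class E p = lpa_class E q"
  moreover have "p \<in> lpa_class E p"
    by (auto simp: lpa_class_conv lpa_kernel_eq free_carrier_0 two_sided_0[OF two_sided_rel_ideal])
  ultimately show "p - q \<in> rel_ideal E" by (auto simp: lpa_class_conv lpa_kernel_eq)
next
  assume a: "p - q \<in> rel_ideal E"
  show "lpa_class E p = lpa_class E q"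
    unfolding lpa_class_def
    by (rule abelian_subgroup.a_repr_independence'[OF abelian_subgroup_lpa_kernel, symmetric])
      (use assms a in \<open>auto simp: a_r_coset_def' lpa_kernel_eq free_carrier_diff intro!: bexI[of _ "p - q"]\<close>)
qed

lemma lpa_carrier: "carrier (lpa E) = lpa_class E ` free_carrier E"
  by (auto simp: lpa_def FactRing_def A_RCOSETS_def' lpa_class_def)

lemma lpa_add:
  assumes "p \<in> free_carrier E" "q \<in> free_carrier E"
  shows "lpa_class E p \<oplus>\<^bsub>lpa E\<^esub> lpa_class E q = lpa_class E (p + q)"
  using abelian_subgroup.a_rcos_sum[OF abelian_subgroup_lpa_kernel assms]
  by (simp add: lpa_class_def lpa_def FactRing_def)

lemma lpa_zero: "\<zero>\<^bsub>lpa E\<^esub> = lpa_class E 0"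
  by (auto simp: lpa_def FactRing_def lpa_class_conv)

lemma lpa_mult:
  assumes "p \<in> free_carrier E" "q \<in> free_carrier E"
  shows "lpa_class E p \<otimes>\<^bsub>lpa E\<^esub> lpa_class E q = lpa_class E (p * q)"
proof -
  have *: "lpa_class E (a * b) = lpa_class E (p * q)" if "a \<in> lpa_class E p" "b \<in> lpa_class E q" for a b
  proof -
    from that obtain k l where kl: "k \<in> lpa_kernel E" "l \<in> lpa_kernel E" "a = k + p" "b = l + q"
      by (auto simp: lpa_class_conv)
    then have "a * b - p * q = k * b + p * l" by (simp add: algebra_simps)
    also have "\<dots> \<in> rel_ideal E"
      using kl two_sided_rel_ideal
      by (auto simp: lpa_kernel_eq intro: two_sided_add two_sided_lmult two_sided_rmult)
    finally show ?thesis
      using kl assms by (subst lpa_class_eq_iff) (auto simp: lpa_kernel_eq free_carrier_mult free_carrier_add)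
  qed
  have "0 \<in> lpa_kernel E"
    by (auto simp: lpa_kernel_eq free_carrier_0 two_sided_0[OF two_sided_rel_ideal])
  then have pq: "p \<in> lpa_class E p" "q \<in> lpa_class E q" by (force simp: lpa_class_conv)+
  have "lpa_class E p \<otimes>\<^bsub>lpa E\<^esub> lpa_class E q = (\<Union>a\<in>lpa_class E p. \<Union>b\<in>lpa_class E q. lpa_class E (a * b))"
    by (simp add: lpa_def FactRing_def rcoset_mult_def lpa_class_def)
  also have "\<dots> = (\<Union>a\<in>lpa_class E p. \<Union>b\<in>lpa_class E q. lpa_class E (p * q))"
    using * by (intro SUP_cong refl)
  also have "\<dots> = lpa_class E (p * q)" using pq by blast
  finally show ?thesis .
qed

lemma rng_lpa: "rng (lpa E :: ('k::field,'v,'e) lpa_elem ring)"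
proof -
  have "group (free_alg E A_Mod lpa_kernel E)"
    by (rule abelian_subgroup.a_factorgroup_is_group[OF abelian_subgroup_lpa_kernel])
  also have "free_alg E A_Mod lpa_kernel E = add_monoid (lpa E :: ('k::field,'v,'e) lpa_elem ring)"
    by (simp add: lpa_def FactRing_def A_FactGroup_def' )
  finally show ?thesis
    by (auto simp: rng_def lpa_carrier lpa_mult free_carrier_mult)
qed

lemma lpa_inv:
  fixes p :: "('k::field,'v,'e) lpa_word_alg"
  assumes "p \<in> free_carrier E"
  shows "inv\<^bsub>add_monoid (lpa E)\<^esub> (lpa_class E p) = lpa_class E (- p)"
proof -
  have "group (add_monoid (lpa E :: ('k,'v,'e) lpa_elem ring))"
    using rng_lpa[where ?'k = 'k] unfolding rng_def by (rule conjunct1)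
  then interpret group "add_monoid (lpa E :: ('k,'v,'e) lpa_elem ring)" .
  show ?thesis
  proof (rule inv_equality)
    show "lpa_class E (- p) \<otimes>\<^bsub>add_monoid (lpa E)\<^esub> lpa_class E p = \<one>\<^bsub>add_monoid (lpa E)\<^esub>"
      using lpa_add[of "- p" p] assms by (simp add: free_carrier_uminus lpa_zero)
  qed (use assms in \<open>simp_all add: lpa_carrier free_carrier_uminus\<close>)
qed

text \<open>Vertices provide left local units, which makes ring ideals of the quotient subspaces.\<close>

lemma local_unit:
  assumes "p \<in> free_carrier E"
  obtains u :: "('k::field,'v,'e) lpa_word_alg" where "u \<in> free_carrier E" "u * p - p \<in> rel_ideal E"
proof -
  interpret wf_digraph E by (rule wf)
  \<comment> \<open>A ghost edge runs backwards, so its left unit is the vertex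
    \<open>head E e\<close>.\<close>
  define src where "src g = (case g of Vert v \<Rightarrow> v | Edge e \<Rightarrow> tail E e | Ghost e \<Rightarrow> head E e)" for g
  let ?T = "(\<lambda>w. src (hd w)) ` Poly_Mapping.keys p"
  let ?u = "\<Sum>v\<in>?T. gen (Vert v) :: ('k,'v,'e) lpa_word_alg"
  note ts = two_sided_rel_ideal[of E]
  have rel: "x \<in> lpa_relations E \<Longrightarrow> x \<in> rel_ideal E" for x :: "('k,'v,'e) lpa_word_alg"
    unfolding rel_ideal_def by (rule ideal_gen_incl) auto
  have src: "src g \<in> verts E" if "g \<in> lpa_gens E" for g
    using that by (auto simp: lpa_gens_def src_def)
  have one: "gen (Vert (src g)) * gen g - gen g \<in> (rel_ideal E :: ('k,'v,'e) lpa_word_alg set)" if "g \<in> lpa_gens E"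
    for g :: "('v,'e) lpa_gen"
  proof (cases g)
    case (Vert v)
    then show ?thesis using rel[OF vert_vert[of v E v]] that by (simp add: src_def)
  next
    case (Edge e)
    then show ?thesis using rel[OF source_edge[of e E]] that by (simp add: src_def)
  next
    case (Ghost e)
    then show ?thesis using rel[OF range_ghost[of e E]] that by (simp add: src_def)
  qed
  have two: "gen (Vert v) * gen g \<in> (rel_ideal E :: ('k,'v,'e) lpa_word_alg set)"
    if "g \<in> lpa_gens E" "v \<noteq> src g" "v \<in> verts E" for g :: "('v,'e) lpa_gen" and v
  proof -
    have "gen (Vert v) * gen (Vert (src g)) \<in> (rel_ideal E :: ('k,'v,'e) lpa_word_alg set)"
      using rel[OF vert_vert[of v E "src g"]] that src[of g] by simp
    then have "gen (Vert v) * gen (Vert (src g)) * gen g \<in> (rel_ideal E :: ('k,'v,'e) lpa_word_alg set)"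
      by (rule two_sided_rmult[OF ts])
    moreover have "gen (Vert v) * (gen (Vert (src g)) * gen g - gen g) \<in> (rel_ideal E :: ('k,'v,'e) lpa_word_alg set)"
      by (rule two_sided_lmult[OF ts one[OF that(1)]])
    ultimately have "gen (Vert v) * gen (Vert (src g)) * gen g -
        gen (Vert v) * (gen (Vert (src g)) * gen g - gen g) \<in> (rel_ideal E :: ('k,'v,'e) lpa_word_alg set)"
      by (rule two_sided_diff[OF ts])
    then show ?thesis by (simp add: algebra_simps)
  qed
  have T: "v \<in> verts E" if "v \<in> ?T" for v
    using that assms src by (auto simp: free_carrier_iff subset_iff)
  have word: "?u * Poly_Mapping.single w c - Poly_Mapping.single w c \<in> rel_ideal E"
    if w: "w \<in> Poly_Mapping.keys p" for w and c :: 'k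
  proof -
    obtain g w' where gw: "w = g # w'" "g \<in> lpa_gens E"
      using assms w by (cases w) (auto simp: free_carrier_iff)
    have g: "src g \<in> ?T" using w gw by force
    have "?u * gen g - gen g = (gen (Vert (src g)) * gen g - gen g) +
        (\<Sum>v\<in>?T - {src g}. gen (Vert v) * gen g)"
      by (simp add: sum_distrib_right sum.remove[OF _ g] distrib_right)
    also have "\<dots> \<in> rel_ideal E"
      using T gw(2) by (intro two_sided_add[OF ts] one two_sided_sum[OF ts] two) auto
    finally have "(?u * gen g - gen g) * Poly_Mapping.single w' c \<in> rel_ideal E"
      by (rule two_sided_rmult[OF ts])
    then show ?thesis by (simp add: gw single_Cons algebra_simps)
  qed
  have "?u * p - p = (\<Sum>w\<in>Poly_Mapping.keys p. ?u * Poly_Mapping.single w (Poly_Mapping.lookup p w)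
      - Poly_Mapping.single w (Poly_Mapping.lookup p w))"
    by (simp add: sum_subtractf flip: poly_mapping_sum_single sum_distrib_left)
  also have "\<dots> \<in> rel_ideal E" by (intro two_sided_sum[OF ts] word)
  finally show thesis
    using T by (intro that[of ?u]) (auto intro!: free_carrier_sum simp: gen_in_free)
qed

text \<open>On the left is a ring ideal with no scalars built in, on the right an ideal of a ring
  that contains the constants. They agree because \<open>c a = (c u) a\<close> for a local unit
  \<open>u\<close> of \<open>a\<close>, which closes the ring ideal under scalars.\<close>

lemma lpa_class_in_gen_iff:
  fixes p :: "('k::field,'v,'e) lpa_word_alg"
  assumes "p \<in> free_carrier E" "X \<subseteq> free_carrier E"
  shows "lpa_class E p \<in> rng_ideal_gen (lpa E) (lpa_class E ` X) \<longleftrightarrow> p \<in> ideal_gen (rel_ideal E \<union> X)"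
    (is "?L \<longleftrightarrow> ?R")
proof
  let ?D = "ideal_gen (rel_ideal E \<union> X) :: ('k::field,'v,'e) lpa_word_alg set"
  note D = two_sided_ideal_gen[of "rel_ideal E \<union> X"]
  have rel: "rel_ideal E \<subseteq> ?D" and X: "X \<subseteq> ?D" using ideal_gen_superset[of "rel_ideal E \<union> X"] by auto
  let ?I = "lpa_class E ` (?D \<inter> free_carrier E)"
  have "rng_ideal ?I (lpa E)"
    unfolding rng_ideal_def
  proof (intro conjI ballI)
    show "additive_subgroup ?I (lpa E)"
    proof (intro additive_subgroup.intro subgroup.intro)
      fix x assume "x \<in> ?I"
      then obtain q where "x = lpa_class E q" "- q \<in> ?D \<inter> free_carrier E" "q \<in> free_carrier E"
        using two_sided_uminus[OF D] by (auto simp: free_carrier_uminus)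
      then show "inv\<^bsub>add_monoid (lpa E)\<^esub> x \<in> ?I"
        using lpa_inv by (metis imageI)
    next
      fix x y assume "x \<in> ?I" "y \<in> ?I"
      then show "x \<otimes>\<^bsub>add_monoid (lpa E)\<^esub> y \<in> ?I"
        by (auto simp: lpa_add intro!: imageI two_sided_add[OF D] free_carrier_add)
    qed (auto simp: lpa_carrier lpa_zero free_carrier_0 two_sided_0[OF D])
  next
    fix a x :: "('k,'v,'e) lpa_elem" assume "a \<in> ?I" "x \<in> carrier (lpa E)"
    then obtain b y where *: "a = lpa_class E b" "b \<in> ?D" "b \<in> free_carrier E"
      "x = lpa_class E y" "y \<in> free_carrier E" by (auto simp: lpa_carrier)
    then have "y * b \<in> ?D \<inter> free_carrier E" "b * y \<in> ?D \<inter> free_carrier E"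
      by (simp_all add: free_carrier_mult two_sided_lmult[OF D] two_sided_rmult[OF D])
    then show "x \<otimes>\<^bsub>lpa E\<^esub> a \<in> ?I" "a \<otimes>\<^bsub>lpa E\<^esub> x \<in> ?I"
      using * by (simp_all add: lpa_mult)
  qed
  then have "rng_ideal_gen (lpa E) (lpa_class E ` X) \<subseteq> ?I"
    using X assms(2) by (intro rng_ideal_gen_minimal) auto
  moreover assume ?L
  ultimately obtain q where q: "q \<in> ?D" "q \<in> free_carrier E" "lpa_class E p = lpa_class E q" by auto
  then have "p - q \<in> ?D" using assms(1) lpa_class_eq_iff rel by blast
  then have "p - q + q \<in> ?D" by (rule two_sided_add[OF D]) fact
  then show ?R by simp
next
  assume p: ?R
  show ?L
    unfolding rng_ideal_gen_def
  proof (intro InterI)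
    fix Y assume "Y \<in> {I. rng_ideal I (lpa E) \<and> lpa_class E ` X \<subseteq> I}"
    then have Y: "rng_ideal Y (lpa E)" and XY: "lpa_class E ` X \<subseteq> Y" by auto
    interpret additive_subgroup Y "lpa E" using Y by (simp add: rng_ideal_def)
    let ?I = "{p \<in> free_carrier E. lpa_class E p \<in> Y}"
    have Ymult: "lpa_class E (r * a) \<in> Y" "lpa_class E (a * r) \<in> Y"
      if "a \<in> ?I" "r \<in> free_carrier E" for a r
      using that Y by (auto simp: rng_ideal_def lpa_carrier simp flip: lpa_mult)
    have I: "rng_ideal ?I (free_alg E)"
      unfolding rng_ideal_free_alg
    proof (intro conjI ballI)
      show "0 \<in> ?I" using zero_closed by (simp add: free_carrier_0 lpa_zero)
      fix x assume x: "x \<in> ?I"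
      then have xf: "x \<in> free_carrier E" "lpa_class E x \<in> Y" by auto
      have "lpa_class E (- x) \<in> Y"
        using subgroup.m_inv_closed[OF a_subgroup xf(2)] by (simp only: lpa_inv[OF xf(1)])
      then show "- x \<in> ?I" using x by (simp add: free_carrier_uminus)
      show "x + y \<in> ?I" if "y \<in> ?I" for y
        using x that a_closed by (auto simp: free_carrier_add simp flip: lpa_add)
      show "y * x \<in> ?I" "x * y \<in> ?I" if "y \<in> free_carrier E" for y
        using Ymult x that by (auto simp: free_carrier_mult)
    qed auto
    have sc: "scale c a \<in> ?I" if aI: "a \<in> ?I" for c a
    proof -
      have af: "a \<in> free_carrier E" using aI by simp
      obtain u where u: "u \<in> free_carrier E" "u * a - a \<in> rel_ideal E"
        by (rule local_unit[OF af])
      have "const c * (u * a - a) \<in> rel_ideal E"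
        by (rule two_sided_lmult[OF two_sided_rel_ideal u(2)])
      then have "const c * u * a - scale c a \<in> rel_ideal E"
        by (simp add: scale_eq algebra_simps)
      then have "lpa_class E (scale c a) = lpa_class E (const c * u * a)"
        using aI u by (subst eq_commute, subst lpa_class_eq_iff)
          (auto simp: scale_eq free_carrier_const_mult free_carrier_mult)
      then show ?thesis
        using Ymult[of a "const c * u"] aI u by (auto simp: scale_eq free_carrier_const_mult)
    qed
    have D: "two_sided {p. retract E p \<in> ?I}"
      by (rule two_sided_retract_vimage[OF I]) (rule sc)
    have rel: "lpa_class E r \<in> Y" if "r \<in> rel_ideal E" "r \<in> free_carrier E" for r
    proof -
      have "lpa_class E r = lpa_class E 0"
        using that by (subst lpa_class_eq_iff) (auto simp: free_carrier_0)
      then show ?thesis using zero_closed by (simp add: lpa_zero)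
    qed
    have "lpa_relations E \<union> gen ` (- lpa_gens E) \<subseteq> {p. retract E p \<in> ?I}"
    proof (intro subsetI CollectI conjI)
      fix r :: "('k,'v,'e) lpa_word_alg" assume r: "r \<in> lpa_relations E \<union> gen ` (- lpa_gens E)"
      show "retract E r \<in> free_carrier E"
        using r relations_in_free[OF wf] by (auto simp: retract_gen kill_foreign_def free_carrier_0 retract_id subset_iff)
      from r show "lpa_class E (retract E r) \<in> Y"
      proof
        assume r: "r \<in> lpa_relations E"
        then have "r \<in> free_carrier E" using relations_in_free[OF wf] by auto
        moreover have "r \<in> rel_ideal E" using r unfolding rel_ideal_def by (intro ideal_gen_incl) auto
        ultimately show ?thesis by (simp add: retract_id rel)
      qed (use zero_closed in \<open>auto simp: retract_gen kill_foreign_def lpa_zero\<close>)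
    qed
    then have "rel_ideal E \<subseteq> {p. retract E p \<in> ?I}"
      unfolding rel_ideal_def by (rule ideal_gen_minimal[OF D])
    moreover have "X \<subseteq> {p. retract E p \<in> ?I}"
      using assms(2) XY by (auto simp: retract_id subset_iff)
    ultimately have "ideal_gen (rel_ideal E \<union> X) \<subseteq> {p. retract E p \<in> ?I}"
      by (intro ideal_gen_minimal[OF D]) auto
    then show "lpa_class E p \<in> Y" using p assms(1) by (auto simp: retract_id subset_iff)
  qed
qed

text \<open>Membership in \<open>fully_idempotent_part\<close>, read on representatives. The
  intersections with \<open>free_carrier\<close> leave out elements such as the foreign generators,
  which \<open>rel_ideal\<close> contains.\<close>

definition fully_idempotent_word :: "('k::field,'v,'e) lpa_word_alg \<Rightarrow> bool" where
  "fully_idempotent_word p \<longleftrightarrow>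
    (\<forall>q \<in> ideal_gen (rel_ideal E \<union> {p}) \<inter> free_carrier E.
      q \<in> ideal_gen (rel_ideal E \<union> {x * y | x y.
        x \<in> ideal_gen (rel_ideal E \<union> {q}) \<inter> free_carrier E \<and>
        y \<in> ideal_gen (rel_ideal E \<union> {q}) \<inter> free_carrier E}))"

lemma rng_ideal_gen_lpa_class:
  assumes "X \<subseteq> free_carrier E"
  shows "rng_ideal_gen (lpa E) (lpa_class E ` X) = lpa_class E ` (ideal_gen (rel_ideal E \<union> X) \<inter> free_carrier E)"
proof -
  have "rng_ideal_gen (lpa E) (lpa_class E ` X) \<subseteq> carrier (lpa E)"
    by (rule rng_ideal_gen_subset[OF rng_lpa]) (use assms in \<open>auto simp: lpa_carrier\<close>)
  then show ?thesis
    using lpa_class_in_gen_iff[OF _ assms] by (auto simp: lpa_carrier)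
qed

lemma fully_idempotent_part_lpa:
  fixes p :: "('k::field,'v,'e) lpa_word_alg"
  assumes "p \<in> free_carrier E"
  shows "lpa_class E p \<in> fully_idempotent_part (lpa E) \<longleftrightarrow> fully_idempotent_word p"
proof -
  have gen1: "rng_ideal_gen (lpa E) {lpa_class E q} = lpa_class E ` (ideal_gen (rel_ideal E \<union> {q}) \<inter> free_carrier E)"
    if "q \<in> free_carrier E" for q :: "('k::field,'v,'e) lpa_word_alg"
    using rng_ideal_gen_lpa_class[of "{q}"] that by simp
  have prods: "{x \<otimes>\<^bsub>lpa E\<^esub> y | x y. x \<in> rng_ideal_gen (lpa E) {lpa_class E q} \<and> y \<in> rng_ideal_gen (lpa E) {lpa_class E q}}
     = lpa_class E ` {x * y | x y.
        x \<in> ideal_gen (rel_ideal E \<union> {q}) \<inter> free_carrier E \<and>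
        y \<in> ideal_gen (rel_ideal E \<union> {q}) \<inter> free_carrier E}" (is "?A = lpa_class E ` ?B")
    if q: "q \<in> free_carrier E" for q :: "('k::field,'v,'e) lpa_word_alg"
  proof
    let ?Q = "ideal_gen (rel_ideal E \<union> {q}) \<inter> free_carrier E"
    show "?A \<subseteq> lpa_class E ` ?B"
    proof
      fix z assume "z \<in> ?A"
      then obtain x y where "x \<in> ?Q" "y \<in> ?Q" "z = lpa_class E x \<otimes>\<^bsub>lpa E\<^esub> lpa_class E y"
        unfolding gen1[OF q] by blast
      then show "z \<in> lpa_class E ` ?B" using lpa_mult[of x y] by blast
    qed
    show "lpa_class E ` ?B \<subseteq> ?A"
    proof
      fix z assume "z \<in> lpa_class E ` ?B"
      then obtain x y where "x \<in> ?Q" "y \<in> ?Q" "z = lpa_class E (x * y)" by blast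
      then show "z \<in> ?A" unfolding gen1[OF q] using lpa_mult[of x y] by blast
    qed
  qed
  have "b \<in> free_carrier E \<Longrightarrow>
      lpa_class E b \<in> rng_ideal_gen (lpa E) {x \<otimes>\<^bsub>lpa E\<^esub> y | x y. x \<in> rng_ideal_gen (lpa E) {lpa_class E b} \<and> y \<in> rng_ideal_gen (lpa E) {lpa_class E b}}
      \<longleftrightarrow> b \<in> ideal_gen (rel_ideal E \<union> {x * y | x y.
        x \<in> ideal_gen (rel_ideal E \<union> {b}) \<inter> free_carrier E \<and>
        y \<in> ideal_gen (rel_ideal E \<union> {b}) \<inter> free_carrier E})" for b :: "('k::field,'v,'e) lpa_word_alg"
    by (subst prods, assumption, rule lpa_class_in_gen_iff) (auto simp: free_carrier_mult)
  then show ?thesis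
    unfolding fully_idempotent_part_def fully_idempotent_word_def mem_Collect_eq gen1[OF assms]
    using assms by (simp add: lpa_carrier)
qed

end

section \<open>Quotients of the word algebra as rings of additive maps\<close>

text \<open>A quotient by an ideal that depends on variables is not a type; the additive maps of a
  fixed group form one. Both the quotients of the word algebra and the actions on infinite paths
  take values here.\<close>

typedef (overloaded) 'a endo = "{f :: 'a::ab_group_add \<Rightarrow> 'a. \<forall>x y. f (x + y) = f x + f y}"
  morphisms endo_apply Endo
  by (rule exI[of _ "\<lambda>x. x"]) simp

lemma endo_eqI: "(\<And>x. endo_apply f x = endo_apply g x) \<Longrightarrow> f = g"
  by (metis endo_apply_inject ext)

lemma endo_apply_add: "endo_apply f (x + y) = endo_apply f x + endo_apply f y"
  using endo_apply[of f] by simp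

lemma Endo_apply: "(\<And>x y. f (x + y) = f x + f y) \<Longrightarrow> endo_apply (Endo f) = f"
  by (simp add: Endo_inverse)

instantiation endo :: (ab_group_add) "{ring, monoid_mult}"
begin

definition "0 = Endo (\<lambda>x. 0)"
definition "1 = Endo (\<lambda>x. x)"
definition "f + g = Endo (\<lambda>x. endo_apply f x + endo_apply g x)"
definition "f - g = Endo (\<lambda>x. endo_apply f x - endo_apply g x)"
definition "- f = Endo (\<lambda>x. - endo_apply f x)"
definition "f * g = Endo (\<lambda>x. endo_apply f (endo_apply g x))"

lemma endo_simps [simp]:
  "endo_apply 0 x = 0"
  "endo_apply 1 x = x"
  "endo_apply (f + g) x = endo_apply f x + endo_apply g x"
  "endo_apply (f - g) x = endo_apply f x - endo_apply g x"
  "endo_apply (- f) x = - endo_apply f x"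
  "endo_apply (f * g) x = endo_apply f (endo_apply g x)"
  unfolding zero_endo_def one_endo_def plus_endo_def minus_endo_def uminus_endo_def times_endo_def
  by (subst Endo_apply; simp add: endo_apply_add)+

instance
  by standard (auto intro!: endo_eqI simp: endo_apply_add)

end

lemma endo_apply_sum: "endo_apply (sum f A) x = (\<Sum>i\<in>A. endo_apply (f i) x)"
  by (induction A rule: infinite_finite_induct) auto

text \<open>
  If \<open>n\<close> is a linear projection with kernel \<open>I\<close>, then \<open>p \<mapsto> (x \<mapsto> n (p * x))\<close> is a homomorphism with
  kernel \<open>I\<close>.  So the quotient by \<open>I\<close> sits inside a ring type, where congruences are equations.  The
  unit of the word algebra goes to \<open>n\<close>, not to the identity.
\<close>

lemma quotient_endo:
  fixes I :: "('k::field,'v,'e) lpa_word_alg set"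
  assumes I: "two_sided I"
  obtains h :: "('k,'v,'e) lpa_word_alg \<Rightarrow> ('k,'v,'e) lpa_word_alg endo"
  where "\<And>p q. h (p + q) = h p + h q" "\<And>p q. h (p * q) = h p * h q" "\<And>p. h p = 0 \<longleftrightarrow> p \<in> I"
proof -
  let ?s = "\<lambda>c p. const c * p :: ('k,'v,'e) lpa_word_alg"
  interpret V: vector_space ?s
    by unfold_locales
      (auto simp: algebra_simps single_add const_1 single_list_mult simp flip: mult.assoc)
  interpret P: vector_space_pair ?s ?s ..
  obtain B where B: "B \<subseteq> I" "V.independent B" "I \<subseteq> V.span B"
    by (rule V.maximal_independent_subset)
  let ?C = "V.extend_basis B"
  obtain n where n: "Vector_Spaces.linear ?s ?s n" "\<forall>x\<in>?C. n x = (if x \<in> B then 0 else x)"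
    using P.linear_independent_extend[OF V.independent_extend_basis[OF B(2)], of "\<lambda>x. if x \<in> B then 0 else x"]
    by blast
  interpret n: Vector_Spaces.linear ?s ?s n by (rule n(1))
  have "V.span B \<subseteq> {x. n x = 0}"
  proof (rule V.span_minimal)
    show "B \<subseteq> {x. n x = 0}" using n(2) V.extend_basis_superset[OF B(2)] by auto
    show "V.subspace {x. n x = 0}" by (rule V.subspaceI) (auto simp: n.add n.scale n.zero)
  qed
  then have nI: "n x = 0" if "x \<in> I" for x using B(3) that by blast
  have "V.span ?C \<subseteq> {x. n x - x \<in> I}"
  proof (rule V.span_minimal)
    show "?C \<subseteq> {x. n x - x \<in> I}"
      using n(2) B(1) two_sided_0[OF I] two_sided_uminus[OF I] by auto
    show "V.subspace {x. n x - x \<in> I}"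
    proof (rule V.subspaceI)
      show "x + y \<in> {x. n x - x \<in> I}" if "x \<in> {x. n x - x \<in> I}" "y \<in> {x. n x - x \<in> I}" for x y
        using two_sided_add[OF I, of "n x - x" "n y - y"] that by (simp add: n.add algebra_simps)
      show "const c * x \<in> {x. n x - x \<in> I}" if "x \<in> {x. n x - x \<in> I}" for x c
        using two_sided_lmult[OF I, of "n x - x" "const c"] that by (simp add: n.scale algebra_simps)
    qed (simp add: n.zero two_sided_0[OF I])
  qed
  then have nn: "n x - x \<in> I" for x using V.span_extend_basis[OF B(2)] by blast
  have n_iff: "n x = n y \<longleftrightarrow> x - y \<in> I" for x y
  proof
    assume "n x = n y"
    then have "(n y - y) - (n x - x) \<in> I" using two_sided_diff[OF I nn nn] by blast
    then show "x - y \<in> I" using \<open>n x = n y\<close> by simp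
  next
    assume "x - y \<in> I"
    then have "n (x - y) = 0" by (rule nI)
    then show "n x = n y" by (simp add: n.diff)
  qed
  define h where "h r = Endo (\<lambda>x. n (r * x))" for r
  have h: "endo_apply (h r) x = n (r * x)" for r x
    unfolding h_def by (subst Endo_apply) (simp_all add: distrib_left n.add)
  show thesis
  proof (rule that[of h])
    show "h (p + q) = h p + h q" for p q
      by (rule endo_eqI) (simp add: h distrib_right n.add)
    show "h (p * q) = h p * h q" for p q
    proof (rule endo_eqI)
      fix x
      have "p * (n (q * x) - q * x) \<in> I" by (rule two_sided_lmult[OF I nn])
      then show "endo_apply (h (p * q)) x = endo_apply (h p * h q) x"
        unfolding endo_simps h by (subst eq_commute, subst n_iff) (simp add: algebra_simps)
    qed
    show "h p = 0 \<longleftrightarrow> p \<in> I" for p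
    proof
      assume "h p = 0"
      \<comment> \<open>Evaluation at 1 recovers \<open>n p\<close>: since the word algebra is
        unital, no element outside \<open>I\<close> acts as zero.\<close>
      then have "n p = n 0" using h[of p 1] by (simp add: n.zero)
      then show "p \<in> I" using n_iff[of p 0] unfolding diff_zero by blast
    next
      assume "p \<in> I"
      then show "h p = 0"
        by (intro endo_eqI) (simp add: h nI two_sided_rmult[OF I])
    qed
  qed
qed

section \<open>Path calculus in quotients of the Leavitt path algebra\<close>

text \<open>The product of the edges ends with the vertex reached, so a trivial path is its vertex
  and not the unit of the word algebra. The adjoint of a path is \<open>gth\<close>.\<close>

fun pth :: "('v,'e) pre_digraph \<Rightarrow> 'v \<Rightarrow> 'e list \<Rightarrow> ('k::field,'v,'e) lpa_word_alg" where
  "pth E u [] = gen (Vert u)"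
| "pth E u (e # p) = gen (Edge e) * pth E (head E e) p"

fun gth :: "('v,'e) pre_digraph \<Rightarrow> 'v \<Rightarrow> 'e list \<Rightarrow> ('k::field,'v,'e) lpa_word_alg" where
  "gth E u [] = gen (Vert u)"
| "gth E u (e # p) = gth E (head E e) p * gen (Ghost e)"

text \<open>For incomparable paths the products \<open>t t^*\<close> become orthogonal idempotents
  below \<open>v\<close>; this is their complement in \<open>v\<close>.\<close>

definition path_cut :: "('v,'e) pre_digraph \<Rightarrow> 'v \<Rightarrow> 'e list set \<Rightarrow> ('k::field,'v,'e) lpa_word_alg" where
  "path_cut E v X = gen (Vert v) - (\<Sum>t\<in>X. pth E v t * gth E v t)"

definition path_antichain :: "('v,'e) pre_digraph \<Rightarrow> 'v \<Rightarrow> 'e list set \<Rightarrow> bool" where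
  "path_antichain E v X \<longleftrightarrow> v \<in> verts E \<and> finite X \<and>
     (\<forall>t\<in>X. \<exists>w. pre_digraph.awalk E v t w) \<and> (\<forall>s\<in>X. \<forall>t\<in>X. s \<noteq> t \<longrightarrow> s \<parallel> t)"

text \<open>An arbitrary homomorphic image of \<open>L_K(E)\<close> inside a ring type. The element
  \<open>h 1\<close> acts as a unit on the image of \<open>h\<close> only, not on the whole ring, so
  multipliers are always taken of the form \<open>h x\<close>.\<close>

locale lpa_hom = wf_digraph E for E :: "('v,'e) pre_digraph" +
  fixes h :: "('k::field,'v,'e) lpa_word_alg \<Rightarrow> 'a::ring"
  assumes h_add: "h (p + q) = h p + h q"
    and h_mult: "h (p * q) = h p * h q"
    and h_rel: "p \<in> rel_ideal E \<Longrightarrow> h p = 0"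
begin

lemma h_0: "h 0 = 0"
  using h_add[of 0 0] by simp

lemma h_uminus: "h (- p) = - h p"
  using h_add[of p "- p"] by (simp add: h_0 eq_neg_iff_add_eq_0 add.commute)

lemma h_diff: "h (p - q) = h p - h q"
  using h_add[of p "- q"] by (simp add: h_uminus)

lemma h_sum: "h (sum f A) = (\<Sum>i\<in>A. h (f i))"
  by (induction A rule: infinite_finite_induct) (auto simp: h_0 h_add)

lemma h_1_left: "h 1 * h p = h p"
  and h_1_right: "h p * h 1 = h p"
  using h_mult[of 1 p] h_mult[of p 1] by simp_all

lemma h_relations: "p - q \<in> lpa_relations E \<Longrightarrow> h p = h q"
  using h_rel[of "p - q"] ideal_gen_incl[of "p - q"] by (auto simp: rel_ideal_def h_diff)

abbreviation "V v \<equiv> h (gen (Vert v))"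
abbreviation "Ed e \<equiv> h (gen (Edge e))"
abbreviation "Gh e \<equiv> h (gen (Ghost e))"
abbreviation "P u p \<equiv> h (pth E u p)"
abbreviation "G u p \<equiv> h (gth E u p)"
abbreviation "S c \<equiv> h (const c)"

lemma V_V: "v \<in> verts E \<Longrightarrow> w \<in> verts E \<Longrightarrow> V v * V w = (if v = w then V v else 0)"
  using h_relations[OF vert_vert[of v E w]] by (auto simp: h_mult h_0)

lemma V_idem: "v \<in> verts E \<Longrightarrow> V v * V v = V v"
  by (simp add: V_V)

lemma V_Ed: "e \<in> arcs E \<Longrightarrow> V (tail E e) * Ed e = Ed e"
  using h_relations[OF source_edge[of e E]] by (auto simp: h_mult)

lemma Ed_V: "e \<in> arcs E \<Longrightarrow> Ed e * V (head E e) = Ed e"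
  using h_relations[OF edge_range[of e E]] by (auto simp: h_mult)

lemma V_Gh: "e \<in> arcs E \<Longrightarrow> V (head E e) * Gh e = Gh e"
  using h_relations[OF range_ghost[of e E]] by (auto simp: h_mult)

lemma Gh_V: "e \<in> arcs E \<Longrightarrow> Gh e * V (tail E e) = Gh e"
  using h_relations[OF ghost_source[of e E]] by (auto simp: h_mult)

lemma Gh_Ed: "e \<in> arcs E \<Longrightarrow> f \<in> arcs E \<Longrightarrow> Gh e * Ed f = (if e = f then V (head E e) else 0)"
  using h_relations[OF CK1[of e E f]] by (auto simp: h_mult h_0)

lemma V_regular: "regular E v \<Longrightarrow> V v = (\<Sum>e\<in>out_arcs E v. Ed e * Gh e)"
  using h_relations[OF CK2[of E v]] by (auto simp: h_mult h_sum)

lemma S_comm: "S c * h p = h p * S c"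
  using const_mult_comm[of c p] by (metis h_mult)

lemma S_comm': "h p * (S c * x) = S c * (h p * x)"
  by (simp add: S_comm flip: mult.assoc)

lemma S_mult: "S a * S b = S (a * b)"
  by (simp add: single_list_mult flip: h_mult)

lemma S_add: "S (a + b) = S a + S b"
  by (simp add: single_add flip: h_add)

lemma S_1: "S 1 * h p = h p"
  by (simp add: const_1 h_1_left)

lemma P_Cons [simp]: "P u (e # p) = Ed e * P (head E e) p"
  by (simp add: h_mult)

lemma G_Cons [simp]: "G u (e # p) = G (head E e) p * Gh e"
  by (simp add: h_mult)

declare pth.simps(2) [simp del] gth.simps(2) [simp del]

lemma V_P: "awalk u p v \<Longrightarrow> V u * P u p = P u p"
  by (cases p) (auto simp: awalk_simps V_V V_Ed simp flip: mult.assoc)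

lemma P_V: "awalk u p v \<Longrightarrow> P u p * V v = P u p"
  by (induction p arbitrary: u) (auto simp: awalk_simps V_V mult.assoc)

lemma G_V: "awalk u p v \<Longrightarrow> G u p * V u = G u p"
  by (cases p) (auto simp: awalk_simps V_V Gh_V mult.assoc)

lemma V_G: "awalk u p v \<Longrightarrow> V v * G u p = G u p"
  by (induction p arbitrary: u) (auto simp: awalk_simps V_V simp flip: mult.assoc)

lemma P_append: "awalk u p v \<Longrightarrow> awalk v q w \<Longrightarrow> P u (p @ q) = P u p * P v q"
  by (induction p arbitrary: u) (auto simp: awalk_simps V_P mult.assoc simp del: awalk_append_iff)

lemma G_append: "awalk u p v \<Longrightarrow> awalk v q w \<Longrightarrow> G u (p @ q) = G v q * G u p"
  by (induction p arbitrary: u) (auto simp: awalk_simps G_V mult.assoc simp del: awalk_append_iff)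

lemma G_P: "awalk u p v \<Longrightarrow> G u p * P u p = V v"
proof (induction p arbitrary: u)
  case (Cons e p)
  then have e: "e \<in> arcs E" "awalk (head E e) p v" by (auto simp: awalk_simps)
  have "G u (e # p) * P u (e # p) = G (head E e) p * (Gh e * Ed e) * P (head E e) p"
    by (simp add: mult.assoc)
  also have "\<dots> = G (head E e) p * P (head E e) p"
    using e by (simp add: Gh_Ed G_V)
  finally show ?case using Cons.IH[OF e(2)] by simp
qed (auto simp: awalk_simps V_V)

lemma G_P_append: "awalk u p v \<Longrightarrow> awalk v q w \<Longrightarrow> G u p * P u (p @ q) = P v q"
  by (simp add: P_append G_P V_P flip: mult.assoc)

lemma G_append_P: "awalk u p v \<Longrightarrow> awalk v q w \<Longrightarrow> G u (p @ q) * P u p = G v q"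
  by (simp add: G_append G_P G_V mult.assoc)

text \<open>Once the common prefix cancels, two different edges meet and \<open>CK1\<close> makes
  the product vanish.\<close>

lemma G_P_parallel:
  assumes "awalk u p v" "awalk u q w" "p \<parallel> q"
  shows "G u p * P u q = 0"
proof -
  obtain r b bs c cs where *: "b \<noteq> c" "p = r @ b # bs" "q = r @ c # cs"
    using parallel_decomp[OF assms(3)] by blast
  obtain x where x: "awalk u r x" "awalk x (b # bs) v" "awalk x (c # cs) w"
    using assms(1,2) unfolding *(2,3) by auto
  have "G u p * P u q = G x (b # bs) * (G u r * P u r) * P x (c # cs)"
    unfolding *(2,3) G_append[OF x(1,2)] P_append[OF x(1,3)] by (simp add: mult.assoc)
  also have "\<dots> = G (head E b) bs * (Gh b * V x * Ed c) * P (head E c) cs"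
    by (simp add: G_P[OF x(1)] mult.assoc)
  also have "Gh b * V x * Ed c = 0"
    using x(2,3) *(1) by (auto simp: awalk_simps Gh_Ed V_Ed mult.assoc)
  finally show ?thesis by simp
qed

lemma V_neq_P: "awalk u p v \<Longrightarrow> x \<in> verts E \<Longrightarrow> x \<noteq> u \<Longrightarrow> V x * P u p = 0"
  using V_P[of u p v] V_V[of x u] by (metis awalk_hd_in_verts mult.assoc mult_zero_left)

lemma G_neq_V: "awalk u p v \<Longrightarrow> x \<in> verts E \<Longrightarrow> x \<noteq> u \<Longrightarrow> G u p * V x = 0"
  using G_V[of u p v] V_V[of u x] by (metis awalk_hd_in_verts mult.assoc mult_zero_right)

lemma Ed_neq_P: "awalk u p v \<Longrightarrow> e \<in> arcs E \<Longrightarrow> head E e \<noteq> u \<Longrightarrow> Ed e * P u p = 0"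
  using V_neq_P[of u p v "head E e"] Ed_V[of e] by (metis head_in_verts mult.assoc mult_zero_right)

lemma Gh_neq_V: "e \<in> arcs E \<Longrightarrow> x \<in> verts E \<Longrightarrow> x \<noteq> tail E e \<Longrightarrow> Gh e * V x = 0"
  using Gh_V[of e] V_V[of "tail E e" x] by (metis tail_in_verts mult.assoc mult_zero_right)

lemma Gh_P_Cons: "e \<in> arcs E \<Longrightarrow> awalk u (f # p) v \<Longrightarrow>
    Gh e * P u (f # p) = (if e = f then P (head E f) p else 0)"
  by (auto simp: awalk_simps Gh_Ed V_P simp flip: mult.assoc)

lemma h_cut: "h (path_cut E v X) = V v - (\<Sum>t\<in>X. P v t * G v t)"
  by (simp add: path_cut_def h_diff h_sum h_mult)

context
  fixes v X assumes X: "path_antichain E v X"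
begin

lemma cut_vert: "v \<in> verts E" "finite X"
  using X by (auto simp: path_antichain_def)

lemma cut_V: "h (path_cut E v X) * V v = h (path_cut E v X)"
proof -
  have "(P v t * G v t) * V v = P v t * G v t" if "t \<in> X" for t
    using X that by (auto simp: path_antichain_def mult.assoc G_V)
  then show ?thesis
    by (simp add: h_cut left_diff_distrib sum_distrib_right V_idem[OF cut_vert(1)])
qed

text \<open>On a path through \<open>t\<close> the summand \<open>t t^*\<close> acts as the
  identity, and the summands of all paths incomparable with \<open>t\<close> vanish.\<close>

lemma cut_P:
  assumes "t \<in> X" "awalk v (t @ q) w"
  shows "h (path_cut E v X) * P v (t @ q) = 0"
proof -
  obtain x where x: "awalk v t x" "awalk x q w" using assms(2) by auto
  have *: "P v s * G v s * P v (t @ q) = (if s = t then P v (t @ q) else 0)" if s: "s \<in> X" for s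
  proof (cases "s = t")
    case True
    then show ?thesis using x by (simp add: mult.assoc G_P_append) (simp add: P_append)
  next
    case False
    then have "s \<parallel> t" "\<exists>y. awalk v s y" using X s assms(1) by (auto simp: path_antichain_def)
    then show ?thesis using False x G_P_parallel[of v s _ t x]
      by (auto simp: P_append mult.assoc) (simp flip: mult.assoc)
  qed
  have "h (path_cut E v X) * P v (t @ q) = P v (t @ q) - (\<Sum>s\<in>X. P v s * G v s * P v (t @ q))"
    unfolding h_cut using assms(2) by (simp only: left_diff_distrib sum_distrib_right V_P)
  also have "(\<Sum>s\<in>X. P v s * G v s * P v (t @ q)) = (\<Sum>s\<in>X. if s = t then P v (t @ q) else 0)"
    using * by (intro sum.cong) auto
  also have "\<dots> = P v (t @ q)" using assms(1) cut_vert(2) by simp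
  finally show ?thesis by simp
qed

lemma cut_idem: "h (path_cut E v X) * h (path_cut E v X) = h (path_cut E v X)"
proof -
  have "h (path_cut E v X) * (P v t * G v t) = 0" if "t \<in> X" for t
    using cut_P[of t "[]"] X that by (auto simp: path_antichain_def simp flip: mult.assoc)
  then have "h (path_cut E v X) * (\<Sum>t\<in>X. P v t * G v t) = 0"
    by (simp add: sum_distrib_left)
  then show ?thesis
    by (subst (2) h_cut) (simp add: right_diff_distrib cut_V)
qed

end

end

section \<open>Closed simple paths\<close>

context wf_digraph
begin

text \<open>Split at any later visit to \<open>v\<close>: the piece before it is a shorter closed
  path, to which the induction applies.\<close>

lemma closed_path_starts_simple:
  "awalk v p v \<Longrightarrow> p \<noteq> [] \<Longrightarrow> \<exists>c q. p = c @ q \<and> closed_simple_path G v c \<and> awalk v q v"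
proof (induction "length p" arbitrary: p rule: less_induct)
  case less
  show ?case
  proof (cases "closed_simple_path G v p")
    case True
    then show ?thesis using less.prems awalk_hd_in_verts
      by (intro exI[of _ p] exI[of _ "[]"]) (auto simp: awalk_Nil_iff)
  next
    case False
    then obtain e where e: "e \<in> set (tl p)" "tail G e = v"
      using less.prems by (auto simp: closed_simple_path_def)
    obtain f p' where p: "p = f # p'" using less.prems by (cases p) auto
    obtain r s where rs: "p' = r @ e # s" using e(1) p by (auto simp: in_set_conv_decomp)
    have pe: "p = (f # r) @ (e # s)" by (simp add: p rs)
    obtain x where x: "awalk v (f # r) x" "awalk x (e # s) v"
      using less.prems(1) unfolding pe awalk_append_iff by blast
    then have xv: "x = v" using e(2) by (auto simp: awalk_simps)
    obtain c q where cq: "f # r = c @ q" "closed_simple_path G v c" "awalk v q v"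
      using less.hyps[of "f # r"] x(1) xv by (auto simp: p rs)
    have "awalk v (q @ (e # s)) v" using cq(3) x(2) xv by (metis awalk_appendI)
    then show ?thesis using cq(1,2) unfolding pe by (intro exI[of _ c] exI[of _ "q @ (e # s)"]) simp
  qed
qed

text \<open>A proper extension of \<open>c\<close> that closes at \<open>v\<close> again would leave
  \<open>v\<close> once more after its first edge.\<close>

lemma closed_simple_path_prefix:
  assumes "closed_simple_path G v c" "closed_simple_path G v d" "prefix c d"
  shows "c = d"
proof (rule ccontr)
  assume "c \<noteq> d"
  then obtain e r where d: "d = c @ e # r" using assms(3) by (metis append.right_neutral neq_Nil_conv prefixE)
  have "awalk v c v" "awalk v (c @ e # r) v" "c \<noteq> []" using assms d by (auto simp: closed_simple_path_def)
  then have "tail G e = v" "e \<in> set (tl d)" by (auto simp: awalk_simps d tl_append split: list.split)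
  then show False using assms(2) by (auto simp: closed_simple_path_def)
qed

lemma closed_simple_path_parallel:
  "closed_simple_path G v c \<Longrightarrow> closed_simple_path G v d \<Longrightarrow> c \<noteq> d \<Longrightarrow> c \<parallel> d"
  using closed_simple_path_prefix by blast

end

section \<open>Reduction\<close>

context lpa_hom
begin

definition cycle_poly :: "'v \<Rightarrow> 'k \<Rightarrow> 'e list set \<Rightarrow> ('e list \<Rightarrow> 'k) \<Rightarrow> ('k,'v,'e) lpa_word_alg" where
  "cycle_poly v k D f = const k * gen (Vert v) + (\<Sum>d\<in>D. const (f d) * pth E v d)"

definition closed_paths :: "'v \<Rightarrow> 'e list set \<Rightarrow> bool" where
  "closed_paths v D \<longleftrightarrow> v \<in> verts E \<and> finite D \<and> (\<forall>d\<in>D. awalk v d v \<and> d \<noteq> [])"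

text \<open>The multipliers lie in the image of \<open>h\<close>, so for \<open>a = h p\<close> the
  reduced element is \<open>h (x * p * y)\<close>. Thus it has a lift in every ideal of the word
  algebra that contains \<open>p\<close>.\<close>

definition reduces_to_cut :: "'a \<Rightarrow> bool" where
  "reduces_to_cut a \<longleftrightarrow> (\<exists>x y v X. path_antichain E v X \<and> h (path_cut E v X) \<noteq> 0 \<and>
     h x * a * h y = h (path_cut E v X))"

definition reduces_to_cycle :: "'a \<Rightarrow> bool" where
  "reduces_to_cycle a \<longleftrightarrow> (\<exists>x y v k D f c. closed_paths v D \<and> k \<noteq> 0 \<and>
     closed_simple_path E v c \<and> V v = P v c * G v c \<and>
     h (cycle_poly v k D f) \<noteq> 0 \<and> h x * a * h y = h (cycle_poly v k D f))"

lemma reduces_to_cut_mult: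
  assumes "reduces_to_cut (h p * a * h q)" shows "reduces_to_cut a"
proof -
  from assms obtain x y v X where *: "path_antichain E v X" "h (path_cut E v X) \<noteq> 0"
      "h x * (h p * a * h q) * h y = h (path_cut E v X)"
    unfolding reduces_to_cut_def by blast
  moreover have "h x * (h p * a * h q) * h y = h (x * p) * a * h (q * y)"
    by (simp add: h_mult mult.assoc)
  ultimately show ?thesis unfolding reduces_to_cut_def by metis
qed

lemma reduces_to_cycle_mult:
  assumes "reduces_to_cycle (h p * a * h q)" shows "reduces_to_cycle a"
proof -
  from assms obtain x y v k D f c where *: "closed_paths v D" "k \<noteq> 0"
     "closed_simple_path E v c" "V v = P v c * G v c" "h (cycle_poly v k D f) \<noteq> 0"
     "h x * (h p * a * h q) * h y = h (cycle_poly v k D f)"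
    unfolding reduces_to_cycle_def by blast
  moreover have "h x * (h p * a * h q) * h y = h (x * p) * a * h (q * y)"
    by (simp add: h_mult mult.assoc)
  ultimately show ?thesis unfolding reduces_to_cycle_def by metis
qed

definition reducible :: "'a \<Rightarrow> bool" where
  "reducible a \<longleftrightarrow> reduces_to_cut a \<or> reduces_to_cycle a"

lemma reducible_mult: "reducible (h p * a * h q) \<Longrightarrow> reducible a"
  unfolding reducible_def using reduces_to_cut_mult reduces_to_cycle_mult by blast

lemma reducible_lmult: "reducible (h p * h a) \<Longrightarrow> reducible (h a)"
  using reducible_mult[of p "h a" 1] by (simp add: h_1_right flip: h_mult)

lemma reducible_rmult: "reducible (h a * h q) \<Longrightarrow> reducible (h a)"
  using reducible_mult[of 1 "h a" q] by (simp add: h_1_left flip: h_mult)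

lemma h_cycle_poly: "h (cycle_poly v k D f) = S k * V v + (\<Sum>d\<in>D. S (f d) * P v d)"
  by (simp add: cycle_poly_def h_add h_sum h_mult)

text \<open>Every path in the polynomial begins with a path in \<open>X\<close> and is killed by the
  cut, so only the constant term is left.\<close>

lemma cut_cycle_poly:
  assumes X: "path_antichain E v X" and D: "closed_paths v D"
    and DX: "\<And>d. d \<in> D \<Longrightarrow> \<exists>t\<in>X. \<exists>q. d = t @ q"
  shows "h (path_cut E v X) * h (cycle_poly v k D f) = S k * h (path_cut E v X)"
proof -
  have "h (path_cut E v X) * P v d = 0" if d: "d \<in> D" for d
  proof -
    obtain t q where tq: "t \<in> X" "d = t @ q" using DX[OF d] by blast
    then have "awalk v (t @ q) v" using D d by (simp add: closed_paths_def del: awalk_append_iff)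
    then show ?thesis unfolding tq(2) by (rule cut_P[OF X tq(1)])
  qed
  then have "h (path_cut E v X) * (\<Sum>d\<in>D. S (f d) * P v d) = 0"
    by (simp add: sum_distrib_left S_comm')
  then show ?thesis
    by (simp add: h_cycle_poly distrib_left S_comm' cut_V[OF X])
qed

lemma reduces_to_cutI:
  assumes X: "path_antichain E v X" and "h (path_cut E v X) \<noteq> 0" "k \<noteq> 0"
    and "h x * a * h y = S k * h (path_cut E v X)"
  shows "reduces_to_cut a"
proof -
  have "h (const (1/k) * x) * a * h y = S (1/k) * (h x * a * h y)"
    by (simp add: h_mult mult.assoc)
  also have "\<dots> = h (path_cut E v X)"
    using assms(3,4) by (simp add: S_mult S_1 flip: mult.assoc)
  finally show ?thesis using X assms(2) unfolding reduces_to_cut_def by blast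
qed

text \<open>
  Cut off the closed simple paths that begin the paths of the polynomial.  If the cut vanishes,
  then at least two of them occur, and conjugating by one of them shortens the polynomial.
\<close>

lemma cycle_poly_reduces_to_cut:
  assumes "V v \<noteq> 0" "\<And>c. closed_simple_path E v c \<Longrightarrow> V v \<noteq> P v c * G v c" "k \<noteq> 0" "closed_paths v D"
  shows "reduces_to_cut (h (cycle_poly v k D f))"
  using assms(4)
proof (induction "card D" arbitrary: D f rule: less_induct)
  case less
  have v: "v \<in> verts E" and fin: "finite D" using less.prems by (auto simp: closed_paths_def)
  have "\<forall>d\<in>D. \<exists>c q. d = c @ q \<and> closed_simple_path E v c \<and> awalk v q v"
    using less.prems closed_path_starts_simple by (auto simp: closed_paths_def)
  then obtain c r where cr: "\<And>d. d \<in> D \<Longrightarrow> d = c d @ r d"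
    "\<And>d. d \<in> D \<Longrightarrow> closed_simple_path E v (c d)" "\<And>d. d \<in> D \<Longrightarrow> awalk v (r d) v"
    by metis
  have wc: "awalk v (c d) v" if "d \<in> D" for d
    using cr(2)[OF that] by (simp add: closed_simple_path_def)
  let ?X = "c ` D"
  have X: "path_antichain E v ?X"
    using v fin wc closed_simple_path_parallel[OF cr(2) cr(2)]
    by (auto simp: path_antichain_def)
  show ?case
  proof (cases "h (path_cut E v ?X) = 0")
    case False
    have "h (path_cut E v ?X) * h (cycle_poly v k D f) = S k * h (path_cut E v ?X)"
      using cr(1) by (intro cut_cycle_poly[OF X less.prems]) blast
    then have "h (path_cut E v ?X) * h (cycle_poly v k D f) * h 1 = S k * h (path_cut E v ?X)"
      by (simp add: h_1_right flip: h_mult)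
    then show ?thesis by (intro reduces_to_cutI[OF X False assms(3)])
  next
    case True
    then have sumX: "V v = (\<Sum>t\<in>?X. P v t * G v t)" by (simp add: h_cut)
    have "?X \<noteq> {}" using sumX assms(1) by auto
    then obtain d where d: "d \<in> D" by blast
    \<comment> \<open>If \<open>c d\<close> were the only beginning, the vanishing cut would say
      that \<open>v\<close> is the product of this closed simple path and its adjoint, which is
      excluded.\<close>
    have "?X \<noteq> {c d}" using sumX assms(2)[OF cr(2)[OF d]] by auto
    then obtain d' where d': "d' \<in> D" "c d' \<noteq> c d" using d by auto
    let ?c = "c d"
    let ?D1 = "{e \<in> D. c e = ?c}"
    \<comment> \<open>Conjugation by \<open>?c\<close> turns \<open>?c @ r e\<close> into
      \<open>r e @ ?c\<close>, keeps the constant term and kills the paths that begin with another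
      closed simple path. At least \<open>d'\<close> is lost.\<close>
    let ?\<psi> = "\<lambda>e. r e @ ?c"
    have inj: "inj_on ?\<psi> ?D1" using cr(1) by (intro inj_onI) (metis (mono_tags, lifting) append_same_eq mem_Collect_eq)
    let ?g = "f \<circ> the_inv_into ?D1 ?\<psi>"
    have "card (?\<psi> ` ?D1) \<le> card ?D1" using fin by (intro card_image_le) auto
    also have "\<dots> < card D" using d' fin by (intro psubset_card_mono) auto
    finally have card: "card (?\<psi> ` ?D1) < card D" .
    have closed: "closed_paths v (?\<psi> ` ?D1)"
      using fin v awalk_appendI[OF cr(3) wc[OF d]] cr(2)[OF d]
      by (auto simp: closed_paths_def closed_simple_path_def simp del: awalk_append_iff)
    have *: "G v ?c * P v e * P v ?c = (if c e = ?c then P v (?\<psi> e) else 0)" if e: "e \<in> D" for e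
    proof (cases "c e = ?c")
      case True
      have "G v ?c * P v (?c @ r e) * P v ?c = P v (r e) * P v ?c"
        using G_P_append[OF wc[OF d] cr(3)[OF e]] by simp
      then show ?thesis using True cr(1)[OF e] P_append[OF cr(3)[OF e] wc[OF d]] by simp
    next
      case False
      then have "?c \<parallel> c e" using closed_simple_path_parallel[OF cr(2)[OF d] cr(2)[OF e]] by auto
      then have "G v ?c * P v (c e) = 0" by (rule G_P_parallel[OF wc[OF d] wc[OF e]])
      then have "G v ?c * P v (c e @ r e) = 0"
        by (simp add: P_append[OF wc[OF e] cr(3)[OF e]] flip: mult.assoc)
      then show ?thesis using False cr(1)[OF e] by simp
    qed
    have "G v ?c * h (cycle_poly v k D f) * P v ?c =
        S k * (G v ?c * (V v * P v ?c)) + (\<Sum>e\<in>D. S (f e) * (G v ?c * P v e * P v ?c))"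
      by (simp add: h_cycle_poly distrib_left distrib_right sum_distrib_left sum_distrib_right
          S_comm' mult.assoc)
    also have "(\<Sum>e\<in>D. S (f e) * (G v ?c * P v e * P v ?c)) = (\<Sum>e\<in>D. if c e = ?c then S (f e) * P v (?\<psi> e) else 0)"
      using * by (intro sum.cong) auto
    also have "\<dots> = (\<Sum>e\<in>?D1. S (f e) * P v (?\<psi> e))"
      using fin by (simp add: sum.If_cases Int_def)
    also have "\<dots> = (\<Sum>e\<in>?\<psi> ` ?D1. S (?g e) * P v e)"
      unfolding sum.reindex[OF inj] o_def using the_inv_into_f_f[OF inj] by (intro sum.cong) auto
    also have "S k * (G v ?c * (V v * P v ?c)) = S k * V v"
      by (simp add: V_P[OF wc[OF d]] G_P[OF wc[OF d]])
    finally have "G v ?c * h (cycle_poly v k D f) * P v ?c = h (cycle_poly v k (?\<psi> ` ?D1) ?g)"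
      by (simp add: h_cycle_poly)
    then have "reduces_to_cut (G v ?c * h (cycle_poly v k D f) * P v ?c)"
      using less.hyps[OF card closed, of ?g] by simp
    then show ?thesis by (rule reduces_to_cut_mult)
  qed
qed

lemma cycle_poly_reducible:
  assumes "h (cycle_poly v k D f) \<noteq> 0" "k \<noteq> 0" "closed_paths v D"
  shows "reducible (h (cycle_poly v k D f))"
proof (cases "\<exists>c. closed_simple_path E v c \<and> V v = P v c * G v c")
  case True
  have "h 1 * h (cycle_poly v k D f) * h 1 = h (cycle_poly v k D f)"
    by (simp add: h_1_left h_1_right)
  then show ?thesis
    using True assms unfolding reducible_def reduces_to_cycle_def by blast
next
  case False
  have "V v \<noteq> 0"
  proof
    assume "V v = 0"
    moreover have "P v d = 0" if "d \<in> D" for d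
      using V_P[of v d v] that assms(3) \<open>V v = 0\<close> by (auto simp: closed_paths_def)
    ultimately show False using assms(1) by (simp add: h_cycle_poly)
  qed
  then show ?thesis
    using False assms cycle_poly_reduces_to_cut unfolding reducible_def by blast
qed

text \<open>Strip first edges until a trivial path occurs.  The factor \<open>z\<close> records that the product stays nonzero.\<close>

lemma trim_real:
  assumes "finite D" "\<And>p. p \<in> D \<Longrightarrow> awalk u p w" "w \<in> verts E"
    "(\<Sum>p\<in>D. S (f p) * P u p) * z \<noteq> 0"
  shows "\<exists>y k D' g. k \<noteq> 0 \<and> closed_paths w D' \<and>
    h y * (\<Sum>p\<in>D. S (f p) * P u p) = h (cycle_poly w k D' g) \<and>
    h (cycle_poly w k D' g) * z \<noteq> 0"
  using assms(1,2,4)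
\<comment> \<open>The \<open>Suc\<close> makes the measure drop also when a trivial path with
  coefficient zero is removed.\<close>
proof (induction "\<Sum>p\<in>D. Suc (length p)" arbitrary: D f u rule: less_induct)
  case less
  let ?b = "\<Sum>p\<in>D. S (f p) * P u p"
  show ?case
  proof (cases "[] \<in> D")
    case True
    then have u: "u = w" using less.prems(2)[OF True] by (simp add: awalk_Nil_iff)
    have split: "?b = S (f []) * V w + (\<Sum>p\<in>D - {[]}. S (f p) * P u p)"
      using sum.remove[OF less.prems(1) True, of "\<lambda>p. S (f p) * P u p"] by (simp add: u)
    show ?thesis
    proof (cases "f [] = 0")
      case True0: True
      then have "?b = (\<Sum>p\<in>D - {[]}. S (f p) * P u p)" using split by (simp add: h_0)
      moreover have "(\<Sum>p\<in>D - {[]}. Suc (length p)) < (\<Sum>p\<in>D. Suc (length p))"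
        using less.prems(1) True by (simp add: sum.remove[of D "[]"])
      ultimately show ?thesis
        using less.hyps[of "D - {[]}" u f] less.prems by auto
    next
      case False
      have b: "?b = h (cycle_poly w (f []) (D - {[]}) f)"
        using split u by (simp add: h_cycle_poly)
      show ?thesis
      proof (intro exI conjI)
        show "f [] \<noteq> 0" by (rule False)
        show "closed_paths w (D - {[]})"
          using less.prems assms(3) u by (auto simp: closed_paths_def)
        show "h 1 * ?b = h (cycle_poly w (f []) (D - {[]}) f)"
          unfolding b by (rule h_1_left)
        show "h (cycle_poly w (f []) (D - {[]}) f) * z \<noteq> 0"
          using less.prems(3) unfolding b .
      qed
    qed
  next
    case False
    let ?H = "hd ` D"
    have H: "e \<in> arcs E \<and> tail E e = u" if e: "e \<in> ?H" for e
    proof -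
      obtain p where p: "p \<in> D" "e = hd p" using e by blast
      then show ?thesis using less.prems(2)[OF p(1)] False by (cases p) (auto simp: awalk_simps)
    qed
    have Gb: "Gh e * P u p = (if hd p = e then P (head E e) (tl p) else 0)" if "p \<in> D" "e \<in> ?H" for p e
      using less.prems(2)[OF that(1)] False that H[OF that(2)] by (cases p) (auto simp: Gh_P_Cons simp del: P_Cons)
    \<comment> \<open>The finitely many first edges of the paths in \<open>D\<close> already resolve
      the identity on these paths, so some \<open>Gh e * ?b * z\<close> is nonzero even if
      \<open>u\<close> is an infinite emitter.\<close>
    have "(\<Sum>e\<in>?H. Ed e * (Gh e * P u p)) = P u p" if p: "p \<in> D" for p
    proof -
      have "Ed (hd p) * P (head E (hd p)) (tl p) = P u p" using p False by (cases p) auto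
      then have "Ed e * (Gh e * P u p) = (if e = hd p then P u p else 0)" if "e \<in> ?H" for e
        using Gb[OF p that] by auto
      then have "(\<Sum>e\<in>?H. Ed e * (Gh e * P u p)) = (\<Sum>e\<in>?H. if e = hd p then P u p else 0)"
        by (intro sum.cong refl)
      also have "\<dots> = P u p" using p less.prems(1) by simp
      finally show ?thesis .
    qed
    then have "?b = (\<Sum>p\<in>D. S (f p) * (\<Sum>e\<in>?H. Ed e * (Gh e * P u p)))" by simp
    also have "\<dots> = (\<Sum>e\<in>?H. Ed e * (Gh e * ?b))"
      unfolding sum_distrib_left by (subst sum.swap) (simp add: S_comm')
    finally have "?b * z = (\<Sum>e\<in>?H. Ed e * (Gh e * ?b * z))"
      by (metis (no_types, lifting) mult.assoc sum.cong sum_distrib_right)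
    then obtain e where e: "e \<in> ?H" "Gh e * ?b * z \<noteq> 0"
      using less.prems(3) by (metis (no_types, lifting) mult_zero_right sum.neutral)
    let ?D = "tl ` {p \<in> D. hd p = e}"
    let ?g = "\<lambda>p. f (e # p)"
    have De: "p = e # tl p" if "p \<in> D" "hd p = e" for p
      using that False by (cases p) auto
    have inj: "inj_on tl {p \<in> D. hd p = e}"
      by (rule inj_onI) (metis (mono_tags, lifting) De mem_Collect_eq)
    have Geb: "Gh e * ?b = (\<Sum>p\<in>?D. S (?g p) * P (head E e) p)"
    proof -
      have "Gh e * ?b = (\<Sum>p\<in>D. S (f p) * (Gh e * P u p))"
        by (simp add: sum_distrib_left S_comm')
      also have "\<dots> = (\<Sum>p\<in>D. if hd p = e then S (f p) * P (head E e) (tl p) else 0)"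
        using e by (intro sum.cong) (auto simp: Gb)
      also have "\<dots> = (\<Sum>p\<in>{p \<in> D. hd p = e}. S (f p) * P (head E e) (tl p))"
        using less.prems(1) by (simp add: sum.If_cases Int_def)
      also have "\<dots> = (\<Sum>p\<in>{p \<in> D. hd p = e}. S (?g (tl p)) * P (head E e) (tl p))"
        using De by (intro sum.cong) auto
      also have "\<dots> = (\<Sum>p\<in>?D. S (?g p) * P (head E e) p)"
        by (simp add: sum.reindex[OF inj])
      finally show ?thesis .
    qed
    have fin: "finite ?D" using less.prems(1) by simp
    have walk: "awalk (head E e) p w" if p: "p \<in> ?D" for p
    proof -
      obtain q where q: "q \<in> D" "hd q = e" "p = tl q" using p by blast
      then have "awalk u (e # p) w" using less.prems(2)[OF q(1)] De[OF q(1,2)] by simp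
      then show ?thesis by (simp add: awalk_Cons_iff)
    qed
    have ne: "{p \<in> D. hd p = e} \<noteq> {}" using e(1) by auto
    have "(\<Sum>p\<in>?D. Suc (length p)) = (\<Sum>p\<in>{p \<in> D. hd p = e}. Suc (length (tl p)))"
      by (simp add: sum.reindex[OF inj])
    also have "\<dots> < (\<Sum>p\<in>{p \<in> D. hd p = e}. Suc (length p))"
    proof (rule sum_strict_mono)
      show "Suc (length (tl p)) < Suc (length p)" if "p \<in> {p \<in> D. hd p = e}" for p
        using that False by (cases p) auto
    qed (use ne less.prems(1) in auto)
    also have "\<dots> \<le> (\<Sum>p\<in>D. Suc (length p))"
      using less.prems(1) by (intro sum_mono2) auto
    finally have card: "(\<Sum>p\<in>?D. Suc (length p)) < (\<Sum>p\<in>D. Suc (length p))" .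
    have nz: "(\<Sum>p\<in>?D. S (?g p) * P (head E e) p) * z \<noteq> 0"
      using e(2) unfolding Geb .
    obtain y k D' g where *: "k \<noteq> 0" "closed_paths w D'" "h y * (Gh e * ?b) = h (cycle_poly w k D' g)"
        "h (cycle_poly w k D' g) * z \<noteq> 0"
      using less.hyps[OF card fin walk nz] unfolding Geb[symmetric] by blast
    have "h (y * gen (Ghost e)) * ?b = h (cycle_poly w k D' g)"
      using *(3) by (simp add: h_mult mult.assoc)
    then show ?thesis using * by blast
  qed
qed

text \<open>Combinations of \<open>p q^*\<close> with \<open>q\<close> of length at most
  \<open>n\<close>, built one term at a time. The bound drives the reduction: right multiplication
  by an edge lowers it (\<open>ghost_span_Ed\<close>).\<close>

inductive_set ghost_span :: "nat \<Rightarrow> 'v \<Rightarrow> 'v \<Rightarrow> 'a set" for n u w where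
  zero: "0 \<in> ghost_span n u w"
| step: "a \<in> ghost_span n u w \<Longrightarrow> awalk u p v \<Longrightarrow> awalk w q v \<Longrightarrow> length q \<le> n \<Longrightarrow>
    a + S c * (P u p * G w q) \<in> ghost_span n u w"

lemma ghost_span_real:
  assumes "a \<in> ghost_span 0 u w"
  shows "\<exists>D f. finite D \<and> (\<forall>p\<in>D. awalk u p w) \<and> a = (\<Sum>p\<in>D. S (f p) * P u p)"
  using assms
proof induction
  case zero
  show ?case by (rule exI[of _ "{}"]) simp
next
  case (step a p v q c)
  then obtain D f where *: "finite D" "\<forall>p\<in>D. awalk u p w" "a = (\<Sum>p\<in>D. S (f p) * P u p)" by blast
  have q: "q = []" "v = w" using step by (auto simp: awalk_Nil_iff)
  \<comment> \<open>A path that occurs already has its coefficient raised, so that \<open>D\<close>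
    can be a set of distinct paths.\<close>
  let ?f = "f(p := (if p \<in> D then f p else 0) + c)"
  have "(\<Sum>r\<in>insert p D. S (?f r) * P u r) = S (?f p) * P u p + (\<Sum>r\<in>D - {p}. S (?f r) * P u r)"
    using *(1) by (rule sum.insert_remove)
  also have "(\<Sum>r\<in>D - {p}. S (?f r) * P u r) = (\<Sum>r\<in>D - {p}. S (f r) * P u r)"
    by (intro sum.cong) auto
  also have "S (?f p) * P u p + \<dots> = a + S c * P u p"
    using *(1) by (cases "p \<in> D") (simp_all add: *(3) S_add h_0 distrib_right sum.remove[of D p])
  also have "S c * P u p = S c * (P u p * G w q)"
    using step(2) by (simp add: q P_V)
  finally show ?case
    using * step(2) q by (intro exI[of _ "insert p D"] exI[of _ ?f]) auto
qed

lemma ghost_span_Ed: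
  assumes "a \<in> ghost_span (Suc n) u (tail E e)" "e \<in> arcs E"
  shows "a * Ed e \<in> ghost_span n u (head E e)"
  using assms(1)
proof induction
  case zero
  show ?case by (simp add: ghost_span.zero)
next
  case (step a p v q c)
  show ?case
  proof (cases q)
    case Nil
    then have v: "v = tail E e" using step by (auto simp: awalk_Nil_iff)
    have 1: "awalk v [e] (head E e)" using v assms(2) arc_implies_awalk by simp
    have "P u p * V v * Ed e = P u p * P v [e]"
      using v assms(2) by (simp add: mult.assoc V_Ed Ed_V)
    also have "\<dots> = P u (p @ [e]) * G (head E e) []"
      using step(2) 1 P_append[OF step(2) 1] by (simp add: Ed_V assms(2) mult.assoc V_idem)
    finally have "(a + S c * (P u p * G (tail E e) q)) * Ed e = a * Ed e + S c * (P u (p @ [e]) * G (head E e) [])"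
      by (simp add: Nil v distrib_right mult.assoc)
    then show ?thesis
      using ghost_span.step[OF step.IH awalk_appendI[OF step(2) 1], of "[]"] assms(2)
      by (simp add: awalk_Nil_iff)
  next
    case (Cons f q')
    then have f: "f \<in> arcs E" "awalk (head E f) q' v" using step by (auto simp: awalk_simps)
    have "(a + S c * (P u p * G (tail E e) q)) * Ed e = a * Ed e + S c * (P u p * (G (head E f) q' * (Gh f * Ed e)))"
      by (simp add: Cons distrib_right mult.assoc)
    also have "\<dots> = (if f = e then a * Ed e + S c * (P u p * G (head E e) q') else a * Ed e)"
      using f assms(2) by (auto simp: Gh_Ed G_V)
    also have "\<dots> \<in> ghost_span n u (head E e)"
      using ghost_span.step[OF step.IH step(2), of q' c] f step(4) step.IH by (auto simp: Cons)
    finally show ?thesis .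
  qed
qed

text \<open>The terms with nonempty \<open>q\<close> are sorted by the first edge of
  \<open>q\<close>, which is the last factor of \<open>q^*\<close>. Only finitely many edges occur,
  so a cut along them makes sense even at an infinite emitter.\<close>

lemma ghost_span_split:
  assumes "a \<in> ghost_span (Suc n) u w"
  shows "\<exists>X b g. finite X \<and> (\<forall>e\<in>X. e \<in> out_arcs E w \<and> g e * V (head E e) = g e) \<and>
    b \<in> ghost_span 0 u w \<and> a = b + (\<Sum>e\<in>X. g e * Gh e)"
  using assms
proof induction
  case zero
  show ?case by (intro exI[of _ "{}"] exI[of _ 0]) (simp add: ghost_span.zero)
next
  case (step a p v q c)
  then obtain X b g where *: "finite X" "\<forall>e\<in>X. e \<in> out_arcs E w \<and> g e * V (head E e) = g e"
    "b \<in> ghost_span 0 u w" "a = b + (\<Sum>e\<in>X. g e * Gh e)" by blast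
  show ?case
  proof (cases q)
    case Nil
    have "b + S c * (P u p * G w q) \<in> ghost_span 0 u w"
      using ghost_span.step[OF *(3) step(2,3)] Nil by simp
    moreover have "a + S c * (P u p * G w q) = (b + S c * (P u p * G w q)) + (\<Sum>e\<in>X. g e * Gh e)"
      using *(4) by (simp add: ac_simps)
    ultimately show ?thesis using *(1,2) by blast
  next
    case (Cons f q')
    then have f: "f \<in> out_arcs E w" "awalk (head E f) q' v" using step by (auto simp: awalk_simps)
    let ?t = "S c * (P u p * G (head E f) q')"
    let ?g = "g(f := (if f \<in> X then g f else 0) + ?t)"
    have t: "?t * V (head E f) = ?t" using f by (simp add: mult.assoc G_V)
    have "(\<Sum>e\<in>insert f X. ?g e * Gh e) = ?g f * Gh f + (\<Sum>e\<in>X - {f}. ?g e * Gh e)"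
      using *(1) by (rule sum.insert_remove)
    also have "(\<Sum>e\<in>X - {f}. ?g e * Gh e) = (\<Sum>e\<in>X - {f}. g e * Gh e)"
      by (intro sum.cong) auto
    also have "?g f * Gh f + \<dots> = (\<Sum>e\<in>X. g e * Gh e) + ?t * Gh f"
      using *(1) by (cases "f \<in> X") (simp_all add: distrib_right sum.remove[of X f])
    also have "?t * Gh f = S c * (P u p * G w q)"
      by (simp add: Cons mult.assoc)
    finally have 1: "a + S c * (P u p * G w q) = b + (\<Sum>e\<in>insert f X. ?g e * Gh e)"
      using *(4) by (simp add: ac_simps)
    have 2: "\<forall>e\<in>insert f X. e \<in> out_arcs E w \<and> ?g e * V (head E e) = ?g e"
      using *(2) f t by (auto simp: distrib_right)
    have 3: "finite (insert f X)" using *(1) by simp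
    show ?thesis
      by (rule exI, rule exI, rule exI, intro conjI, rule 3, rule 2, rule *(3), rule 1)
  qed
qed

lemma path_antichain_edges:
  assumes "w \<in> verts E" "finite X" "X \<subseteq> out_arcs E w"
  shows "path_antichain E w ((\<lambda>e. [e]) ` X)"
  unfolding path_antichain_def using assms
  by (fastforce simp: awalk_simps)

lemma h_cut_edges:
  assumes "X \<subseteq> out_arcs E w"
  shows "h (path_cut E w ((\<lambda>e. [e]) ` X)) = V w - (\<Sum>e\<in>X. Ed e * Gh e)"
proof -
  have "(\<Sum>t\<in>(\<lambda>e. [e]) ` X. P w t * G w t) = (\<Sum>e\<in>X. P w [e] * G w [e])"
    by (subst sum.reindex) (auto simp: inj_on_def)
  also have "\<dots> = (\<Sum>e\<in>X. Ed e * Gh e)"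
    using assms by (intro sum.cong) (auto simp: Ed_V V_Gh)
  finally show ?thesis by (simp add: h_cut)
qed

text \<open>Let \<open>b\<close> be the polynomial and \<open>q\<close> the cut along
  \<open>X\<close>. As \<open>b\<close> kills the other edges at \<open>w\<close>, enlarging
  \<open>X\<close> by the first edges of the paths in \<open>D\<close> gives a cut \<open>q'\<close>
  with \<open>b q' = b q\<close>, so \<open>q'\<close> is nonzero. It also satisfies
  \<open>q' b = k q'\<close>, whence \<open>q' b q = q' b q' = k q'\<close>.\<close>

lemma cycle_poly_edge_cut_reduces:
  assumes "h (cycle_poly w k D f) * h (path_cut E w ((\<lambda>e. [e]) ` X)) \<noteq> 0" "k \<noteq> 0" "closed_paths w D"
    "finite X" "X \<subseteq> out_arcs E w"
    "\<And>e. e \<in> out_arcs E w - X \<Longrightarrow> h (cycle_poly w k D f) * Ed e = 0"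
  shows "reduces_to_cut (h (cycle_poly w k D f) * h (path_cut E w ((\<lambda>e. [e]) ` X)))"
proof -
  let ?b = "h (cycle_poly w k D f)"
  let ?X' = "X \<union> hd ` D"
  let ?q = "h (path_cut E w ((\<lambda>e. [e]) ` X))" and ?q' = "h (path_cut E w ((\<lambda>e. [e]) ` ?X'))"
  have w: "w \<in> verts E" and D: "\<And>d. d \<in> D \<Longrightarrow> awalk w d w \<and> d \<noteq> []" "finite D"
    using assms(3) by (auto simp: closed_paths_def)
  have hd: "hd d \<in> out_arcs E w" if "d \<in> D" for d
    using D(1)[OF that] by (cases d) (auto simp: awalk_simps)
  have X': "finite ?X'" "?X' \<subseteq> out_arcs E w"
    using assms(4,5) hd D(2) by auto
  note ac' = path_antichain_edges[OF w X']
  have "?q - ?q' = (\<Sum>e\<in>?X'. Ed e * Gh e) - (\<Sum>e\<in>X. Ed e * Gh e)"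
    using assms(5) X'(2) by (simp add: h_cut_edges)
  also have "\<dots> = (\<Sum>e\<in>?X' - X. Ed e * Gh e)"
    using X'(1) by (subst sum_diff) auto
  finally have "?b * ?q - ?b * ?q' = (\<Sum>e\<in>?X' - X. ?b * Ed e * Gh e)"
    by (metis (no_types, lifting) mult.assoc right_diff_distrib sum.cong sum_distrib_left)
  also have "\<dots> = 0"
    using assms(6) X'(2) by (intro sum.neutral) auto
  finally have bq: "?b * ?q = ?b * ?q'" by simp
  then have "?q' \<noteq> 0" using assms(1) by auto
  have "d = [hd d] @ tl d" if "d \<in> D" for d
    using D(1)[OF that] by simp
  then have qb: "?q' * ?b = S k * ?q'"
    by (intro cut_cycle_poly[OF ac' assms(3)]) blast
  have "?q' * (?b * ?q') = S k * (?q' * ?q')"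
    unfolding mult.assoc[symmetric] qb by (rule refl)
  moreover have "?q' * (?b * ?q') * h 1 = ?q' * (?b * ?q')"
    by (simp add: h_1_right flip: h_mult)
  ultimately have "?q' * (?b * ?q) * h 1 = S k * ?q'"
    unfolding bq cut_idem[OF ac'] by simp
  then show ?thesis
    by (rule reduces_to_cutI[OF ac' \<open>?q' \<noteq> 0\<close> assms(2)])
qed

text \<open>If \<open>a\<close> survives multiplication by an edge at \<open>w\<close>, its ghost
  parts become shorter. If it kills all these edges, then \<open>b e = - g e\<close> for the parts
  given by \<open>ghost_span_split\<close>, hence \<open>a = b q\<close> with \<open>q\<close> the
  cut along the edges in \<open>X\<close>. Now \<open>b\<close> has no ghost parts and can be
  trimmed while the product with \<open>q\<close> stays nonzero.\<close>

lemma ghost_span_reducible: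
  assumes "h a \<in> ghost_span n u w" "h a \<noteq> 0" "w \<in> verts E"
  shows "reducible (h a)"
  using assms
proof (induction n arbitrary: a w)
  case 0
  obtain D f where *: "finite D" "\<forall>p\<in>D. awalk u p w" "h a = (\<Sum>p\<in>D. S (f p) * P u p)"
    using ghost_span_real[OF 0(1)] by blast
  have nz: "(\<Sum>p\<in>D. S (f p) * P u p) * h 1 \<noteq> 0"
    unfolding *(3)[symmetric] h_1_right by (rule 0(2))
  obtain y k D' g where **: "k \<noteq> 0" "closed_paths w D'" "h y * h a = h (cycle_poly w k D' g)"
      "h (cycle_poly w k D' g) * h 1 \<noteq> 0"
    using trim_real[OF *(1) _ 0(3) nz] *(2) unfolding *(3)[symmetric] by blast
  then have "reducible (h y * h a)"
    by (simp add: h_1_right cycle_poly_reducible)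
  then show ?case by (rule reducible_lmult)
next
  case (Suc n)
  show ?case
  proof (cases "\<exists>e\<in>out_arcs E w. h a * Ed e \<noteq> 0")
    case True
    then obtain e where e: "e \<in> arcs E" "tail E e = w" "h a * Ed e \<noteq> 0" by auto
    have "h (a * gen (Edge e)) \<in> ghost_span n u (head E e)"
      using ghost_span_Ed[of "h a" n u e] e Suc.prems(1) by (simp add: h_mult)
    then have "reducible (h (a * gen (Edge e)))"
      using e by (intro Suc.IH) (auto simp: h_mult)
    then show ?thesis unfolding h_mult by (rule reducible_rmult)
  next
    case False
    then have aE: "h a * Ed e = 0" if "e \<in> out_arcs E w" for e using that by auto
    obtain X b g where *: "finite X" "\<forall>e\<in>X. e \<in> out_arcs E w \<and> g e * V (head E e) = g e"
      "b \<in> ghost_span 0 u w" "h a = b + (\<Sum>e\<in>X. g e * Gh e)"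
      using ghost_span_split[OF Suc.prems(1)] by blast
    have X: "X \<subseteq> out_arcs E w" using *(2) by auto
    have bE: "b * Ed e = (if e \<in> X then - g e else 0)" if e: "e \<in> out_arcs E w" for e
    proof -
      have "(\<Sum>f\<in>X. g f * Gh f) * Ed e = (\<Sum>f\<in>X. if f = e then g e else 0)"
        unfolding sum_distrib_right using *(2) e
        by (intro sum.cong) (auto simp: mult.assoc Gh_Ed)
      also have "\<dots> = (if e \<in> X then g e else 0)" using *(1) by simp
      finally have "h a * Ed e = b * Ed e + (if e \<in> X then g e else 0)"
        by (simp add: *(4) distrib_right)
      then show ?thesis using aE[OF e] by (auto simp: eq_neg_iff_add_eq_0)
    qed
    obtain D f where D: "finite D" "\<forall>p\<in>D. awalk u p w" "b = (\<Sum>p\<in>D. S (f p) * P u p)"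
      using ghost_span_real[OF *(3)] by blast
    let ?q = "h (path_cut E w ((\<lambda>e. [e]) ` X))"
    have "b * V w = b"
      using D(2) by (auto simp: D(3) sum_distrib_right mult.assoc P_V intro!: sum.cong)
    then have "b * ?q = b - (\<Sum>e\<in>X. b * Ed e * Gh e)"
      by (simp add: h_cut_edges[OF X] right_diff_distrib sum_distrib_left mult.assoc)
    also have "(\<Sum>e\<in>X. b * Ed e * Gh e) = - (\<Sum>e\<in>X. g e * Gh e)"
      unfolding sum_negf[symmetric] using X by (intro sum.cong) (auto simp: bE)
    finally have aq: "h a = b * ?q" using *(4) by simp
    then have nz: "(\<Sum>p\<in>D. S (f p) * P u p) * ?q \<noteq> 0" using Suc.prems(2) D(3) by simp
    obtain y k D' g' where **: "k \<noteq> 0" "closed_paths w D'" "h y * b = h (cycle_poly w k D' g')"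
        "h (cycle_poly w k D' g') * ?q \<noteq> 0"
      using trim_real[OF D(1) _ Suc.prems(3) nz] D(2) unfolding D(3)[symmetric] by blast
    have "h (cycle_poly w k D' g') * Ed e = 0" if "e \<in> out_arcs E w - X" for e
      unfolding **(3)[symmetric] using bE[of e] that by (simp add: mult.assoc)
    then have "reduces_to_cut (h (cycle_poly w k D' g') * ?q)"
      using ** *(1) X by (intro cycle_poly_edge_cut_reduces) auto
    then have "reducible (h y * h a)"
      unfolding **(3)[symmetric] aq reducible_def by (simp add: mult.assoc)
    then show ?thesis by (rule reducible_lmult)
  qed
qed

end

section \<open>Spanning by monomials \<open>p q^*\<close> and passage to corners\<close>

context lpa_hom
begin

inductive_set monomial_span :: "'a set" where
  zero: "0 \<in> monomial_span"
| step: "a \<in> monomial_span \<Longrightarrow> awalk u p v \<Longrightarrow> awalk w q v \<Longrightarrow>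
    a + S c * (P u p * G w q) \<in> monomial_span"

lemma monomial_span_add: "b \<in> monomial_span \<Longrightarrow> a \<in> monomial_span \<Longrightarrow> a + b \<in> monomial_span"
proof (induction rule: monomial_span.induct)
  case (step b u p v w q c)
  then show ?case
    using monomial_span.step[of "a + b" u p v w q c] by (simp add: add.assoc)
qed simp

lemma monomial_span_monomial:
  "awalk u p v \<Longrightarrow> awalk w q v \<Longrightarrow> S c * (P u p * G w q) \<in> monomial_span"
  using monomial_span.step[OF monomial_span.zero, of u p v w q c] by simp

text \<open>A monomial goes to a monomial or to 0. The ghost part grows only when a ghost edge meets
  a trivial \<open>p\<close>, where \<open>e^* q^* = (q e)^*\<close> is used.\<close>

lemma monomial_span_gen:
  assumes "g \<in> lpa_gens E" "awalk u p v" "awalk w q v"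
  shows "h (gen g) * (S c * (P u p * G w q)) \<in> monomial_span"
proof (cases g)
  case (Vert x)
  then have x: "x \<in> verts E" using assms(1) by simp
  show ?thesis
  proof (cases "x = u")
    case True
    then show ?thesis
      using monomial_span_monomial[OF assms(2,3)] Vert V_P[OF assms(2)]
      by (simp add: S_comm' flip: mult.assoc[of "V u"])
  next
    case False
    then show ?thesis
      using V_neq_P[OF assms(2) x] Vert monomial_span.zero
      by (simp add: S_comm' flip: mult.assoc[of "V x"])
  qed
next
  case (Edge e)
  then have e: "e \<in> arcs E" using assms(1) by simp
  show ?thesis
  proof (cases "head E e = u")
    case True
    have "awalk (tail E e) (e # p) v" using e True assms(2) by (simp add: awalk_simps)
    from monomial_span_monomial[OF this assms(3), of c] show ?thesis
      using Edge True by (simp add: S_comm' mult.assoc)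
  next
    case False
    then show ?thesis
      using Ed_neq_P[OF assms(2) e] Edge monomial_span.zero
      by (simp add: S_comm' flip: mult.assoc[of "Ed e"])
  qed
next
  case (Ghost e)
  then have e: "e \<in> arcs E" using assms(1) by simp
  show ?thesis
  proof (cases p)
    case Nil
    then have u: "u = v" "u \<in> verts E" using assms(2) by (auto simp: awalk_Nil_iff)
    show ?thesis
    proof (cases "u = tail E e")
      case True
      have 1: "awalk u [e] (head E e)" using e True arc_implies_awalk by simp
      have "awalk w (q @ [e]) (head E e)" using assms(3) 1 u by (metis awalk_appendI)
      from monomial_span_monomial[OF _ this, of "head E e" "[]" c]
      have "S c * (V (head E e) * G w (q @ [e])) \<in> monomial_span"
        using e by (simp add: awalk_Nil_iff)
      moreover have "V (head E e) * G w (q @ [e]) = Gh e * (P u p * G w q)"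
        using G_append[OF assms(3), of "[e]" "head E e"] 1 u Nil e V_G[OF assms(3)]
        by (simp add: V_Gh flip: mult.assoc)
      ultimately show ?thesis using Ghost by (simp add: S_comm')
    next
      case False
      then have "Gh e * V u = 0" using Gh_neq_V[OF e u(2)] by simp
      then show ?thesis using Ghost Nil monomial_span.zero
        by (simp add: S_comm' flip: mult.assoc[of "Gh e"])
    qed
  next
    case (Cons f p')
    then have f: "awalk (head E f) p' v" using assms(2) by (simp add: awalk_Cons_iff)
    have "Gh e * (P u p * G w q) = (if e = f then P (head E f) p' * G w q else 0)"
      using Gh_P_Cons[OF e, of u f p' v] assms(2) Cons
      by (simp del: P_Cons flip: mult.assoc)
    then show ?thesis
      using monomial_span_monomial[OF f assms(3)] Ghost monomial_span.zero
      by (simp add: S_comm')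
  qed
qed

lemma monomial_span_gen_mult:
  "a \<in> monomial_span \<Longrightarrow> g \<in> lpa_gens E \<Longrightarrow> h (gen g) * a \<in> monomial_span"
proof (induction rule: monomial_span.induct)
  case (step a u p v w q c)
  then show ?case
    using monomial_span_add[OF monomial_span_gen[of g u p v w q c] step.IH]
    by (simp add: distrib_left)
qed (simp add: monomial_span.zero)

lemma monomial_span_word:
  "w \<noteq> [] \<Longrightarrow> set w \<subseteq> lpa_gens E \<Longrightarrow> h (Poly_Mapping.single w c) \<in> monomial_span"
proof (induction w)
  case (Cons g w)
  show ?case
  proof (cases "w = []")
    case False
    then have "h (Poly_Mapping.single w c) \<in> monomial_span" using Cons by simp
    then show ?thesis
      using monomial_span_gen_mult[of "h (Poly_Mapping.single w c)" g] Cons.prems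
      by (simp add: single_Cons h_mult)
  next
    case True
    have s: "h (Poly_Mapping.single [g] c) = S c * h (gen g)"
      by (simp add: gen_def single_list_mult flip: h_mult)
    show ?thesis
    proof (cases g)
      case (Vert v)
      then have v: "awalk v [] v" using Cons.prems by (simp add: awalk_Nil_iff)
      then show ?thesis
        using monomial_span_monomial[OF v v, of c] True s Vert by (simp add: V_idem awalk_Nil_iff)
    next
      case (Edge e)
      then have e: "awalk (tail E e) [e] (head E e)" "awalk (head E e) [] (head E e)" "e \<in> arcs E"
        using Cons.prems arc_implies_awalk by (auto simp: awalk_Nil_iff)
      then show ?thesis
        using monomial_span_monomial[OF e(1,2), of c] True s Edge by (simp add: Ed_V)
    next
      case (Ghost e)
      then have e: "awalk (tail E e) [e] (head E e)" "awalk (head E e) [] (head E e)" "e \<in> arcs E"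
        using Cons.prems arc_implies_awalk by (auto simp: awalk_Nil_iff)
      then show ?thesis
        using monomial_span_monomial[OF e(2,1), of c] True s Ghost by (simp add: V_Gh)
    qed
  qed
qed simp

lemma monomial_span_free: "p \<in> free_carrier E \<Longrightarrow> h p \<in> monomial_span"
proof -
  assume p: "p \<in> free_carrier E"
  have "h (\<Sum>w\<in>A. Poly_Mapping.single w (Poly_Mapping.lookup p w)) \<in> monomial_span"
    if "A \<subseteq> Poly_Mapping.keys p" for A
    using finite_subset[OF that finite_keys] that
  proof (induction A)
    case (insert w A)
    then show ?case
      using p by (auto simp: h_add free_carrier_iff intro!: monomial_span_add monomial_span_word)
  qed (simp add: h_0 monomial_span.zero)
  from this[OF order_refl] show ?thesis by (simp flip: poly_mapping_sum_single)
qed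

lemma ghost_span_mono: "a \<in> ghost_span m u w \<Longrightarrow> m \<le> n \<Longrightarrow> a \<in> ghost_span n u w"
  by (induction rule: ghost_span.induct) (auto intro: ghost_span.intros)

lemma monomial_span_localize:
  assumes "a \<in> monomial_span" "u \<in> verts E" "w \<in> verts E"
  shows "\<exists>n. V u * a * V w \<in> ghost_span n u w"
  using assms(1)
proof induction
  case zero
  show ?case by (simp add: ghost_span.zero)
next
  case (step a x p v y q c)
  then obtain n where n: "V u * a * V w \<in> ghost_span n u w" by blast
  have eq: "V u * (a + S c * (P x p * G y q)) * V w = V u * a * V w + S c * ((V u * P x p) * (G y q * V w))"
    by (simp add: distrib_left distrib_right S_comm' mult.assoc)
  show ?case
  proof (cases "x = u \<and> y = w")
    case True
    then have "V u * P x p = P u p" "G y q * V w = G w q"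
      using V_P[OF step(2)] G_V[OF step(3)] by auto
    moreover have "V u * a * V w + S c * (P u p * G w q) \<in> ghost_span (max n (length q)) u w"
      using ghost_span_mono[OF n] step True by (intro ghost_span.step) auto
    ultimately show ?thesis unfolding eq by auto
  next
    case False
    then have "V u * P x p = 0 \<or> G y q * V w = 0"
      using V_neq_P[OF step(2) assms(2)] G_neq_V[OF step(3) assms(3)] by auto
    then show ?thesis unfolding eq using n by auto
  qed
qed

text \<open>The equations are demanded for every finite \<open>W\<close> above \<open>U\<close>, so
  that the induction step can merge the sets belonging to two summands.\<close>

lemma monomial_span_local_unit:
  assumes "a \<in> monomial_span"
  shows "\<exists>U. finite U \<and> U \<subseteq> verts E \<and> (\<forall>W. finite W \<and> U \<subseteq> W \<and> W \<subseteq> verts E \<longrightarrow>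
    (\<Sum>v\<in>W. V v) * a = a \<and> a * (\<Sum>v\<in>W. V v) = a)"
  using assms
proof induction
  case zero
  show ?case by (rule exI[of _ "{}"]) simp
next
  case (step a x p v y q c)
  from step.IH obtain U where U: "finite U \<and> U \<subseteq> verts E \<and>
    (\<forall>W. finite W \<and> U \<subseteq> W \<and> W \<subseteq> verts E \<longrightarrow>
      (\<Sum>v\<in>W. V v) * a = a \<and> a * (\<Sum>v\<in>W. V v) = a)" by (rule exE)
  have x: "x \<in> verts E" "y \<in> verts E" using step by auto
  have P: "(\<Sum>v\<in>W. V v) * P x p = P x p" if "finite W" "x \<in> W" "W \<subseteq> verts E" for W
  proof -
    have "(\<Sum>v\<in>W. V v) * P x p = (\<Sum>v\<in>W. if v = x then P x p else 0)"
      unfolding sum_distrib_right using that V_P[OF step(2)] V_neq_P[OF step(2)]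
      by (intro sum.cong) auto
    then show ?thesis using that by simp
  qed
  have G: "G y q * (\<Sum>v\<in>W. V v) = G y q" if "finite W" "y \<in> W" "W \<subseteq> verts E" for W
  proof -
    have "G y q * (\<Sum>v\<in>W. V v) = (\<Sum>v\<in>W. if v = y then G y q else 0)"
      unfolding sum_distrib_left using that G_V[OF step(3)] G_neq_V[OF step(3)]
      by (intro sum.cong) auto
    then show ?thesis using that by simp
  qed
  show ?case
  proof (rule exI[of _ "insert x (insert y U)"], intro conjI allI impI)
    fix W assume W: "finite W \<and> insert x (insert y U) \<subseteq> W \<and> W \<subseteq> verts E"
    then have aW: "(\<Sum>v\<in>W. V v) * a = a" "a * (\<Sum>v\<in>W. V v) = a" using U[THEN conjunct2, THEN conjunct2, rule_format, of W] by auto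
    have hW: "(\<Sum>v\<in>W. V v) = h (\<Sum>v\<in>W. gen (Vert v))" by (simp add: h_sum)
    have "(\<Sum>v\<in>W. V v) * (P x p * G y q) = P x p * G y q"
      using P[of W] W by (simp flip: mult.assoc)
    then show "(\<Sum>v\<in>W. V v) * (a + S c * (P x p * G y q)) = a + S c * (P x p * G y q)"
      using aW(1) unfolding hW by (simp add: distrib_left S_comm')
    show "(a + S c * (P x p * G y q)) * (\<Sum>v\<in>W. V v) = a + S c * (P x p * G y q)"
      using aW(2) G[of W] W by (simp add: distrib_right mult.assoc)
  qed (use U x in auto)
qed

text \<open>Finite sums of vertices act as units on \<open>h p\<close> from both sides, so some
  corner between two vertices is nonzero. In that corner the ghost parts have bounded
  length.\<close>

theorem reduction:
  assumes "p \<in> free_carrier E" "h p \<noteq> 0"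
  shows "reducible (h p)"
proof -
  have p: "h p \<in> monomial_span" by (rule monomial_span_free[OF assms(1)])
  from monomial_span_local_unit[OF p] obtain U where U: "finite U \<and> U \<subseteq> verts E \<and>
    (\<forall>W. finite W \<and> U \<subseteq> W \<and> W \<subseteq> verts E \<longrightarrow>
      (\<Sum>v\<in>W. V v) * h p = h p \<and> h p * (\<Sum>v\<in>W. V v) = h p)" by (rule exE)
  have "h p = (\<Sum>v\<in>U. V v) * h p * (\<Sum>v\<in>U. V v)"
    using U[THEN conjunct2, THEN conjunct2, rule_format, of U] U by simp
  also have "\<dots> = (\<Sum>u\<in>U. \<Sum>w\<in>U. V u * h p * V w)"
    unfolding sum_distrib_right by (simp only: sum_distrib_left)
  finally obtain u w where uw: "u \<in> U" "w \<in> U" "V u * h p * V w \<noteq> 0"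
    using assms(2) by (metis (no_types, lifting) sum.neutral)
  have verts: "u \<in> verts E" "w \<in> verts E" using uw U by auto
  obtain n where "V u * h p * V w \<in> ghost_span n u w"
    using monomial_span_localize[OF p verts] by blast
  then have "reducible (h (gen (Vert u) * p * gen (Vert w)))"
    using uw(3) verts(2) by (intro ghost_span_reducible[of _ n u w]) (auto simp: h_mult)
  then show ?thesis
    using reducible_mult[of "gen (Vert u)" "h p" "gen (Vert w)"] by (simp add: h_mult)
qed

end

section \<open>Hereditary sets and Condition (K)\<close>

context wf_digraph
begin

lemma path_ge_refl: "v \<in> verts G \<Longrightarrow> path_ge G v v"
  by (auto simp: path_ge_def awalk_Nil_iff intro!: exI[of _ "[]"])

lemma path_ge_trans: "path_ge G u v \<Longrightarrow> path_ge G v w \<Longrightarrow> path_ge G u w"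
  unfolding path_ge_def using awalk_appendI by blast

lemma tree_subset: "path_ge G u v \<Longrightarrow> tree G v \<subseteq> tree G u"
  using path_ge_trans by (auto simp: tree_def)

lemma cas_restriction: "pre_digraph.cas (restriction G H) u p v = cas u p v"
  by (induction p arbitrary: u) (simp_all add: pre_digraph.cas.simps restriction_def)

lemma awalk_restriction_tree:
  assumes "u \<in> tree G v"
  shows "pre_digraph.awalk (restriction G (tree G v)) u p w \<longleftrightarrow> awalk u p w"
  unfolding pre_digraph.awalk_def cas_restriction
proof -
  have "set p \<subseteq> {e \<in> arcs G. tail G e \<in> tree G v}" if "awalk u p w"
    using that assms
  proof (induction p arbitrary: u)
    case (Cons e p)
    then have e: "e \<in> arcs G" "u = tail G e" "awalk (head G e) p w" by (auto simp: awalk_Cons_iff)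
    have "path_ge G v (head G e)"
      using Cons.prems(2) e arc_implies_awalk[of e] path_ge_trans[of v u "head G e"]
      by (auto simp: tree_def path_ge_def)
    then have "head G e \<in> tree G v" using e by (simp add: tree_def)
    then show ?case using Cons.IH[OF e(3)] Cons.prems(2) e by auto
  qed simp
  then show "(u \<in> verts (restriction G (tree G v)) \<and> set p \<subseteq> arcs (restriction G (tree G v)) \<and> cas u p w) =
      (u \<in> verts G \<and> set p \<subseteq> arcs G \<and> cas u p w)"
    using assms by (auto simp: restriction_def tree_def awalk_def)
qed

lemma closed_simple_path_restriction_tree:
  assumes "u \<in> tree G v"
  shows "closed_simple_path (restriction G (tree G v)) u p \<longleftrightarrow> closed_simple_path G u p"
  unfolding closed_simple_path_def awalk_restriction_tree[OF assms] by (simp add: restriction_def)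

lemma awalk_verts_restriction:
  "pre_digraph.awalk_verts (restriction G H) u p = awalk_verts u p"
  by (induction p arbitrary: u) (simp_all add: pre_digraph.awalk_verts.simps restriction_def)

lemma closed_path_rotate:
  assumes "awalk w p w" "p \<noteq> []" "u \<in> set (awalk_verts w p)"
  shows "\<exists>c. closed_simple_path G u c"
proof -
  obtain q r where qr: "p = q @ r" "awalk w q u" "awalk u r w"
    using awalk_decomp[OF assms(1,3)] by blast
  then have "awalk u (r @ q) u" "r @ q \<noteq> []" using assms(2) awalk_appendI[OF qr(3,2)] by auto
  then show ?thesis using closed_path_starts_simple by blast
qed

text \<open>By rotation, every vertex on a closed simple path is the base of one, so only base
  vertices have to be tested. Walks that start in \<open>tree G v\<close> stay there, so the
  restriction graph can be replaced by the graph itself.\<close>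

lemma P_K_iff:
  "v \<in> P_K G \<longleftrightarrow> v \<in> verts G \<and>
    (\<forall>u\<in>tree G v. \<forall>c. closed_simple_path G u c \<longrightarrow> (\<exists>d. closed_simple_path G u d \<and> d \<noteq> c))"
  (is "_ \<longleftrightarrow> _ \<and> ?K")
proof -
  let ?T = "tree G v"
  have "condition_K (restriction G ?T) \<longleftrightarrow> ?K"
  proof
    assume K: "condition_K (restriction G ?T)"
    show ?K
    proof (intro ballI allI impI)
      fix u c assume u: "u \<in> ?T" and c: "closed_simple_path G u c"
      have "closed_simple_path (restriction G ?T) u c"
        using c by (simp add: closed_simple_path_restriction_tree[OF u])
      moreover have "u \<in> set (pre_digraph.awalk_verts (restriction G ?T) u c)"
        unfolding awalk_verts_restriction using c by (auto simp: closed_simple_path_def intro: hd_in_awalk_verts)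
      ultimately obtain p q where "p \<noteq> q" "closed_simple_path (restriction G ?T) u p"
          "closed_simple_path (restriction G ?T) u q"
        using K u unfolding condition_K_def by (fastforce simp: restriction_def)
      then show "\<exists>d. closed_simple_path G u d \<and> d \<noteq> c"
        unfolding closed_simple_path_restriction_tree[OF u] by metis
    qed
  next
    assume K: ?K
    show "condition_K (restriction G ?T)"
      unfolding condition_K_def
    proof (intro ballI impI)
      fix u assume "u \<in> verts (restriction G ?T)"
      then have u: "u \<in> ?T" by (simp add: restriction_def)
      assume "\<exists>w p. closed_simple_path (restriction G ?T) w p \<and>
        u \<in> set (pre_digraph.awalk_verts (restriction G ?T) w p)"
      then obtain w p where wp: "closed_simple_path (restriction G ?T) w p" "u \<in> set (awalk_verts w p)"
        unfolding awalk_verts_restriction by blast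
      then have w: "w \<in> ?T" by (auto simp: closed_simple_path_def pre_digraph.awalk_def restriction_def)
      have "closed_simple_path G w p" using wp(1) by (simp add: closed_simple_path_restriction_tree[OF w])
      then obtain c where c: "closed_simple_path G u c"
        using closed_path_rotate wp(2) unfolding closed_simple_path_def by blast
      then show "\<exists>p q. p \<noteq> q \<and> closed_simple_path (restriction G ?T) u p \<and> closed_simple_path (restriction G ?T) u q"
        unfolding closed_simple_path_restriction_tree[OF u] using K u by blast
    qed
  qed
  then show ?thesis by (auto simp: P_K_def)
qed

lemma P_K_hereditary: "v \<in> P_K G \<Longrightarrow> awalk v p w \<Longrightarrow> w \<in> P_K G"
  unfolding P_K_iff using tree_subset[of v w] by (auto simp: path_ge_def)

end

section \<open>The generators of the exchange ideal as words\<close>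

definition vertex_cut :: "('v,'e) pre_digraph \<Rightarrow> 'v set \<Rightarrow> 'v \<Rightarrow> ('k::field,'v,'e) lpa_word_alg" where
  "vertex_cut E H v = gen (Vert v) - (\<Sum>e \<in> arcs_leaving_into_compl E H v. gen (Edge e) * gen (Ghost e))"

definition exchange_gens :: "('v,'e) pre_digraph \<Rightarrow> ('k::field,'v,'e) lpa_word_alg set" where
  "exchange_gens E = (\<lambda>v. gen (Vert v)) ` P_K E \<union>
     vertex_cut E (P_K E) ` breaking_vertices E (P_K E)"

lemma P_ex_eq: "P_ex E = lpa_class E ` exchange_gens E"
  by (auto simp: P_ex_def exchange_gens_def lpa_vert_def lpa_breaking_def[abs_def] vertex_cut_def
      image_Un image_image)

lemma exchange_gens_free:
  assumes "wf_digraph E"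
  shows "exchange_gens E \<subseteq> (free_carrier E :: ('k::field,'v,'e) lpa_word_alg set)"
  by (auto simp: exchange_gens_def vertex_cut_def P_K_def breaking_vertices_def gen_in_free
      arcs_leaving_into_compl_def intro!: free_carrier_diff free_carrier_sum free_carrier_mult)

text \<open>The words that \<open>retract\<close> drops contain a foreign generator. This brings
  elements of an ideal of the word algebra back into the algebra of \<open>E\<close>.\<close>

lemma retract_cong:
  fixes p :: "('k::field,'v,'e) lpa_word_alg"
  shows "p - retract E p \<in> rel_ideal E"
proof -
  note ts = two_sided_rel_ideal[of E]
  have word: "Poly_Mapping.single w c \<in> rel_ideal E" if w: "\<not> set w \<subseteq> lpa_gens E" for w and c :: 'k
  proof -
    obtain g u u' where g: "g \<notin> lpa_gens E" "w = u @ g # u'"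
      using w by (auto simp: subset_iff in_set_conv_decomp)
    have "gen g \<in> (rel_ideal E :: ('k,'v,'e) lpa_word_alg set)"
      unfolding rel_ideal_def by (rule ideal_gen_incl) (use g in auto)
    then have "Poly_Mapping.single u 1 * gen g * Poly_Mapping.single u' c \<in> rel_ideal E"
      by (intro two_sided_lmult[OF ts] two_sided_rmult[OF ts])
    then show ?thesis by (simp add: gen_def single_list_mult g(2))
  qed
  have "p - retract E p = (\<Sum>w\<in>Poly_Mapping.keys p. Poly_Mapping.single w (Poly_Mapping.lookup p w)
     - (if set w \<subseteq> lpa_gens E then Poly_Mapping.single w (Poly_Mapping.lookup p w) else 0))"
    unfolding sum_subtractf retract_eq poly_mapping_sum_single[of p, symmetric] ..
  also have "\<dots> \<in> rel_ideal E"
    using word two_sided_0[OF ts] by (intro two_sided_sum[OF ts]) auto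
  finally show ?thesis .
qed

section \<open>The exchange ideal is fully idempotent\<close>

definition exchange_ideal :: "('v,'e) pre_digraph \<Rightarrow> ('k::field,'v,'e) lpa_word_alg set" where
  "exchange_ideal E = ideal_gen (rel_ideal E \<union> exchange_gens E)"

lemma two_sided_exchange_ideal: "two_sided (exchange_ideal E)"
  unfolding exchange_ideal_def by (rule two_sided_ideal_gen)

lemma rel_ideal_exchange_ideal: "rel_ideal E \<subseteq> exchange_ideal E"
  unfolding exchange_ideal_def using ideal_gen_superset by blast

context lpa_hom
begin

lemma h_vertex_cut: "h (vertex_cut E H v) = V v - (\<Sum>e \<in> arcs_leaving_into_compl E H v. Ed e * Gh e)"
  by (simp add: vertex_cut_def h_diff h_sum h_mult)

lemma vertex_cut_V: "v \<in> verts E \<Longrightarrow> h (vertex_cut E H v) * V v = h (vertex_cut E H v)"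
  and V_vertex_cut: "v \<in> verts E \<Longrightarrow> V v * h (vertex_cut E H v) = h (vertex_cut E H v)"
proof -
  assume v: "v \<in> verts E"
  have "Ed e * Gh e * V v = Ed e * Gh e \<and> V v * (Ed e * Gh e) = Ed e * Gh e"
    if "e \<in> arcs_leaving_into_compl E H v" for e
  proof -
    have "e \<in> arcs E" "tail E e = v" using that by (auto simp: arcs_leaving_into_compl_def)
    then show ?thesis using Gh_V[of e] V_Ed[of e] by (simp add: mult.assoc) (simp flip: mult.assoc)
  qed
  then show "h (vertex_cut E H v) * V v = h (vertex_cut E H v)"
    "V v * h (vertex_cut E H v) = h (vertex_cut E H v)"
    by (simp_all add: h_vertex_cut left_diff_distrib right_diff_distrib sum_distrib_left
        sum_distrib_right V_idem[OF v])
qed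

lemma vertex_cut_Ed:
  assumes "v \<in> breaking_vertices E H" "e \<in> arcs_leaving_into_compl E H v"
  shows vertex_cut_Ed_0: "h (vertex_cut E H v) * Ed e = 0"
    and Gh_vertex_cut_0: "Gh e * h (vertex_cut E H v) = 0"
proof -
  let ?A = "arcs_leaving_into_compl E H v"
  have fin: "finite ?A" using assms(1) by (simp add: breaking_vertices_def)
  have e: "e \<in> arcs E" "tail E e = v" using assms(2) by (auto simp: arcs_leaving_into_compl_def)
  have A: "f \<in> arcs E" if "f \<in> ?A" for f using that by (auto simp: arcs_leaving_into_compl_def)
  have "(\<Sum>f\<in>?A. Ed f * Gh f * Ed e) = (\<Sum>f\<in>?A. if f = e then Ed e else 0)"
    using A e by (intro sum.cong) (auto simp: mult.assoc Gh_Ed Ed_V)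
  then show "h (vertex_cut E H v) * Ed e = 0"
    using fin assms(2) e V_Ed[of e] by (simp add: h_vertex_cut left_diff_distrib sum_distrib_right)
  have "(\<Sum>f\<in>?A. Gh e * (Ed f * Gh f)) = (\<Sum>f\<in>?A. if f = e then Gh e else 0)"
    using A e by (intro sum.cong) (auto simp: Gh_Ed V_Gh simp flip: mult.assoc)
  then show "Gh e * h (vertex_cut E H v) = 0"
    using fin assms(2) e Gh_V[of e] by (simp add: h_vertex_cut right_diff_distrib sum_distrib_left)
qed

section \<open>The corner at a vertex \<open>v\<close> with a closed simple path \<open>c\<close>
  such that \<open>c c^* = v\<close>\<close>

context
  fixes v c
  assumes c: "closed_simple_path E v c" and unitary: "V v = P v c * G v c"
begin

lemma cycle_awalk: "awalk v c v" "c \<noteq> []" "v \<in> verts E"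
  using c by (auto simp: closed_simple_path_def)

lemma cycle_power: "awalk v (concat (replicate k c)) v"
proof (induction k)
  case (Suc k)
  show ?case using awalk_appendI[OF cycle_awalk(1) Suc] by simp
qed (simp add: awalk_Nil_iff cycle_awalk)

lemma cycle_power_unitary: "V v = P v (concat (replicate k c)) * G v (concat (replicate k c))"
proof (induction k)
  case (Suc k)
  let ?d = "concat (replicate k c)"
  have "P v (c @ ?d) * G v (c @ ?d) = P v c * (P v ?d * G v ?d) * G v c"
    by (simp add: P_append[OF cycle_awalk(1) cycle_power] G_append[OF cycle_awalk(1) cycle_power] mult.assoc)
  also have "\<dots> = V v"
    unfolding Suc.IH[symmetric] by (simp add: P_V[OF cycle_awalk(1)] flip: unitary)
  finally show ?case by simp
qed (simp add: V_idem cycle_awalk)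

text \<open>Since \<open>v = d d^*\<close> for every power \<open>d\<close> of \<open>c\<close>, a
  path \<open>p\<close> incomparable with \<open>d\<close> has \<open>p^* = p^* d d^* = 0\<close>,
  and then \<open>p = p p^* p = 0\<close>. A nonzero \<open>p\<close> is therefore an initial piece
  of some \<open>d = p q\<close>, which gives \<open>w = q q^*\<close>.\<close>

lemma nonzero_path_on_cycle:
  assumes p: "awalk v p w" "P v p \<noteq> 0"
  shows "\<exists>q. q \<noteq> [] \<and> awalk w q v \<and> V w = P w q * G w q"
proof -
  \<comment> \<open>This exponent makes \<open>?d\<close> strictly longer than \<open>p\<close>, so
    that \<open>q\<close> is nonempty.\<close>
  let ?d = "concat (replicate (Suc (length p)) c)"
  have "length ?d = Suc (length p) * length c" by (simp add: length_concat sum_list_replicate)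
  then have len: "length p < length ?d" using cycle_awalk(2) by (cases c) auto
  have "prefix p ?d"
  proof (rule ccontr)
    assume "\<not> prefix p ?d"
    moreover have "\<not> prefix ?d p" using len prefix_length_le by fastforce
    ultimately have "G v p * P v ?d = 0" using G_P_parallel[OF p(1) cycle_power] by blast
    then have "G v p * (P v ?d * G v ?d) = 0" by (simp flip: mult.assoc)
    then have "G v p = 0" using G_V[OF p(1)] unfolding cycle_power_unitary[symmetric] by simp
    then have "P v p * (G v p * P v p) = 0" by simp
    then show False using p(2) by (simp add: G_P[OF p(1)] P_V[OF p(1)])
  qed
  then obtain q where q: "?d = p @ q" by (rule prefixE)
  then have ne: "q \<noteq> []" using len by auto
  have wq: "awalk w q v"
    using cycle_power[of "Suc (length p)"] p(1) unfolding q awalk_append_iff by auto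
  have "V w = G v p * (V v * P v p)"
    by (simp add: V_P[OF p(1)] G_P[OF p(1)])
  also have "\<dots> = (G v p * P v (p @ q)) * (G v (p @ q) * P v p)"
    unfolding cycle_power_unitary[of "Suc (length p)"] q by (simp only: mult.assoc)
  also have "\<dots> = P w q * G w q"
    by (simp add: G_P_append[OF p(1) wq] G_append_P[OF p(1) wq])
  finally show ?thesis using ne wq by blast
qed

text \<open>Otherwise \<open>d^* = d^* c c^* = 0\<close>, and then
  \<open>v = d^* d = 0\<close>.\<close>

lemma cycle_unique:
  assumes "V v \<noteq> 0" "closed_simple_path E v d"
  shows "d = c"
proof (rule ccontr)
  assume "d \<noteq> c"
  have dw: "awalk v d v" using assms(2) by (simp add: closed_simple_path_def)
  have "G v d * (P v c * G v c) = 0"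
    using G_P_parallel[OF dw cycle_awalk(1) closed_simple_path_parallel[OF assms(2) c \<open>d \<noteq> c\<close>]]
    by (simp flip: mult.assoc)
  then have "G v d = 0" using G_V[OF dw] by (simp flip: unitary)
  then show False using assms(1) G_P[OF dw] by simp
qed

lemma cycle_not_P_K: "V v \<noteq> 0 \<Longrightarrow> v \<notin> P_K E"
  using c path_ge_refl cycle_awalk(3) cycle_unique unfolding P_K_iff tree_def by blast

text \<open>A nonzero path from \<open>v\<close> can be continued back to \<open>v\<close>, so by
  heredity its end cannot lie in \<open>P_K E\<close>.\<close>

lemma path_into_P_K_zero:
  assumes "V v \<noteq> 0" "awalk v p w" "w \<in> P_K E"
  shows "P v p = 0"
  using nonzero_path_on_cycle[OF assms(2)] P_K_hereditary[OF assms(3)] cycle_not_P_K[OF assms(1)]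
  by blast

lemma ghost_span_annihilate:
  assumes "a \<in> ghost_span n v w" "\<And>p q x. awalk v p x \<Longrightarrow> awalk w q x \<Longrightarrow> P v p * (G w q * z) = 0"
  shows "a * z = 0"
  using assms(1)
proof induction
  case (step a p x q c)
  then show ?case using assms(2) by (simp add: distrib_right mult.assoc)
qed simp

lemma cycle_V_V:
  assumes "V v \<noteq> 0" "w \<in> P_K E" "awalk v p x" "awalk w q x"
  shows "P v p * (G w q * V w) = 0"
  using path_into_P_K_zero[OF assms(1,3)] P_K_hereditary[OF assms(2,4)] by simp

text \<open>If \<open>p\<close> is nonzero, its end \<open>x\<close> has a path back to
  \<open>v\<close>, and \<open>v\<close> is outside \<open>P_K E\<close>. So the first edge from
  \<open>w\<close> on the way to \<open>v\<close> stays outside \<open>P_K E\<close> and is one of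
  the subtracted edges, which the cut kills. It is the first edge of \<open>q\<close> or, for
  trivial \<open>q\<close>, of a path \<open>r\<close> with \<open>w = r r^*\<close>.\<close>

lemma cycle_breaking:
  assumes "V v \<noteq> 0" "w \<in> breaking_vertices E (P_K E)" "awalk v p x" "awalk w q x"
  shows "P v p * (G w q * h (vertex_cut E (P_K E) w)) = 0"
proof (cases "P v p = 0")
  case False
  let ?A = "arcs_leaving_into_compl E (P_K E) w" and ?z = "h (vertex_cut E (P_K E) w)"
  obtain r where r: "r \<noteq> []" "awalk x r v" "V x = P x r * G x r"
    using nonzero_path_on_cycle[OF assms(3) False] by blast
  have stay: "e \<in> ?A" if e: "e \<in> out_arcs E w" "awalk (head E e) s v" for e s
    using e P_K_hereditary[OF _ e(2)] cycle_not_P_K[OF assms(1)]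
    by (auto simp: arcs_leaving_into_compl_def)
  have w: "w \<in> verts E" using assms(2) by (simp add: breaking_vertices_def)
  have "G w q * ?z = 0"
  proof (cases q)
    case (Cons f q')
    then have f: "f \<in> out_arcs E w" "awalk (head E f) q' x" using assms(4) by (auto simp: awalk_Cons_iff)
    then have "f \<in> ?A" using stay[OF f(1)] awalk_appendI[OF f(2) r(2)] by blast
    then show ?thesis using Gh_vertex_cut_0[OF assms(2)] Cons by (simp add: mult.assoc)
  next
    case Nil
    then have x: "x = w" using assms(4) by (simp add: awalk_Nil_iff)
    obtain f r' where fr: "r = f # r'" using r(1) by (cases r) auto
    then have f: "f \<in> out_arcs E w" "awalk (head E f) r' v" using r(2) x by (auto simp: awalk_Cons_iff)
    then have "?z * Ed f = 0" using stay vertex_cut_Ed_0[OF assms(2)] by blast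
    then have "?z * (P x r * G x r) = 0" by (simp add: fr flip: mult.assoc)
    then have "?z * V w = 0" unfolding r(3)[unfolded x] x .
    then have "?z = 0" unfolding vertex_cut_V[OF w] .
    then show ?thesis by simp
  qed
  then show ?thesis by simp
qed simp

lemma corner_annihilate:
  assumes "w \<in> verts E" "\<And>p q x. awalk v p x \<Longrightarrow> awalk w q x \<Longrightarrow> P v p * (G w q * z) = 0"
  shows "V v * h r * V w * z = 0"
proof -
  have "h (r * gen (Vert w)) = h (retract E (r * gen (Vert w)))"
    using h_rel[OF retract_cong[of "r * gen (Vert w)" E]] by (simp add: h_diff)
  moreover have "retract E (r * gen (Vert w)) \<in> free_carrier E"
    by (rule retract_in_free) (simp add: lookup_Nil_mult gen_def lookup_single)
  ultimately have "h (r * gen (Vert w)) \<in> monomial_span"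
    using monomial_span_free by simp
  then obtain n where "V v * h (r * gen (Vert w)) * V w \<in> ghost_span n v w"
    using monomial_span_localize cycle_awalk(3) assms(1) by blast
  from ghost_span_annihilate[OF this assms(2)] show ?thesis
    by (simp add: h_mult mult.assoc V_idem[OF assms(1)] flip: mult.assoc[of "V w" "V w"])
qed

text \<open>Each element of \<open>exchange_gens E\<close> is already killed from the left by
  \<open>V v * h r\<close>, for every \<open>r\<close>. Quantifying over both \<open>r\<close> and
  \<open>s\<close> turns the condition in \<open>?D\<close> into a two-sided ideal.\<close>

lemma exchange_ideal_corner:
  assumes "V v \<noteq> 0" "z \<in> exchange_ideal E"
  shows "V v * h z * V v = 0"
proof -
  let ?D = "{z. \<forall>r s. V v * h (r * z * s) * V v = 0}"
  have "two_sided ?D"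
  proof (rule two_sidedI)
    show "x + y \<in> ?D" if "x \<in> ?D" "y \<in> ?D" for x y
      using that by (simp add: distrib_left distrib_right h_add)
    show "t * x \<in> ?D" if "x \<in> ?D" for t x
    proof (intro CollectI allI)
      fix r s
      show "V v * h (r * (t * x) * s) * V v = 0"
        using that[THEN CollectD, rule_format, of "r * t" s] by (simp add: mult.assoc)
    qed
    show "x * t \<in> ?D" if "x \<in> ?D" for t x
    proof (intro CollectI allI)
      fix r s
      show "V v * h (r * (x * t) * s) * V v = 0"
        using that[THEN CollectD, rule_format, of r "t * s"] by (simp add: mult.assoc)
    qed
  qed (auto simp: h_0 h_uminus)
  moreover have "rel_ideal E \<subseteq> ?D"
    by (auto simp: h_mult h_rel)
  moreover have "gen (Vert w) \<in> ?D" if "w \<in> P_K E" for w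
  proof (intro CollectI allI)
    fix r s
    have "w \<in> verts E" using that by (simp add: P_K_def)
    then have "V v * h r * V w * V w = 0"
      using cycle_V_V[OF assms(1) that] by (rule corner_annihilate)
    then have "V v * h r * V w = 0" by (simp add: mult.assoc V_idem[OF \<open>w \<in> verts E\<close>])
    then show "V v * h (r * gen (Vert w) * s) * V v = 0" by (simp add: h_mult flip: mult.assoc)
  qed
  moreover have "vertex_cut E (P_K E) w \<in> ?D" if "w \<in> breaking_vertices E (P_K E)" for w
  proof (intro CollectI allI)
    fix r s
    have w: "w \<in> verts E" using that by (simp add: breaking_vertices_def)
    then have "V v * h r * V w * h (vertex_cut E (P_K E) w) = 0"
      using cycle_breaking[OF assms(1) that] by (rule corner_annihilate)
    then have "V v * h r * h (vertex_cut E (P_K E) w) = 0"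
      using V_vertex_cut[OF w] by (simp add: mult.assoc)
    then show "V v * h (r * vertex_cut E (P_K E) w * s) * V v = 0"
      by (simp add: h_mult flip: mult.assoc)
  qed
  ultimately have "exchange_ideal E \<subseteq> ?D"
    unfolding exchange_ideal_def by (intro ideal_gen_minimal) (auto simp: exchange_gens_def)
  then have "V v * h (1 * z * 1) * V v = 0" using assms(2) by blast
  then show ?thesis by simp
qed

end

end

lemma lpa_hom_quotient:
  fixes I :: "('k::field,'v,'e) lpa_word_alg set"
  assumes "wf_digraph E" "two_sided I" "rel_ideal E \<subseteq> I"
  shows "\<exists>h :: ('k,'v,'e) lpa_word_alg \<Rightarrow> ('k,'v,'e) lpa_word_alg endo.
    lpa_hom E h \<and> (\<forall>p. h p = 0 \<longleftrightarrow> p \<in> I)"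
proof (rule quotient_endo[OF assms(2)])
  fix h :: "('k,'v,'e) lpa_word_alg \<Rightarrow> ('k,'v,'e) lpa_word_alg endo"
  assume h: "\<And>p q. h (p + q) = h p + h q" "\<And>p q. h (p * q) = h p * h q" "\<And>p. h p = 0 \<longleftrightarrow> p \<in> I"
  have "lpa_hom E h"
    by (intro lpa_hom.intro lpa_hom_axioms.intro assms(1) h(1,2)) (use assms(3) h(3) in auto)
  then show ?thesis using h(3) by blast
qed

lemma exchange_ideal_fully_idempotent:
  fixes p :: "('k::field,'v,'e) lpa_word_alg"
  assumes wf: "wf_digraph E" and p: "p \<in> exchange_ideal E"
  shows "fully_idempotent_word E p"
  unfolding fully_idempotent_word_def[OF wf]
proof (rule ballI, rule ccontr)
  fix q :: "('k,'v,'e) lpa_word_alg"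
  assume q: "q \<in> ideal_gen (rel_ideal E \<union> {p}) \<inter> free_carrier E"
  let ?Q = "ideal_gen (rel_ideal E \<union> {q})"
  let ?I = "ideal_gen (rel_ideal E \<union> {x * y | x y. x \<in> ?Q \<inter> free_carrier E \<and> y \<in> ?Q \<inter> free_carrier E})"
  assume qI: "q \<notin> ?I"
  have "ideal_gen (rel_ideal E \<union> {p}) \<subseteq> exchange_ideal E"
    using p rel_ideal_exchange_ideal by (intro ideal_gen_minimal two_sided_exchange_ideal) auto
  then have qJ: "q \<in> exchange_ideal E" and qf: "q \<in> free_carrier E" using q by auto
  have relI: "rel_ideal E \<subseteq> ?I" and relQ: "rel_ideal E \<subseteq> ?Q" and qQ: "q \<in> ?Q"
    using ideal_gen_superset by blast+
  note Q = two_sided_ideal_gen[of "rel_ideal E \<union> {q}"]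
  have I: "two_sided ?I" by (rule two_sided_ideal_gen)
  obtain h :: "('k,'v,'e) lpa_word_alg \<Rightarrow> ('k,'v,'e) lpa_word_alg endo"
    where h: "lpa_hom E h" "\<forall>p. h p = 0 \<longleftrightarrow> p \<in> ?I"
    using lpa_hom_quotient[OF wf I relI] by blast
  interpret lpa_hom E h by (rule h(1))
  have "h q \<noteq> 0" using qI h(2) by blast
  with qf have "reducible (h q)" by (rule reduction)
  then consider "reduces_to_cut (h q)" | "reduces_to_cycle (h q)"
    unfolding reducible_def by blast
  then show False
  proof cases
    case 1
    then obtain x y v X where *: "path_antichain E v X" "h (path_cut E v X) \<noteq> 0" "h x * h q * h y = h (path_cut E v X)"
      unfolding reduces_to_cut_def by blast
    let ?g = "x * q * y"
    \<comment> \<open>The multipliers may involve foreign generators and constants. Modulo the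
      relations \<open>retract\<close> removes the former, and no constant term arises because
      \<open>q\<close> has none.\<close>
    let ?r = "retract E ?g"
    have hg: "h ?g = h (path_cut E v X)" using *(3) by (simp add: h_mult)
    have gQ: "?g \<in> ?Q" using qQ by (intro two_sided_rmult[OF Q] two_sided_lmult[OF Q])
    have "?g - ?r \<in> rel_ideal E" by (rule retract_cong)
    then have hr: "h ?r = h ?g" and "?g - ?r \<in> ?Q" using h_rel[of "?g - ?r"] relQ by (auto simp: h_diff)
    then have "?g - (?g - ?r) \<in> ?Q" using gQ two_sided_diff[OF Q] by blast
    moreover have "?r \<in> free_carrier E"
      using free_carrier_no_const[OF qf] by (intro retract_in_free) (simp add: lookup_Nil_mult)
    ultimately have "?r \<in> ?Q \<inter> free_carrier E" by simp
    then have "?r * ?r \<in> ?I" by (intro ideal_gen_incl) blast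
    then have "h (?r * ?r) = 0" using h(2) by blast
    then have "h (path_cut E v X) * h (path_cut E v X) = 0" by (simp only: h_mult[of ?r ?r] hr hg)
    then show False using cut_idem[OF *(1)] *(2) by simp
  next
    case 2
    then obtain x y v k D f c where *: "closed_paths v D" "closed_simple_path E v c" "V v = P v c * G v c"
      "h (cycle_poly v k D f) \<noteq> 0" "h x * h q * h y = h (cycle_poly v k D f)"
      unfolding reduces_to_cycle_def by blast
    have v: "v \<in> verts E" and D: "\<And>d. d \<in> D \<Longrightarrow> awalk v d v"
      using *(1) by (auto simp: closed_paths_def)
    have "V v * h (cycle_poly v k D f) = h (cycle_poly v k D f)"
      using V_P[OF D] by (auto simp: h_cycle_poly distrib_left sum_distrib_left S_comm' V_idem[OF v] intro!: sum.cong)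
    moreover have "h (cycle_poly v k D f) * V v = h (cycle_poly v k D f)"
      using P_V[OF D] by (auto simp: h_cycle_poly distrib_right sum_distrib_right mult.assoc V_idem[OF v] intro!: sum.cong)
    ultimately have nz: "V v * h (x * q * y) * V v \<noteq> 0"
      using *(4,5) by (simp add: h_mult)
    then have "V v \<noteq> 0" by auto
    moreover have "x * q * y \<in> exchange_ideal E"
      using qJ by (intro two_sided_lmult two_sided_rmult two_sided_exchange_ideal)
    ultimately show False using exchange_ideal_corner[OF *(2,3)] nz by blast
  qed
qed

section \<open>The representation on infinite paths ending in a cycle\<close>

abbreviation lmon :: "int \<Rightarrow> int \<Rightarrow>\<^sub>0 'k::field" where
  "lmon n \<equiv> Poly_Mapping.single n 1"

lemma lmon_mult: "lmon m * lmon n = lmon (m + n)"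
  by (simp add: mult_single)

lemma lmon_cancel: "lmon (- n) * (lmon n * a) = a" "lmon n * (lmon (- n) * a) = a"
  by (simp_all add: lmon_mult flip: mult.assoc)

text \<open>Setting the variable to 1, that is, summing the coefficients as \<open>aug\<close> does,
  sends \<open>1 - lmon n\<close> to 0.\<close>

lemma one_minus_lmon_not_unit:
  "\<not> (1 - lmon n) dvd (1 :: int \<Rightarrow>\<^sub>0 'k::field)"
proof
  define aug where "aug p = (\<Sum>i\<in>Poly_Mapping.keys p. Poly_Mapping.lookup p i)" for p :: "int \<Rightarrow>\<^sub>0 'k"
  have sup: "aug p = (\<Sum>i\<in>S. Poly_Mapping.lookup p i)" if "finite S" "Poly_Mapping.keys p \<subseteq> S" for p S
    unfolding aug_def using that by (intro sum.mono_neutral_left) (auto simp: in_keys_iff)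
  have add: "aug (p + q) = aug p + aug q" for p q
  proof -
    let ?S = "Poly_Mapping.keys p \<union> Poly_Mapping.keys q"
    have "aug (p + q) = (\<Sum>i\<in>?S. Poly_Mapping.lookup (p + q) i)"
      by (rule sup) (use keys_add[of p q] in auto)
    then show ?thesis by (simp add: sup[of ?S] lookup_add sum.distrib)
  qed
  have sum: "aug (sum f A) = (\<Sum>i\<in>A. aug (f i))" for f :: "int \<Rightarrow> _" and A
    by (induction A rule: infinite_finite_induct) (auto simp: aug_def[of 0] add)
  have single: "aug (Poly_Mapping.single i c) = c" for i c
    by (subst sup[of "{i}"]) auto
  have mult: "aug (lmon n * p) = aug p" for p
  proof -
    have "aug (lmon n * (\<Sum>i\<in>Poly_Mapping.keys p. Poly_Mapping.single i (Poly_Mapping.lookup p i))) =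
      aug (\<Sum>i\<in>Poly_Mapping.keys p. Poly_Mapping.single i (Poly_Mapping.lookup p i))"
      by (simp add: sum_distrib_left mult_single sum single)
    then show ?thesis by (simp flip: poly_mapping_sum_single)
  qed
  assume "(1 - lmon n) dvd (1 :: int \<Rightarrow>\<^sub>0 'k)"
  then obtain q :: "int \<Rightarrow>\<^sub>0 'k" where "1 = (1 - lmon n) * q" by (rule dvdE)
  then have "1 + lmon n * q = q" by (simp add: algebra_simps)
  then have "aug 1 + aug q = aug q" by (metis add mult)
  then show False using single[of 0 1] by simp
qed

lemma sum_fun_apply: "(\<Sum>i\<in>A. f i) x = (\<Sum>i\<in>A. f i x)"
  by (induction A rule: infinite_finite_induct) auto

text \<open>Module over the Laurent polynomials: functions on infinite paths, the edges acting by shifts.\<close>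

type_synonym ('k,'e) path_module = "(nat \<Rightarrow> 'e) \<Rightarrow> int \<Rightarrow>\<^sub>0 'k"

definition icons :: "'e \<Rightarrow> (nat \<Rightarrow> 'e) \<Rightarrow> nat \<Rightarrow> 'e" where
  "icons e \<xi> = case_nat e \<xi>"

definition idrop :: "nat \<Rightarrow> (nat \<Rightarrow> 'e) \<Rightarrow> nat \<Rightarrow> 'e" where
  "idrop k \<xi> = (\<lambda>n. \<xi> (n + k))"

lemma idrop_icons [simp]: "idrop (Suc 0) (icons e \<xi>) = \<xi>" "icons e \<xi> 0 = e" "icons e \<xi> (Suc n) = \<xi> n"
  by (simp_all add: idrop_def icons_def)

lemma icons_idrop: "icons (\<xi> 0) (idrop (Suc 0) \<xi>) = \<xi>"
  by (rule ext) (simp add: idrop_def icons_def split: nat.split)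

lemma idrop_idrop: "idrop k (idrop l \<xi>) = idrop (k + l) \<xi>"
  by (simp add: idrop_def add.assoc)

lemma idrop_apply: "idrop k \<xi> n = \<xi> (n + k)"
  by (simp add: idrop_def)

lemma idrop_0 [simp]: "idrop 0 \<xi> = \<xi>"
  by (simp add: idrop_def)

text \<open>A base vertex at which Condition (K) fails. Every vertex outside \<open>P_K E\<close>
  has such a vertex below it (\<open>not_P_K_cycle\<close>).\<close>

locale unique_cycle = wf_digraph E for E :: "('v,'e) pre_digraph" +
  fixes v :: 'v and c :: "'e list"
  assumes csp: "closed_simple_path E v c"
    and unique: "closed_simple_path E v d \<Longrightarrow> d = c"
begin

definition cyc :: "nat \<Rightarrow> 'e" where
  "cyc = (\<lambda>n. c ! (n mod length c))"

text \<open>Asking for a shift equal to \<open>cyc\<close> itself imposes no phase: a path that ends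
  in a rotated cycle reaches \<open>cyc\<close> after a few more shifts.\<close>

definition \<Omega> :: "(nat \<Rightarrow> 'e) set" where
  "\<Omega> = {\<xi>. (\<forall>n. \<xi> n \<in> arcs E \<and> head E (\<xi> n) = tail E (\<xi> (Suc n))) \<and> (\<exists>k. idrop k \<xi> = cyc)}"

lemma cw: "awalk v c v" "c \<noteq> []" "length c > 0"
  using csp by (auto simp: closed_simple_path_def)

lemma cas_nth:
  "cas u p w \<Longrightarrow> i < length p \<Longrightarrow>
    tail E (p ! i) = (if i = 0 then u else head E (p ! (i - 1))) \<and> (Suc i = length p \<longrightarrow> head E (p ! i) = w)"
proof (induction p arbitrary: u i)
  case (Cons e p)
  show ?case
  proof (cases i)
    case 0
    then show ?thesis using Cons.prems by (cases p) auto
  next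
    case (Suc j)
    have "tail E (p ! j) = (if j = 0 then head E e else head E (p ! (j - 1))) \<and>
        (Suc j = length p \<longrightarrow> head E (p ! j) = w)"
      using Cons.IH[of "head E e" j] Cons.prems Suc by simp
    then show ?thesis unfolding Suc nth_Cons_Suc by (cases j) simp_all
  qed
qed simp

lemma cyc_valid: "cyc n \<in> arcs E" "head E (cyc n) = tail E (cyc (Suc n))" "tail E (cyc 0) = v"
proof -
  let ?i = "n mod length c"
  have i: "?i < length c" using cw(3) by simp
  have cas: "cas v c v" "set c \<subseteq> arcs E" using cw(1) by auto
  show "cyc n \<in> arcs E" using cas(2) i by (auto simp: cyc_def)
  show "tail E (cyc 0) = v" using cas_nth[OF cas(1), of 0] cw(3) by (simp add: cyc_def)
  show "head E (cyc n) = tail E (cyc (Suc n))"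
  proof (cases "Suc ?i = length c")
    case True
    then show ?thesis using cas_nth[OF cas(1) i] cas_nth[OF cas(1), of 0] cw(3)
      by (simp add: cyc_def mod_Suc)
  next
    case False
    then have "Suc n mod length c = Suc ?i" "Suc ?i < length c" using i by (auto simp: mod_Suc)
    then show ?thesis using cas_nth[OF cas(1), of "Suc ?i"] by (simp add: cyc_def)
  qed
qed

lemma cyc_in: "cyc \<in> \<Omega>"
  unfolding \<Omega>_def using cyc_valid by (auto intro: exI[of _ 0])

lemma idrop_cyc: "idrop (length c) cyc = cyc"
  by (simp add: idrop_def cyc_def)

lemma \<Omega>D: "\<xi> \<in> \<Omega> \<Longrightarrow> \<xi> n \<in> arcs E" "\<xi> \<in> \<Omega> \<Longrightarrow> head E (\<xi> n) = tail E (\<xi> (Suc n))"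
  by (auto simp: \<Omega>_def)

lemma idrop_in: "\<xi> \<in> \<Omega> \<Longrightarrow> idrop m \<xi> \<in> \<Omega>"
proof -
  assume \<xi>: "\<xi> \<in> \<Omega>"
  then obtain k where k: "idrop k \<xi> = cyc" by (auto simp: \<Omega>_def)
  have *: "idrop (j * length c) cyc = cyc" for j
    by (simp add: idrop_def cyc_def)
  \<comment> \<open>Dropping \<open>m\<close> more periods leaves \<open>cyc\<close> unchanged and,
    as \<open>length c\<close> is at least 1, ensures that at least \<open>m\<close> letters are
    dropped in all.\<close>
  have "idrop (m * length c + k) \<xi> = cyc"
    using *[of m] by (simp add: k flip: idrop_idrop)
  moreover have le: "m \<le> m * length c + k"
    using mult_le_mono2[of 1 "length c" m] cw(3) by linarith
  ultimately have "idrop (m * length c + k - m) (idrop m \<xi>) = cyc"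
    unfolding idrop_idrop le_add_diff_inverse2[OF le] by simp
  then show ?thesis using \<xi> by (auto simp: \<Omega>_def idrop_def)
qed

lemma tail_idrop: "\<xi> \<in> \<Omega> \<Longrightarrow> tail E (idrop (Suc 0) \<xi> 0) = head E (\<xi> 0)"
  using \<Omega>D(2)[of \<xi> 0] by (simp add: idrop_def)

lemma icons_in: "\<xi> \<in> \<Omega> \<Longrightarrow> e \<in> arcs E \<Longrightarrow> head E e = tail E (\<xi> 0) \<Longrightarrow> icons e \<xi> \<in> \<Omega>"
proof -
  assume *: "\<xi> \<in> \<Omega>" "e \<in> arcs E" "head E e = tail E (\<xi> 0)"
  then obtain k where "idrop k \<xi> = cyc" by (auto simp: \<Omega>_def)
  then have "idrop (Suc k) (icons e \<xi>) = cyc"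
    using idrop_idrop[of k "Suc 0" "icons e \<xi>"] by simp
  moreover have "icons e \<xi> n \<in> arcs E \<and> head E (icons e \<xi> n) = tail E (icons e \<xi> (Suc n))" for n
    using * by (cases n) (auto simp: \<Omega>_def)
  ultimately show ?thesis unfolding \<Omega>_def by blast
qed

lemma awalk_of_\<Omega>: "\<xi> \<in> \<Omega> \<Longrightarrow> awalk (tail E (\<xi> 0)) (map \<xi> [0..<k]) (tail E (\<xi> k))"
proof (induction k)
  case (Suc k)
  have "awalk (tail E (\<xi> k)) [\<xi> k] (tail E (\<xi> (Suc k)))"
    using \<Omega>D[OF Suc.prems, of k] head_in_verts[of "\<xi> k"] by (simp add: awalk_simps)
  from awalk_appendI[OF Suc.IH[OF Suc.prems] this] show ?case by simp
qed (simp add: awalk_Nil_iff \<Omega>D(1) tail_in_verts)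

lemma \<Omega>_path_ge: "\<xi> \<in> \<Omega> \<Longrightarrow> path_ge E (tail E (\<xi> 0)) v"
proof -
  assume \<xi>: "\<xi> \<in> \<Omega>"
  then obtain k where "idrop k \<xi> = cyc" by (auto simp: \<Omega>_def)
  then have "\<xi> k = cyc 0" by (auto simp: idrop_def fun_eq_iff dest: spec[of _ 0])
  then show ?thesis using awalk_of_\<Omega>[OF \<xi>, of k] cyc_valid(3) by (auto simp: path_ge_def)
qed

text \<open>Since every closed path at \<open>v\<close> is a power of \<open>c\<close>, the periodic path is the only one from \<open>v\<close>.\<close>

lemma \<Omega>_from_v:
  assumes "\<xi> \<in> \<Omega>" "tail E (\<xi> 0) = v"
  shows "\<xi> = cyc"
proof -
  obtain k where "idrop k \<xi> = cyc" using assms(1) by (auto simp: \<Omega>_def)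
  then show ?thesis using assms
  proof (induction k arbitrary: \<xi> rule: less_induct)
    case (less k)
    show ?case
    proof (cases "k = 0")
      case False
      let ?p = "map \<xi> [0..<k]"
      have "\<xi> k = cyc 0" using less.prems(1) by (auto simp: idrop_def fun_eq_iff dest: spec[of _ 0])
      then have "awalk v ?p v"
        using awalk_of_\<Omega>[OF less.prems(2), of k] less.prems(3) cyc_valid(3) by simp
      moreover have "?p \<noteq> []" using False by simp
      ultimately obtain d q where d: "?p = d @ q" "closed_simple_path E v d"
        using closed_path_starts_simple by blast
      then have p: "?p = c @ q" using unique by simp
      then have len: "length c \<le> k" by (metis diff_zero le_add1 length_append length_map length_upt)
      have nth: "\<xi> i = c ! i" if i: "i < length c" for i
      proof -
        have "?p ! i = c ! i" using p i by (simp add: nth_append)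
        then show ?thesis using i len by simp
      qed
      let ?\<zeta> = "idrop (length c) \<xi>"
      have \<zeta>: "?\<zeta> \<in> \<Omega>" by (rule idrop_in[OF less.prems(2)])
      have "tail E (?\<zeta> 0) = head E (\<xi> (length c - 1))"
        using \<Omega>D(2)[OF less.prems(2), of "length c - 1"] cw(3) by (simp add: idrop_def)
      also have "\<dots> = v"
        using nth[of "length c - 1"] cas_nth[of v c v "length c - 1"] cw by auto
      finally have tl: "tail E (?\<zeta> 0) = v" .
      have "k - length c < k" using cw(3) False by (intro diff_less) auto
      moreover have "idrop (k - length c) ?\<zeta> = cyc" using less.prems(1) len by (simp add: idrop_idrop)
      ultimately have \<zeta>c: "?\<zeta> = cyc" using \<zeta> tl by (rule less.IH)
      show ?thesis
      proof
        fix n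
        show "\<xi> n = cyc n"
        proof (cases "n < length c")
          case True
          then show ?thesis using nth by (simp add: cyc_def)
        next
          case False
          then have "\<xi> n = ?\<zeta> (n - length c)" by (simp add: idrop_def)
          also have "\<dots> = cyc n" using False by (simp add: \<zeta>c cyc_def mod_if)
          finally show ?thesis .
        qed
      qed
    qed (use less.prems in simp)
  qed
qed

text \<open>On indicator functions an edge is prepended and a ghost edge removed; admitting all
  functions avoids conditions on supports. The weight \<open>lmon 1\<close> makes \<open>c\<close>
  act on the periodic path as \<open>lmon (int (length c))\<close>.\<close>

fun act :: "('v,'e) lpa_gen \<Rightarrow> ('k::field,'e) path_module \<Rightarrow> ('k,'e) path_module" where
  "act (Vert u) f \<xi> = (if \<xi> \<in> \<Omega> \<and> tail E (\<xi> 0) = u then f \<xi> else 0)"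
| "act (Edge e) f \<xi> = (if \<xi> \<in> \<Omega> \<and> \<xi> 0 = e then lmon 1 * f (idrop 1 \<xi>) else 0)"
| "act (Ghost e) f \<xi> = (if \<xi> \<in> \<Omega> \<and> e \<in> arcs E \<and> head E e = tail E (\<xi> 0)
     then lmon (-1) * f (icons e \<xi>) else 0)"

definition scal :: "(int \<Rightarrow>\<^sub>0 'k::field) \<Rightarrow> ('k,'e) path_module \<Rightarrow> ('k,'e) path_module" where
  "scal a f \<xi> = a * f \<xi>"

lemma act_scal: "act g (scal a f) = scal a (act g f)"
  by (rule ext, cases g) (auto simp: scal_def mult.left_commute)

lemma act_add: "act g (f + f') = act g f + act g f'"
  by (rule ext, cases g) (auto simp: distrib_left)

lemma scal_add: "scal a (f + f') = scal a f + scal a f'"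
  by (rule ext) (auto simp: scal_def distrib_left)

definition act_endo :: "('v,'e) lpa_gen \<Rightarrow> ('k::field,'e) path_module endo" where
  "act_endo g = Endo (act g)"

definition scal_endo :: "(int \<Rightarrow>\<^sub>0 'k::field) \<Rightarrow> ('k,'e) path_module endo" where
  "scal_endo a = Endo (scal a)"

lemma apply_act [simp]: "endo_apply (act_endo g) = act g"
  unfolding act_endo_def by (rule Endo_apply) (rule act_add)

lemma apply_scal [simp]: "endo_apply (scal_endo a) = scal a"
  unfolding scal_endo_def by (rule Endo_apply) (rule scal_add)

lemma scal_endo_1 [simp]: "scal_endo 1 = 1"
  by (rule endo_eqI) (simp add: scal_def fun_eq_iff)

sublocale rep: word_eval "\<lambda>a. scal_endo (Poly_Mapping.single 0 a) :: ('k::field,'e) path_module endo" act_endo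
proof
  show "scal_endo (Poly_Mapping.single 0 a) * act_endo x =
      (act_endo x * scal_endo (Poly_Mapping.single 0 a) :: ('k,'e) path_module endo)" for a x
    by (rule endo_eqI) (simp add: act_scal)
qed (auto intro!: endo_eqI ext simp: scal_def single_add distrib_right mult_single mult.assoc[symmetric])

abbreviation \<rho> :: "('k::field,'v,'e) lpa_word_alg \<Rightarrow> ('k,'e) path_module endo" where
  "\<rho> \<equiv> rep.ev"

lemma \<rho>_gen: "\<rho> (gen g) = act_endo g"
  by (simp add: gen_def rep.ev_single rep.sc_1)

text \<open>For \<open>CK2\<close>: an infinite path from \<open>u\<close> has exactly one first
  edge, and the summand of this edge alone returns the value of \<open>f\<close>.\<close>

lemma \<rho>_relations:
  assumes "r \<in> lpa_relations E"
  shows "\<rho> (r :: ('k::field,'v,'e) lpa_word_alg) = 0"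
proof -
  have diff: "\<rho> (p - q) = \<rho> p - \<rho> q" for p q :: "('k,'v,'e) lpa_word_alg"
    using rep.ev_add[of p "- q"] by (simp add: rep.ev_uminus)
  show ?thesis
    using assms
  proof cases
    case (CK2 u)
    have fin: "finite (out_arcs E u)" using CK2(2) by (auto simp: regular_def infinite_emitter_def)
    have "act (Vert u) f \<xi> = (\<Sum>e\<in>out_arcs E u. act (Edge e) (act (Ghost e) f) \<xi>)"
      for f :: "('k,'e) path_module" and \<xi>
    proof (cases "\<xi> \<in> \<Omega> \<and> tail E (\<xi> 0) = u")
      case True
      have "(\<Sum>e\<in>out_arcs E u. act (Edge e) (act (Ghost e) f) \<xi>) =
          (\<Sum>e\<in>out_arcs E u. if \<xi> 0 = e then f \<xi> else 0)"
        using True idrop_in[of \<xi> 1] \<Omega>D[of \<xi> 0] icons_idrop[of \<xi>]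
        by (intro sum.cong) (auto simp: idrop_apply[of _ _ 0] lmon_mult simp flip: mult.assoc)
      then show ?thesis using True \<Omega>D(1)[of \<xi> 0] fin by simp
    next
      case False
      then have "(\<Sum>e\<in>out_arcs E u. act (Edge e) (act (Ghost e) f) \<xi>) = 0"
        by (intro sum.neutral) auto
      with False show ?thesis by auto
    qed
    then have "act_endo (Vert u) = (\<Sum>e\<in>out_arcs E u. act_endo (Edge e) * act_endo (Ghost e) :: ('k,'e) path_module endo)"
      by (intro endo_eqI ext) (simp add: endo_apply_sum sum_fun_apply del: act.simps)
    then show ?thesis unfolding CK2(1) by (simp add: diff rep.ev_sum rep.ev_mult \<rho>_gen)
  qed (auto simp: diff rep.ev_mult \<rho>_gen rep.ev_0 \<Omega>D(1) idrop_in icons_in tail_idrop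
      lmon_mult lmon_cancel intro!: endo_eqI ext)
qed

lemma lpa_hom_\<rho>: "lpa_hom E (\<rho> :: ('k::field,'v,'e) lpa_word_alg \<Rightarrow> _)"
proof (intro lpa_hom.intro lpa_hom_axioms.intro wf_digraph_axioms rep.ev_add rep.ev_mult)
  fix p :: "('k,'v,'e) lpa_word_alg"
  assume "p \<in> rel_ideal E"
  moreover have "rel_ideal E \<subseteq> {p :: ('k,'v,'e) lpa_word_alg. \<rho> p = 0}"
    unfolding rel_ideal_def
  proof (intro ideal_gen_minimal Un_least subsetI CollectI)
    show "two_sided {p :: ('k,'v,'e) lpa_word_alg. \<rho> p = 0}"
      by (rule two_sidedI) (auto simp: rep.ev_0 rep.ev_add rep.ev_uminus rep.ev_mult)
    fix r :: "('k,'v,'e) lpa_word_alg" assume "r \<in> gen ` (- lpa_gens E)"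
    then obtain g where g: "r = gen g" "g \<notin> lpa_gens E" by auto
    have "act g f \<xi> = 0" for f :: "('k,'e) path_module" and \<xi>
      using g(2) \<Omega>D(1)[of \<xi> 0] by (cases g) auto
    then show "\<rho> r = 0" unfolding g(1) \<rho>_gen by (intro endo_eqI ext) simp
  qed (rule \<rho>_relations)
  ultimately show "\<rho> p = 0" by blast
qed

text \<open>Linearity over all Laurent polynomials, beyond the base field, is what lets the value at
  \<open>cyc\<close> be pulled out in \<open>\<theta>_across\<close>.\<close>

lemma \<rho>_scal:
  fixes p :: "('k::field,'v,'e) lpa_word_alg"
  shows "endo_apply (\<rho> p) (scal a f) = scal a (endo_apply (\<rho> p) f)"
proof -
  have *: "endo_apply (prod_list (map act_endo w)) (scal a f) = scal a (endo_apply (prod_list (map act_endo w)) f)" for w and f :: "('k,'e) path_module"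
    by (induction w) (auto simp: act_scal)
  have scal_sum: "scal a (sum g A) = (\<Sum>i\<in>A. scal a (g i))" for g :: "('v,'e) lpa_gen list \<Rightarrow> ('k,'e) path_module" and A
    by (rule ext) (simp add: scal_def sum_fun_apply sum_distrib_left)
  show ?thesis
    unfolding rep.ev_def
    by (simp add: endo_apply_sum * scal_sum) (simp add: scal_def[abs_def] mult.left_commute)
qed

definition \<delta> :: "('k::field,'e) path_module" where
  "\<delta> = (\<lambda>\<xi>. if \<xi> = cyc then 1 else 0)"

text \<open>The diagonal matrix entry of \<open>\<rho> p\<close> at the periodic path.\<close>

definition \<theta> :: "('k::field,'v,'e) lpa_word_alg \<Rightarrow> int \<Rightarrow>\<^sub>0 'k" where
  "\<theta> p = endo_apply (\<rho> p) \<delta> cyc"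

lemma \<theta>_add: "\<theta> (p + q) = \<theta> p + \<theta> q"
  and \<theta>_uminus: "\<theta> (- p) = - \<theta> p"
  and \<theta>_0: "\<theta> 0 = 0"
  by (simp_all add: \<theta>_def rep.ev_add rep.ev_uminus rep.ev_0)

lemma \<theta>_diff: "\<theta> (p - q) = \<theta> p - \<theta> q"
  using \<theta>_add[of p "- q"] by (simp add: \<theta>_uminus)

lemma \<theta>_sum: "\<theta> (sum f A) = (\<Sum>i\<in>A. \<theta> (f i))"
  by (induction A rule: infinite_finite_induct) (auto simp: \<theta>_add \<theta>_0)

lemma \<theta>_1: "\<theta> 1 = 1"
proof -
  have "\<rho> 1 = (1 :: ('a::field,'e) path_module endo)"
    unfolding const_1[symmetric] rep.ev_single by (simp add: rep.sc_1)
  then show ?thesis by (simp add: \<theta>_def \<delta>_def)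
qed

lemma \<theta>_const: "\<theta> (const k * p) = Poly_Mapping.single 0 k * \<theta> p"
  by (simp add: \<theta>_def rep.ev_mult rep.ev_single scal_def)

text \<open>The vertex \<open>v\<close> acts as a projection of rank one, so \<open>\<theta>\<close> is multiplicative across it.\<close>

lemma \<rho>_v: "endo_apply (\<rho> (gen (Vert v))) f = scal (f cyc) \<delta>"
proof
  fix \<xi>
  have "\<xi> \<in> \<Omega> \<and> tail E (\<xi> 0) = v \<longleftrightarrow> \<xi> = cyc"
    using \<Omega>_from_v cyc_in cyc_valid(3) by blast
  then show "endo_apply (\<rho> (gen (Vert v))) f \<xi> = scal (f cyc) \<delta> \<xi>"
    by (simp add: \<rho>_gen scal_def \<delta>_def)
qed

lemma \<theta>_across: "\<theta> (p * gen (Vert v) * q) = \<theta> p * \<theta> q"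
  unfolding \<theta>_def rep.ev_mult endo_simps \<rho>_v \<rho>_scal by (simp add: scal_def mult.commute)

lemma \<theta>_corner: "\<theta> (r * (gen (Vert v) * p * gen (Vert v)) * s) = \<theta> r * \<theta> p * \<theta> s"
  using \<theta>_across[of r "p * gen (Vert v) * s"] \<theta>_across[of p s] by (simp add: mult.assoc)

lemma \<rho>_pth:
  assumes "awalk u p w" "\<xi> \<in> \<Omega>"
  shows "endo_apply (\<rho> (pth E u p)) f \<xi> =
    (if tail E (\<xi> 0) = u \<and> (\<forall>i<length p. \<xi> i = p ! i)
     then lmon (int (length p)) * f (idrop (length p) \<xi>) else 0)"
  using assms
proof (induction p arbitrary: u \<xi>)
  case Nil
  then show ?case by (simp add: \<rho>_gen)
next
  case (Cons e p)
  then have e: "e \<in> arcs E" "u = tail E e" "awalk (head E e) p w" by (auto simp: awalk_Cons_iff)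
  have all: "(\<forall>i<length (e # p). \<xi> i = (e # p) ! i) \<longleftrightarrow> \<xi> 0 = e \<and> (\<forall>i<length p. idrop 1 \<xi> i = p ! i)"
    by (auto simp: idrop_def nth_Cons less_Suc_eq_0_disj split: nat.splits)
  have tl: "tail E (idrop 1 \<xi> 0) = head E (\<xi> 0)" using \<Omega>D(2)[OF Cons.prems(2), of 0] by (simp add: idrop_def)
  show ?case
    unfolding pth.simps rep.ev_mult endo_simps \<rho>_gen apply_act act.simps all
    using Cons.IH[OF e(3) idrop_in[OF Cons.prems(2), of 1]] Cons.prems(2) tl e(2)
    by (auto simp: lmon_mult idrop_idrop add.commute simp flip: mult.assoc)
qed

lemma \<theta>_pth:
  assumes "awalk v p w"
  shows "\<theta> (pth E v p) = (if (\<forall>i<length p. cyc i = p ! i) \<and> idrop (length p) cyc = cyc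
    then lmon (int (length p)) else 0)"
  using \<rho>_pth[OF assms cyc_in, of \<delta>] cyc_valid(3) by (auto simp: \<theta>_def \<delta>_def)

lemma \<theta>_cycle: "\<theta> (pth E v c) = lmon (int (length c))"
  using \<theta>_pth[OF cw(1)] idrop_cyc by (simp add: cyc_def)

lemma \<theta>_v: "\<theta> (gen (Vert v)) = 1"
  using \<theta>_across[of 1 1] by (simp add: \<theta>_1)

lemma v_not_P_K: "v \<notin> P_K E"
  using csp unique path_ge_refl[of v] awalk_hd_in_verts[OF cw(1)] unfolding P_K_iff tree_def by blast

text \<open>The largest two-sided ideal on which \<open>\<theta>\<close> vanishes.\<close>

definition \<theta>_kernel :: "('k::field,'v,'e) lpa_word_alg set" where
  "\<theta>_kernel = {p. \<forall>r s. \<theta> (r * p * s) = 0}"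

text \<open>Applied with \<open>0\<close>, which gives \<open>\<theta>_kernel\<close>, and with a
  value and its square, to compare an ideal with its square.\<close>

lemma two_sided_divisible:
  "two_sided {p :: ('k::field,'v,'e) lpa_word_alg. \<forall>r s. g dvd \<theta> (r * p * s)}" (is "two_sided ?D")
proof (rule two_sidedI)
  show "x + y \<in> ?D" if "x \<in> ?D" "y \<in> ?D" for x y
    using that by (simp add: distrib_left distrib_right \<theta>_add)
  show "t * x \<in> ?D" if "x \<in> ?D" for t x
  proof (intro CollectI allI)
    fix r s show "g dvd \<theta> (r * (t * x) * s)"
      using that[THEN CollectD, rule_format, of "r * t" s] by (simp add: mult.assoc)
  qed
  show "x * t \<in> ?D" if "x \<in> ?D" for t x
  proof (intro CollectI allI)
    fix r s show "g dvd \<theta> (r * (x * t) * s)"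
      using that[THEN CollectD, rule_format, of r "t * s"] by (simp add: mult.assoc)
  qed
qed (auto simp: \<theta>_0 \<theta>_uminus)

lemma \<theta>_kernel_eq: "\<theta>_kernel = {p. \<forall>r s. 0 dvd \<theta> (r * p * s)}"
  by (simp add: \<theta>_kernel_def)

lemma two_sided_\<theta>_kernel: "two_sided (\<theta>_kernel :: ('k::field,'v,'e) lpa_word_alg set)"
  unfolding \<theta>_kernel_eq by (rule two_sided_divisible)

lemma \<rho>_0_\<theta>: "\<rho> p = 0 \<Longrightarrow> \<theta> (r * p * s) = 0"
  by (simp add: \<theta>_def rep.ev_mult)

lemma \<rho>_0_\<theta>_kernel: "\<rho> p = 0 \<Longrightarrow> p \<in> \<theta>_kernel"
  by (simp add: \<theta>_kernel_def \<rho>_0_\<theta>)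

lemma \<rho>_rel_ideal: "p \<in> rel_ideal E \<Longrightarrow> \<rho> p = 0"
  using lpa_hom.h_rel[OF lpa_hom_\<rho>] .

text \<open>A path in \<open>\<Omega>\<close> leads to \<open>v\<close>, so by heredity it meets no
  vertex of \<open>P_K E\<close>. Hence vertices of \<open>P_K E\<close> act as 0, and at a breaking
  vertex the first edge of a path is always among the finitely many subtracted ones.\<close>

lemma exchange_gens_\<theta>_kernel: "exchange_gens E \<subseteq> (\<theta>_kernel :: ('k::field,'v,'e) lpa_word_alg set)"
proof -
  have diff: "\<rho> (p - q) = \<rho> p - \<rho> q" for p q :: "('k,'v,'e) lpa_word_alg"
    using rep.ev_add[of p "- q"] by (simp add: rep.ev_uminus)
  have out: "tail E (\<xi> 0) \<notin> P_K E" if "\<xi> \<in> \<Omega>" for \<xi>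
    using \<Omega>_path_ge[OF that] P_K_hereditary v_not_P_K by (auto simp: path_ge_def)
  have "\<rho> (gen (Vert w) :: ('k,'v,'e) lpa_word_alg) = 0" if "w \<in> P_K E" for w
    unfolding \<rho>_gen using out that by (intro endo_eqI ext) auto
  moreover have "\<rho> (vertex_cut E (P_K E) w :: ('k,'v,'e) lpa_word_alg) = 0" if w: "w \<in> breaking_vertices E (P_K E)" for w
  proof (rule endo_eqI, rule ext)
    fix f :: "('k,'e) path_module" and \<xi>
    let ?A = "arcs_leaving_into_compl E (P_K E) w"
    have fin: "finite ?A" using w by (simp add: breaking_vertices_def)
    have sum: "(\<Sum>e\<in>?A. act (Edge e) (act (Ghost e) f) \<xi>) = act (Vert w) f \<xi>"
    proof (cases "\<xi> \<in> \<Omega> \<and> tail E (\<xi> 0) = w")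
      case True
      have "\<xi> 0 \<in> ?A"
        using True out[OF idrop_in[of \<xi> 1]] \<Omega>D[of \<xi> 0] head_in_verts[of "\<xi> 0"] by (auto simp: arcs_leaving_into_compl_def idrop_def)
      have "(\<Sum>e\<in>?A. act (Edge e) (act (Ghost e) f) \<xi>) = (\<Sum>e\<in>?A. if \<xi> 0 = e then f \<xi> else 0)"
        using True idrop_in[of \<xi> 1] \<Omega>D[of \<xi> 0] icons_idrop[of \<xi>]
        by (intro sum.cong) (auto simp: idrop_apply[of _ _ 0] lmon_mult simp flip: mult.assoc)
      then show ?thesis using True \<open>\<xi> 0 \<in> ?A\<close> fin by simp
    next
      case False
      then have "(\<Sum>e\<in>?A. act (Edge e) (act (Ghost e) f) \<xi>) = 0"
        by (intro sum.neutral) (auto simp: arcs_leaving_into_compl_def)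
      with False show ?thesis by auto
    qed
    show "endo_apply (\<rho> (vertex_cut E (P_K E) w)) f \<xi> = endo_apply 0 f \<xi>"
      unfolding vertex_cut_def diff rep.ev_sum rep.ev_mult \<rho>_gen
      by (simp add: endo_apply_sum sum_fun_apply sum del: act.simps)
  qed
  ultimately show ?thesis
    unfolding exchange_gens_def using \<rho>_0_\<theta>_kernel by blast
qed

text \<open>
  If \<open>\<theta>\<close> does not vanish on the ideal of \<open>a\<close>, then the ideal contains an element of the corner at
  \<open>v\<close> whose \<open>\<theta>\<close>-value \<open>g\<close> is a nonzero nonunit; its square ideal only has \<open>\<theta>\<close>-values in \<open>(g\<^sup>2)\<close>.
\<close>

lemma fully_idempotent_\<theta>_kernel:
  fixes a :: "('k::field,'v,'e) lpa_word_alg"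
  assumes idem: "fully_idempotent_word E a" and a: "a \<in> free_carrier E"
  shows "a \<in> \<theta>_kernel"
proof (rule ccontr)
  assume "a \<notin> \<theta>_kernel"
  then obtain x y where xy: "\<theta> (x * a * y) \<noteq> 0" by (auto simp: \<theta>_kernel_def)
  let ?v = "gen (Vert v) :: ('k,'v,'e) lpa_word_alg"
  \<comment> \<open>The last factor has value \<open>1 - lmon (int (length c))\<close> and forces a
    nonunit; the \<open>?v\<close> before it lets \<open>\<theta>_across\<close> split the
    value.\<close>
  define z where "z = x * a * y * ?v * (1 - pth E v c)"
  \<comment> \<open>The outer vertices give the product formula \<open>\<theta>_corner\<close>;
    \<open>retract\<close> returns the element to the algebra of \<open>E\<close> without changing
    its action.\<close>
  define b where "b = retract E (?v * z * ?v)"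
  define g where "g = \<theta> z"
  have g: "g = \<theta> (x * a * y) * (1 - lmon (int (length c)))"
    by (simp add: g_def z_def \<theta>_across \<theta>_diff \<theta>_1 \<theta>_cycle)
  have "1 - lmon (int (length c)) \<noteq> (0 :: int \<Rightarrow>\<^sub>0 'k)"
  proof
    assume "1 - lmon (int (length c)) = (0 :: int \<Rightarrow>\<^sub>0 'k)"
    then have "lmon 0 = (lmon (int (length c)) :: int \<Rightarrow>\<^sub>0 'k)" by simp
    then have "Poly_Mapping.lookup (lmon 0 :: int \<Rightarrow>\<^sub>0 'k) 0 = Poly_Mapping.lookup (lmon (int (length c))) 0"
      by (rule arg_cong)
    then show False using cw(3) by (simp add: lookup_single when_def)
  qed
  then have g0: "g \<noteq> 0" using xy g by simp
  have ng: "\<not> g dvd 1" using one_minus_lmon_not_unit g by (metis dvd_mult_right)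
  have diff: "\<rho> (p - q) = \<rho> p - \<rho> q" for p q :: "('k,'v,'e) lpa_word_alg"
    using rep.ev_add[of p "- q"] by (simp add: rep.ev_uminus)
  have \<rho>b: "\<rho> b = \<rho> (?v * z * ?v)"
    using \<rho>_rel_ideal[OF retract_cong[of "?v * z * ?v" E]] by (simp add: b_def diff)
  have \<theta>b: "\<theta> (r * b * s) = \<theta> r * g * \<theta> s" for r s
  proof -
    have "\<theta> (r * b * s) = \<theta> (r * (?v * z * ?v) * s)" by (simp add: \<theta>_def rep.ev_mult \<rho>b)
    then show ?thesis by (simp add: \<theta>_corner g_def)
  qed
  have bf: "b \<in> free_carrier E"
    unfolding b_def by (rule retract_in_free) (simp add: lookup_Nil_mult gen_def lookup_single)
  let ?A = "ideal_gen (rel_ideal E \<union> {a})"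
  note A = two_sided_ideal_gen[of "rel_ideal E \<union> {a}"]
  have "a \<in> ?A" by (rule ideal_gen_incl) simp
  then have vzv: "?v * z * ?v \<in> ?A"
    unfolding z_def by (intro two_sided_lmult[OF A] two_sided_rmult[OF A])
  have "?v * z * ?v - b \<in> ?A"
    unfolding b_def by (intro ideal_gen_incl UnI1 retract_cong)
  then have "?v * z * ?v - (?v * z * ?v - b) \<in> ?A"
    using vzv two_sided_diff[OF A] by blast
  then have bA: "b \<in> ?A \<inter> free_carrier E" using bf by simp
  let ?B = "ideal_gen (rel_ideal E \<union> {b})"
  let ?Y = "{p :: ('k,'v,'e) lpa_word_alg. \<forall>r s. g dvd \<theta> (r * p * s)}"
  have BY: "?B \<subseteq> ?Y"
    by (rule ideal_gen_minimal[OF two_sided_divisible]) (auto simp: \<theta>b \<rho>_0_\<theta> \<rho>_rel_ideal)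
  \<comment> \<open>Products are treated one factor at a time: \<open>?Z\<close> collects the
    elements that contribute a second factor \<open>g\<close> in front of any \<open>t\<close> in
    \<open>?Y\<close>.\<close>
  let ?Z = "{s. \<forall>t\<in>?Y. \<forall>r r'. g * g dvd \<theta> (r * s * t * r')}"
  have "two_sided ?Z"
  proof (rule two_sidedI)
    show "p + q \<in> ?Z" if "p \<in> ?Z" "q \<in> ?Z" for p q
      using that by (simp add: distrib_left distrib_right \<theta>_add)
    show "q * p \<in> ?Z" if "p \<in> ?Z" for q p
    proof (intro CollectI ballI allI)
      fix t r r' assume "t \<in> ?Y"
      then show "g * g dvd \<theta> (r * (q * p) * t * r')"
        using that[THEN CollectD, rule_format, of t "r * q" r'] by (simp add: mult.assoc)
    qed
    show "p * q \<in> ?Z" if "p \<in> ?Z" for q p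
    proof (intro CollectI ballI allI)
      fix t r r' assume "t \<in> ?Y"
      then have "q * t \<in> ?Y" by (rule two_sided_lmult[OF two_sided_divisible])
      then show "g * g dvd \<theta> (r * (p * q) * t * r')"
        using that[THEN CollectD, rule_format, of "q * t" r r'] by (simp add: mult.assoc)
    qed
  qed (auto simp: \<theta>_0 \<theta>_uminus)
  moreover have "rel_ideal E \<subseteq> ?Z"
  proof (intro subsetI CollectI ballI allI)
    fix p t r r' :: "('k,'v,'e) lpa_word_alg" assume "p \<in> rel_ideal E"
    then show "g * g dvd \<theta> (r * p * t * r')"
      using \<rho>_0_\<theta>[OF \<rho>_rel_ideal, of p r "t * r'"] by (simp add: mult.assoc)
  qed
  moreover have "b \<in> ?Z"
  proof (intro CollectI ballI allI)
    fix t r r' :: "('k,'v,'e) lpa_word_alg" assume "t \<in> ?Y"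
    then have "g dvd \<theta> (1 * t * r')" by blast
    then show "g * g dvd \<theta> (r * b * t * r')"
      using \<theta>b[of r "t * r'"] by (auto simp: mult.assoc intro: dvd_mult mult_dvd_mono)
  qed
  ultimately have BZ: "?B \<subseteq> ?Z" by (intro ideal_gen_minimal) auto
  have "b \<in> ideal_gen (rel_ideal E \<union> {s * t | s t. s \<in> ?B \<inter> free_carrier E \<and> t \<in> ?B \<inter> free_carrier E})"
    using idem bA unfolding fully_idempotent_word_def[OF wf_digraph_axioms] by blast
  also have "\<dots> \<subseteq> {p. \<forall>r s. g * g dvd \<theta> (r * p * s)}"
  proof (rule ideal_gen_minimal[OF two_sided_divisible], intro Un_least subsetI CollectI allI)
    fix p r s :: "('k,'v,'e) lpa_word_alg" assume "p \<in> rel_ideal E"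
    then show "g * g dvd \<theta> (r * p * s)" by (simp add: \<rho>_0_\<theta> \<rho>_rel_ideal)
  next
    fix p r r' :: "('k,'v,'e) lpa_word_alg" assume "p \<in> {s * t | s t. s \<in> ?B \<inter> free_carrier E \<and> t \<in> ?B \<inter> free_carrier E}"
    then obtain s t where st: "p = s * t" "s \<in> ?Z" "t \<in> ?Y" using BZ BY by blast
    then show "g * g dvd \<theta> (r * p * r')"
      by (simp add: mult.assoc[symmetric])
  qed
  finally have "g * g dvd \<theta> (1 * b * 1)" by blast
  then have "g * g dvd g * 1" unfolding \<theta>b by (simp add: \<theta>_1)
  \<comment> \<open>The Laurent polynomials form a domain, so one factor \<open>g\<close>
    cancels.\<close>
  then have "g dvd 1" using g0 unfolding dvd_mult_cancel_left by blast
  then show False using ng by contradiction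
qed

text \<open>A path \<open>p\<close> from \<open>u\<close> to \<open>v\<close> gives
  \<open>p^* u p = v\<close>, and \<open>\<theta>\<close> takes the value 1 at
  \<open>v\<close>.\<close>

lemma vertex_above_not_in_\<theta>_kernel:
  assumes "path_ge E u v"
  shows "gen (Vert u) \<notin> (\<theta>_kernel :: ('k::field,'v,'e) lpa_word_alg set)"
proof
  interpret lpa_hom E "\<rho> :: ('k,'v,'e) lpa_word_alg \<Rightarrow> _" by (rule lpa_hom_\<rho>)
  obtain p where p: "awalk u p v" using assms by (auto simp: path_ge_def)
  have "G u p * V u * P u p = V v" by (simp add: mult.assoc V_P[OF p] G_P[OF p])
  then have "\<rho> (gth E u p * gen (Vert u) * pth E u p) = \<rho> (gen (Vert v) :: ('k,'v,'e) lpa_word_alg)"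
    by (simp only: rep.ev_mult)
  then have "\<theta> (gth E u p * gen (Vert u) * pth E u p) = (1 :: int \<Rightarrow>\<^sub>0 'k)"
    using \<theta>_v by (simp add: \<theta>_def)
  moreover assume "gen (Vert u) \<in> (\<theta>_kernel :: ('k,'v,'e) lpa_word_alg set)"
  ultimately show False by (simp add: \<theta>_kernel_def)
qed

end

section \<open>The exchange ideal is the common kernel\<close>

context wf_digraph
begin

text \<open>Appending the closed path at \<open>u\<close> to the path from \<open>v\<close> to
  \<open>u\<close> guarantees a first edge even if \<open>u = v\<close>; the head of this edge lies
  in \<open>P_K G\<close> and reaches \<open>u\<close>.\<close>

lemma P_K_of_out_arcs:
  assumes "v \<in> verts G" "\<And>e. e \<in> out_arcs G v \<Longrightarrow> head G e \<in> P_K G"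
  shows "v \<in> P_K G"
  unfolding P_K_iff
proof (intro conjI ballI allI impI)
  fix u c assume u: "u \<in> tree G v" and c: "closed_simple_path G u c"
  have cw: "awalk u c u" "c \<noteq> []" using c by (auto simp: closed_simple_path_def)
  obtain p where p: "awalk v p u" using u by (auto simp: tree_def path_ge_def)
  obtain e q where eq: "p @ c = e # q" using cw(2) by (cases "p @ c") auto
  have "awalk v (e # q) u" using awalk_appendI[OF p cw(1)] by (simp only: eq)
  then have e: "e \<in> out_arcs G v" "awalk (head G e) q u" by (auto simp: awalk_Cons_iff)
  then have "u \<in> tree G (head G e)" by (auto simp: tree_def path_ge_def)
  then show "\<exists>d. closed_simple_path G u d \<and> d \<noteq> c"
    using assms(2)[OF e(1)] c unfolding P_K_iff by blast
qed (rule assms(1))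

lemma not_P_K_cycle:
  assumes "v \<in> verts G" "v \<notin> P_K G"
  obtains u c where "path_ge G v u" "unique_cycle G u c"
proof -
  obtain u c where u: "u \<in> tree G v" and c: "closed_simple_path G u c"
      "\<And>d. closed_simple_path G u d \<Longrightarrow> d = c"
    using assms unfolding P_K_iff by blast
  have "unique_cycle G u c" by unfold_locales (rule c)+
  then show thesis using that u by (auto simp: tree_def)
qed

end

section \<open>Cuts that survive when the exchange generators are killed\<close>

context lpa_hom
begin

context
  assumes kills: "\<And>p. p \<in> exchange_gens E \<Longrightarrow> h p = 0"
begin

lemma V_P_K: "w \<in> P_K E \<Longrightarrow> V w = 0"
  by (rule kills) (simp add: exchange_gens_def)

text \<open>If all edges outside \<open>Y\<close> led into \<open>P_K E\<close>, then the edges from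
  \<open>v\<close> that stay outside \<open>P_K E\<close> would be finite in number, and the
  remaining ones vanish in the image. So \<open>v\<close> would equal the sum over them: trivially
  if \<open>v\<close> is in \<open>P_K E\<close>, by \<open>CK2\<close> if \<open>v\<close> is
  regular, and otherwise because \<open>v\<close> is a breaking vertex. This is where the elements
  \<open>vertex_cut\<close> enter.\<close>

lemma edge_cut_escapes:
  assumes "v \<in> verts E" "finite Y" "Y \<subseteq> out_arcs E v" "V v \<noteq> (\<Sum>e\<in>Y. Ed e * Gh e)"
  shows "\<exists>f\<in>out_arcs E v - Y. head E f \<notin> P_K E"
proof (rule ccontr)
  assume no: "\<not> ?thesis"
  let ?A = "arcs_leaving_into_compl E (P_K E) v"
  have AY: "?A \<subseteq> Y" using no by (auto simp: arcs_leaving_into_compl_def)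
  have A: "?A \<subseteq> out_arcs E v" by (auto simp: arcs_leaving_into_compl_def)
  have zero: "Ed e * Gh e = 0" if "e \<in> out_arcs E v - ?A" for e
  proof -
    have "e \<in> arcs E" "head E e \<in> P_K E" using that by (auto simp: arcs_leaving_into_compl_def)
    then show ?thesis using Ed_V[of e] V_P_K[of "head E e"] by simp
  qed
  have "(\<Sum>e\<in>?A. Ed e * Gh e) = (\<Sum>e\<in>Y. Ed e * Gh e)"
    using assms(2,3) AY zero by (intro sum.mono_neutral_left) auto
  then have neq: "V v \<noteq> (\<Sum>e\<in>?A. Ed e * Gh e)" using assms(4) by simp
  have "v \<notin> P_K E"
  proof
    assume v: "v \<in> P_K E"
    have "Ed e * Gh e = 0" if "e \<in> ?A" for e
    proof -
      have "e \<in> arcs E" "tail E e = v" using that by (auto simp: arcs_leaving_into_compl_def)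
      then show ?thesis using V_Ed[of e] V_P_K[OF v] by simp
    qed
    then show False using neq V_P_K[OF v] by simp
  qed
  then have "?A \<noteq> {}"
    using P_K_of_out_arcs[OF assms(1)] by (fastforce simp: arcs_leaving_into_compl_def)
  show False
  proof (cases "finite (out_arcs E v)")
    case True
    then have "regular E v"
      using assms(1) \<open>?A \<noteq> {}\<close> A by (auto simp: regular_def sink_def infinite_emitter_def)
    then have "V v = (\<Sum>e\<in>out_arcs E v. Ed e * Gh e)" by (rule V_regular)
    also have "\<dots> = (\<Sum>e\<in>?A. Ed e * Gh e)"
      using True A zero by (intro sum.mono_neutral_right) auto
    finally show False using neq by contradiction
  next
    case False
    have "v \<in> breaking_vertices E (P_K E)"
      using assms(1) \<open>v \<notin> P_K E\<close> \<open>?A \<noteq> {}\<close> False finite_subset[OF AY assms(2)]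
      by (simp add: breaking_vertices_def infinite_emitter_def)
    then have "h (vertex_cut E (P_K E) v) = 0" by (intro kills) (simp add: exchange_gens_def)
    then show False using neq by (simp add: h_vertex_cut)
  qed
qed

text \<open>Sort \<open>X\<close> by first edges. If the remaining cut at the head of one of them
  survives, the induction continues there. If all of them vanish, the sum over \<open>X\<close>
  collapses to the sum over the first edges, and \<open>edge_cut_escapes\<close> supplies a single
  edge.\<close>

lemma cut_escapes:
  assumes "path_antichain E v X" "h (path_cut E v X) \<noteq> 0"
  shows "\<exists>s w. awalk v s w \<and> w \<notin> P_K E \<and> (\<forall>t\<in>X. s \<parallel> t)"
  using assms
proof (induction "\<Sum>t\<in>X. Suc (length t)" arbitrary: v X rule: less_induct)
  case less
  note X = less.prems(1)[unfolded path_antichain_def]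
  have v: "v \<in> verts E" and fin: "finite X" using X by auto
  show ?case
  proof (cases "X = {}")
    case True
    then have "V v \<noteq> 0" using less.prems(2) by (simp add: h_cut)
    then show ?thesis using V_P_K v True by (intro exI[of _ "[]"] exI[of _ v]) (auto simp: awalk_Nil_iff)
  next
    case False
    have "[] \<notin> X"
    proof
      assume N: "[] \<in> X"
      \<comment> \<open>The trivial path is a prefix of every path, so no other path is incomparable
        with it.\<close>
      then have "X = {[]}" using X by fastforce
      then have "h (path_cut E v X) = 0" by (simp add: h_cut V_idem[OF v])
      then show False using less.prems(2) by simp
    qed
    let ?Y = "hd ` X"
    let ?X = "\<lambda>e. {t. e # t \<in> X}"
    have XC: "t = hd t # tl t" if "t \<in> X" for t using that \<open>[] \<notin> X\<close> by (cases t) auto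
    have Y: "e \<in> out_arcs E v" if e: "e \<in> ?Y" for e
    proof -
      obtain t w where t: "t \<in> X" "e = hd t" "awalk v t w" using e X by blast
      then have "awalk v (hd t # tl t) w" using XC by metis
      then show ?thesis using t(2) by (auto simp: awalk_Cons_iff)
    qed
    have fX: "finite (?X e)" for e
      by (rule finite_subset[of _ "tl ` X"]) (use fin in force)+
    show ?thesis
    proof (cases "\<exists>e\<in>?Y. h (path_cut E (head E e) (?X e)) \<noteq> 0")
      case True
      then obtain e where e: "e \<in> ?Y" "h (path_cut E (head E e) (?X e)) \<noteq> 0" by blast
      have ac: "path_antichain E (head E e) (?X e)"
        unfolding path_antichain_def
      proof (intro conjI ballI impI)
        show "head E e \<in> verts E" using Y[OF e(1)] by auto
        show "\<exists>w. awalk (head E e) t w" if t: "t \<in> ?X e" for t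
        proof -
          obtain w where "awalk v (e # t) w" using X t by blast
          then show ?thesis by (auto simp: awalk_Cons_iff)
        qed
        show "s \<parallel> t" if "s \<in> ?X e" "t \<in> ?X e" "s \<noteq> t" for s t
        proof -
          have "(e # s) \<parallel> (e # t)" using X that by simp
          then show ?thesis by (simp add: parallel_def)
        qed
      qed (rule fX)
      have inj: "inj_on (Cons e) (?X e)" by simp
      have "(\<Sum>t\<in>?X e. Suc (length t)) < (\<Sum>t\<in>?X e. Suc (length (e # t)))"
      proof (rule sum_strict_mono)
        obtain t where t: "t \<in> X" "e = hd t" using e(1) by blast
        then have "e # tl t \<in> X" using XC[OF t(1)] by metis
        then show "?X e \<noteq> {}" by blast
      qed (use fX in auto)
      also have "\<dots> = (\<Sum>t\<in>Cons e ` ?X e. Suc (length t))"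
        unfolding sum.reindex[OF inj] by simp
      also have "\<dots> \<le> (\<Sum>t\<in>X. Suc (length t))" using fin by (intro sum_mono2) auto
      finally obtain s w where s: "awalk (head E e) s w" "w \<notin> P_K E" "\<forall>t\<in>?X e. s \<parallel> t"
        using less.hyps[OF _ ac e(2)] by blast
      have "awalk v (e # s) w" using s(1) Y[OF e(1)] by (auto simp: awalk_Cons_iff)
      moreover have "(e # s) \<parallel> t" if t: "t \<in> X" for t
      proof -
        obtain f t' where ft: "t = f # t'" using XC[OF t] by blast
        then show ?thesis using s(3) t by (cases "f = e") (auto simp: parallel_def)
      qed
      ultimately show ?thesis using s(2) by blast
    next
      case False
      have sumX: "(\<Sum>t\<in>X. P v t * G v t) = (\<Sum>e\<in>?Y. \<Sum>t\<in>?X e. P v (e # t) * G v (e # t))"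
      proof -
        have "(\<Sum>e\<in>?Y. \<Sum>t\<in>?X e. P v (e # t) * G v (e # t)) = (\<Sum>e\<in>?Y. \<Sum>t\<in>{t \<in> X. hd t = e}. P v t * G v t)"
        proof (rule sum.cong[OF refl])
          fix e
          have "Cons e ` ?X e = {t \<in> X. hd t = e}" using XC by (auto simp: image_iff) metis
          moreover have "(\<Sum>t\<in>Cons e ` ?X e. P v t * G v t) = (\<Sum>t\<in>?X e. P v (e # t) * G v (e # t))"
            by (subst sum.reindex) (auto simp: inj_on_def)
          ultimately show "(\<Sum>t\<in>?X e. P v (e # t) * G v (e # t)) = (\<Sum>t\<in>{t \<in> X. hd t = e}. P v t * G v t)"
            by simp
        qed
        also have "\<dots> = (\<Sum>t\<in>X. P v t * G v t)"
          using fin by (intro sum.group) auto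
        finally show ?thesis by simp
      qed
      have "(\<Sum>t\<in>?X e. P v (e # t) * G v (e # t)) = Ed e * Gh e" if e: "e \<in> ?Y" for e
      proof -
        have "V (head E e) = (\<Sum>t\<in>?X e. P (head E e) t * G (head E e) t)"
        proof -
          have "h (path_cut E (head E e) (?X e)) = 0" using False e by blast
          then show ?thesis by (simp add: h_cut)
        qed
        then have "Ed e * V (head E e) * Gh e = (\<Sum>t\<in>?X e. P v (e # t) * G v (e # t))"
          by (simp add: sum_distrib_left sum_distrib_right mult.assoc)
        then show ?thesis using Y[OF e] by (simp add: Ed_V)
      qed
      then have "(\<Sum>t\<in>X. P v t * G v t) = (\<Sum>e\<in>?Y. Ed e * Gh e)" unfolding sumX by simp
      then have neq: "V v \<noteq> (\<Sum>e\<in>?Y. Ed e * Gh e)" using less.prems(2) by (simp add: h_cut)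
      have "finite ?Y" "?Y \<subseteq> out_arcs E v" using fin Y by auto
      from edge_cut_escapes[OF v this neq] obtain f
        where f: "f \<in> out_arcs E v - ?Y" "head E f \<notin> P_K E" by blast
      have "awalk v [f] (head E f)" using f(1) by (auto simp: awalk_simps)
      moreover have "[f] \<parallel> t" if t: "t \<in> X" for t
      proof -
        obtain e t' where et: "t = e # t'" using XC[OF t] by blast
        then have "e \<in> ?Y" using t by force
        then show ?thesis using f(1) et by (auto simp: parallel_def)
      qed
      ultimately show ?thesis using f(2) by blast
    qed
  qed
qed

end

end

text \<open>A surviving cut can be conjugated to a vertex outside \<open>P_K E\<close>, which lies
  above a unique cycle and acts nontrivially there. A surviving polynomial is detected by its
  constant term, at the cycle of its own vertex.\<close>

lemma \<theta>_kernels_exchange_ideal: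
  fixes p :: "('k::field,'v,'e) lpa_word_alg"
  assumes wf: "wf_digraph E" and pf: "p \<in> free_carrier E"
    and ker: "\<And>v c. unique_cycle E v c \<Longrightarrow> p \<in> unique_cycle.\<theta>_kernel E c"
  shows "p \<in> exchange_ideal E"
proof (rule ccontr)
  assume pJ: "p \<notin> exchange_ideal E"
  obtain h :: "('k,'v,'e) lpa_word_alg \<Rightarrow> ('k,'v,'e) lpa_word_alg endo"
    where h: "lpa_hom E h" "\<forall>p. h p = 0 \<longleftrightarrow> p \<in> exchange_ideal E"
    using lpa_hom_quotient[OF wf two_sided_exchange_ideal rel_ideal_exchange_ideal] by blast
  interpret lpa_hom E h by (rule h(1))
  have kills: "h q = 0" if "q \<in> exchange_gens E" for q
    using that h(2) unfolding exchange_ideal_def by (blast intro: ideal_gen_incl)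
  have J: "exchange_ideal E \<subseteq> (unique_cycle.\<theta>_kernel E c :: ('k,'v,'e) lpa_word_alg set)"
    if uc: "unique_cycle E v c" for v c
  proof -
    interpret unique_cycle E v c by (rule uc)
    show ?thesis
      unfolding exchange_ideal_def using exchange_gens_\<theta>_kernel \<rho>_0_\<theta>_kernel \<rho>_rel_ideal
      by (intro ideal_gen_minimal two_sided_\<theta>_kernel) auto
  qed
  \<comment> \<open>Each \<open>\<theta>_kernel\<close> contains the exchange ideal, so membership
    depends only on the class under \<open>h\<close> and passes from \<open>p\<close> to its
    multiples.\<close>
  have transfer: "q \<in> unique_cycle.\<theta>_kernel E c"
    if uc: "unique_cycle E v c" and hq: "h q = h (x * p * y)" for q x y v c
  proof -
    interpret unique_cycle E v c by (rule uc)
    have "h (q - x * p * y) = 0" by (simp add: h_diff hq)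
    then have "q - x * p * y \<in> \<theta>_kernel" using h(2) J[OF uc] by blast
    moreover have "x * p * y \<in> \<theta>_kernel"
      using ker[OF uc] by (intro two_sided_lmult two_sided_rmult two_sided_\<theta>_kernel)
    ultimately have "(q - x * p * y) + x * p * y \<in> \<theta>_kernel"
      by (rule two_sided_add[OF two_sided_\<theta>_kernel])
    then show ?thesis by simp
  qed
  have "h p \<noteq> 0" using pJ h(2) by blast
  with pf have "reducible (h p)" by (rule reduction)
  then consider "reduces_to_cut (h p)" | "reduces_to_cycle (h p)"
    unfolding reducible_def by blast
  then show False
  proof cases
    case 1
    then obtain x y v X where *: "path_antichain E v X" "h (path_cut E v X) \<noteq> 0" "h x * h p * h y = h (path_cut E v X)"
      unfolding reduces_to_cut_def by blast
    obtain s w where s: "awalk v s w" "w \<notin> P_K E" "\<forall>t\<in>X. s \<parallel> t"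
      using cut_escapes[OF kills *(1,2)] by blast
    have w: "w \<in> verts E" using s(1) by auto
    obtain u c where u: "path_ge E w u" "unique_cycle E u c" by (rule not_P_K_cycle[OF w s(2)])
    interpret C: unique_cycle E u c by (rule u(2))
    have X: "awalk v t (awlast v t)" "G v s * P v t = 0" if t: "t \<in> X" for t
    proof -
      obtain z where "awalk v t z" using *(1) t by (auto simp: path_antichain_def)
      then show "awalk v t (awlast v t)" "G v s * P v t = 0"
        using G_P_parallel[OF s(1) _ s(3)[rule_format, OF t]] by auto
    qed
    \<comment> \<open>As \<open>s\<close> is incomparable with every \<open>t\<close>, conjugation
      by \<open>s\<close> removes the sum and leaves \<open>s^* s = w\<close>.\<close>
    have "G v s * h (path_cut E v X) * P v s = G v s * V v * P v s - (\<Sum>t\<in>X. (G v s * P v t) * (G v t * P v s))"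
      by (simp add: h_cut left_diff_distrib right_diff_distrib sum_distrib_left sum_distrib_right mult.assoc)
    also have "\<dots> = V w" using X by (simp add: G_V[OF s(1)] G_P[OF s(1)])
    finally have "h (gen (Vert w)) = h ((gth E v s * x) * p * (y * pth E v s))"
      unfolding *(3)[symmetric] by (simp add: h_mult mult.assoc)
    then have "gen (Vert w) \<in> (C.\<theta>_kernel :: ('k,'v,'e) lpa_word_alg set)" by (rule transfer[OF u(2)])
    then show False using C.vertex_above_not_in_\<theta>_kernel[OF u(1)] by contradiction
  next
    case 2
    then obtain x y v k D f c where *: "closed_paths v D" "k \<noteq> 0" "closed_simple_path E v c"
      "V v = P v c * G v c" "h (cycle_poly v k D f) \<noteq> 0" "h x * h p * h y = h (cycle_poly v k D f)"
      unfolding reduces_to_cycle_def by blast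
    have D: "awalk v d v" "d \<noteq> []" if "d \<in> D" for d using *(1) that by (auto simp: closed_paths_def)
    have "V v \<noteq> 0"
    proof
      assume "V v = 0"
      then have "P v d = 0" if "d \<in> D" for d using V_P[OF D(1)[OF that]] by simp
      then show False using *(5) \<open>V v = 0\<close> by (simp add: h_cycle_poly)
    qed
    have uc: "unique_cycle E v c"
      by unfold_locales (rule *(3), erule cycle_unique[OF *(3,4) \<open>V v \<noteq> 0\<close>])
    interpret C: unique_cycle E v c by (rule uc)
    have "cycle_poly v k D f \<in> C.\<theta>_kernel"
      by (rule transfer[OF uc, of _ x y]) (simp add: h_mult *(6))
    then have "C.\<theta> (1 * cycle_poly v k D f * 1) = 0" unfolding C.\<theta>_kernel_def by blast
    then have "Poly_Mapping.lookup (C.\<theta> (cycle_poly v k D f)) 0 = 0" by simp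
    \<comment> \<open>A path of positive length has as \<open>\<theta>\<close>-value 0 or a monomial
      of positive degree, so \<open>k\<close> is the whole coefficient in degree 0.\<close>
    moreover have "Poly_Mapping.lookup (Poly_Mapping.single 0 (f d) * C.\<theta> (pth E v d)) 0 = 0" if "d \<in> D" for d
      using D[OF that] by (simp add: C.\<theta>_pth mult_single lookup_single when_def)
    ultimately show False
      using *(2) by (simp add: cycle_poly_def C.\<theta>_add C.\<theta>_sum C.\<theta>_const C.\<theta>_v lookup_add lookup_sum)
  qed
qed

theorem exchange_ideal_eq_fully_idempotent_part:
  assumes wf: "wf_digraph E"
  shows "rng_ideal_gen (lpa E) (P_ex E) = fully_idempotent_part (lpa E :: ('k::field,'v,'e) lpa_elem ring)"
proof -
  have gen: "rng_ideal_gen (lpa E) (P_ex E) = lpa_class E ` (exchange_ideal E \<inter> free_carrier E :: ('k,'v,'e) lpa_word_alg set)"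
    unfolding P_ex_eq exchange_ideal_def
    by (rule rng_ideal_gen_lpa_class[OF wf exchange_gens_free[OF wf]])
  have iff: "p \<in> exchange_ideal E \<longleftrightarrow> lpa_class E p \<in> fully_idempotent_part (lpa E)"
    if p: "p \<in> free_carrier E" for p :: "('k,'v,'e) lpa_word_alg"
    unfolding fully_idempotent_part_lpa[OF wf p]
    using exchange_ideal_fully_idempotent[OF wf] \<theta>_kernels_exchange_ideal[OF wf p]
      unique_cycle.fully_idempotent_\<theta>_kernel[OF _ _ p] by blast
  show ?thesis
    unfolding gen
  proof (intro equalityI subsetI)
    fix z :: "('k,'v,'e) lpa_elem"
    assume z: "z \<in> fully_idempotent_part (lpa E)"
    then have "z \<in> carrier (lpa E)" by (simp add: fully_idempotent_part_def)
    then obtain p where "p \<in> free_carrier E" "z = lpa_class E p"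
      unfolding lpa_carrier[OF wf] by blast
    then show "z \<in> lpa_class E ` (exchange_ideal E \<inter> free_carrier E)"
      using iff z by blast
  qed (use iff in blast)
qed

theorem corollary6p3:
  fixes E :: "('v,'e) pre_digraph" and F :: "('w,'f) pre_digraph"
    and \<phi> :: "('k::field,'v,'e) lpa_elem \<Rightarrow> ('k,'w,'f) lpa_elem"
  assumes "wf_digraph E" and "wf_digraph F"
    and "\<phi> \<in> rng_iso (lpa E) (lpa F)"
  shows "\<phi> ` rng_ideal_gen (lpa E) (P_ex E) = rng_ideal_gen (lpa F) (P_ex F)"
  unfolding exchange_ideal_eq_fully_idempotent_part[OF assms(1)]
    exchange_ideal_eq_fully_idempotent_part[OF assms(2)]
  by (rule fully_idempotent_part_image[OF rng_lpa[OF assms(1)] rng_lpa[OF assms(2)] assms(3)])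

end
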